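(* Let $N,n,C\ge 1$. For each $c\in[C]$ let $\{X_{c,1},\dots,X_{c,n}\}$ be a set of $N\times N$ quaternionic random matrices, the sets for different $c$ being independent of each other. Suppose that for each $c$ there is a function $f_c$, with complex values, defined on $\mathrm{PM}(I)$ for every $I\subseteq[n]$, such that for every $I\subseteq[n]$ and all $\iota:\pm I\to[N]$, $\eta:\pm I\to\{1,-1\}$, $$\mathbb{E}\Big(\prod_{k\in I}X^{(c,k)}_{\iota_k,\iota_{-k};\eta_k,\eta_{-k}}\Big)=\sum_{\substack{\alpha\in\mathrm{PM}(I)\\ \iota=\iota\circ\delta\alpha\\ \mathrm{sgn}\cdot\eta=(\mathrm{sgn}\circ\alpha)\cdot(\eta\circ\delta\alpha)}}\Big[\prod_{\substack{k\in I\\ -k\in\mathrm{FD}(\alpha)}}\eta_k\eta_{-k}\Big](2N)^{\#(\alpha)/2-|I|}f_c(\alpha).$$ Let $\varphi_{\mathrm{Re}},\varphi_{\mathrm{tr}}\in S_n$, let $w:[n]\to[C]$, put $X_k=X_{w(k),k}$, and let $\varepsilon:[n]\to\{1,-1\}$. Let $Y_1,\dots,Y_n$ be $N\times N$ quaternionic random matrices independent from the $X_k$. Then $$\mathbb{E}\big(\mathrm{Re}_{\varphi_{\mathrm{Re}}}\mathrm{tr}_{\varphi_{\mathrm{tr}}}(X_1^{(\varepsilon_1)}Y_1,\dots,X_n^{(\varepsilon_n)}Y_n)\big)$$ $$=\sum_{\substack{\alpha=\alpha_1\cdots\alpha_C\\ \alpha_c\in\mathrm{PM}(w^{-1}(c))}}(-2)^{\chi(\varphi_{\mathrm{Re}},\delta_\varepsilon\alpha\delta_\varepsilon)-2\#(\varphi_{\mathrm{Re}})}N^{\chi(\varphi_{\mathrm{tr}},\delta_\varepsilon\alpha\delta_\varepsilon)-2\#(\varphi_{\mathrm{tr}})}f_1(\alpha_1)\cdots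 f_C(\alpha_C)$$ $$\qquad\times\,\mathbb{E}\big(\mathrm{Re}_{\mathrm{FD}(K(\varphi_{\mathrm{Re}},\delta_\varepsilon\alpha\delta_\varepsilon)^{-1})}\mathrm{tr}_{\mathrm{FD}(K(\varphi_{\mathrm{tr}},\delta_\varepsilon\alpha\delta_\varepsilon)^{-1})}(Y_1,\dots,Y_n)\big).$$
   Context: Quaternions. $a+bi+cj+dk$ is represented by the $2\times2$ complex matrix $\begin{pmatrix}a+bi&c+di\\-c+di&a-bi\end{pmatrix}$, rows and columns indexed by $1,-1$ in this order. For a quaternionic matrix $A$, $A_{\iota_1,\iota_2;\eta_1,\eta_2}$ is the $(\eta_1,\eta_2)$ entry of the $2\times 2$ matrix representing the quaternion in position $(\iota_1,\iota_2)$. $A^*$ is the conjugate transpose. For matrices $A_1,A_2,\dots$ write $A^{(k)}$ for $A_k$ and $A^{(-k)}$ for $A_k^*$ when indices are attached; $X^{(c,k)}$ means $X_{c,k}$. $X_k^{(\varepsilon_k)}$ is $X_k$ if $\varepsilon(k)=1$ and $X_k^*$ if $\varepsilon(k)=-1$. Permutations. $[n]=\{1,\dots,n\}$, $\pm I=I\cup(-I)$. $S(I)$ is the group of permutations of $I$, $S_n=S([n])$, acting right to left. $\#(\pi)$ is the number of orbits of $\pi$. $\delta:k\mapsto-k$. $\mathrm{sgn}(k)$ is the sign of the integer $k$; $\cdot$ is pointwise multiplication of functions. $\delta_\varepsilon:\pm[n]\to\pm[n]$ is $k\mapsto\varepsilon(|k|)k$. Permutations are extended by the identity where needed. $\mathrm{PM}(I)$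 is the set of $\pi\in S(\pm I)$ with $\delta\pi\delta=\pi^{-1}$ and with no $k$ and $-k$ in the same cycle; $\mathrm{PM}(n)=\mathrm{PM}([n])$. The cycles of $\pi\in\mathrm{PM}(I)$ come in pairs (order and signs reversed); $\mathrm{FD}(\pi)$ is the product of those cycles, one chosen from each pair, in which the element of smallest absolute value appears with positive sign, viewed as a permutation on the elements of these cycles; $\mathrm{FD}(\pi)$ also denotes that set of elements. So $\#(\mathrm{FD}(\pi))=\#(\pi)/2$. For $\varphi_+\in S(I)$ (with $I$ never containing both $k$ and $-k$) let $\varphi_-=\delta\varphi_+\delta$. For $\alpha\in\mathrm{PM}(I)$, $K(\varphi_+,\alpha)=\varphi_+^{-1}\alpha^{-1}\varphi_-$ and $\chi(\varphi_+,\alpha)=\#(\varphi_+\varphi_-^{-1})/2+\#(\alpha)/2+\#(K(\varphi_+,\alpha))/2-|I|$, where the permutations in $\varphi_+\varphi_-^{-1}$, $\alpha$ and $K$ are on $\pm I$. Traces along permutations. For $\pi,\rho\in\mathrm{PM}(n)$ and $N\times N$ quaternionic matrices $A_1,\dots,A_n$, $$\mathrm{Re}_{\mathrm{FD}(\pi)}\mathrm{tr}_{\mathrm{FD}(\rho)}(A_1,\dots,A_n)=2^{-\#(\mathrm{FD}(\pi))}N^{-\#(\mathrm{FD}(\rho))}\sum_{\substack{i:\pm[n]\to[N]\\ i_{-k}=i_{\rho(k)}\ \forall k}}\ \sum_{h:\mathrm{FD}(\pi)\to\{1,-1\}}\ \prod_{k\in\mathrm{FD}(\pi)}A^{(k)}_{i_k,i_{-k};h_k,h_{\pi(k)}}.$$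 For $\varphi\in S_n$, a subscript $\varphi$ means this with $\pi$ (or $\rho$) equal to $\varphi\,\delta\varphi^{-1}\delta\in\mathrm{PM}(n)$, whose $\mathrm{FD}$ is taken to be $\varphi$. All expectations written are assumed to exist. *)

theory Defs
  imports "HOL-Probability.Probability" "HOL-Combinatorics.Orbits"
begin

section \<open>Quaternions\<close>

datatype quat = Quat (qre: real) (qi: real) (qj: real) (qk: real)

instantiation quat :: ring_1
begin

definition zero_quat :: quat where "0 = Quat 0 0 0 0"

definition one_quat :: quat where "1 = Quat 1 0 0 0"

definition plus_quat :: "quat \<Rightarrow> quat \<Rightarrow> quat" where
  "p + q = Quat (qre p + qre q) (qi p + qi q) (qj p + qj q) (qk p + qk q)"

definition uminus_quat :: "quat \<Rightarrow> quat" where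
  "- q = Quat (- qre q) (- qi q) (- qj q) (- qk q)"

definition minus_quat :: "quat \<Rightarrow> quat \<Rightarrow> quat" where
  "p - q = Quat (qre p - qre q) (qi p - qi q) (qj p - qj q) (qk p - qk q)"

definition times_quat :: "quat \<Rightarrow> quat \<Rightarrow> quat" where
  "p * q = Quat
     (qre p * qre q - qi p * qi q - qj p * qj q - qk p * qk q)
     (qre p * qi q + qi p * qre q + qj p * qk q - qk p * qj q)
     (qre p * qj q - qi p * qk q + qj p * qre q + qk p * qi q)
     (qre p * qk q + qi p * qj q - qj p * qi q + qk p * qre q)"

instance
  by standard
    (simp_all add: zero_quat_def one_quat_def plus_quat_def uminus_quat_def minus_quat_def
      times_quat_def quat.expand algebra_simps)

end

text \<open>The topology is transported from \<^typ>\<open>real \<times> real \<times> real \<times> real\<close>, so that the Borel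
  sets of quaternionic matrices are the usual ones.\<close>

instantiation quat :: topological_space
begin

definition open_quat :: "quat set \<Rightarrow> bool" where
  "open S \<longleftrightarrow> open ((\<lambda>(a, b, c, d). Quat a b c d) -` S)"

instance
proof
  show "open (UNIV :: quat set)" by (simp add: open_quat_def)
next
  fix S T :: "quat set"
  assume "open S" "open T"
  then show "open (S \<inter> T)" by (simp add: open_quat_def vimage_Int open_Int)
next
  fix K :: "quat set set"
  assume "\<forall>S\<in>K. open S"
  then show "open (\<Union>K)" unfolding open_quat_def vimage_Union by (intro open_UN) auto
qed

end

definition qcnj :: "quat \<Rightarrow> quat" where
  "qcnj q = Quat (qre q) (- qi q) (- qj q) (- qk q)"

text \<open>The entries of the \<open>2 \<times> 2\<close> complex matrix of a quaternion; rows and columns are indexed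
  by \<open>1, -1\<close> in this order.\<close>

definition qentry :: "quat \<Rightarrow> int \<Rightarrow> int \<Rightarrow> complex" where
  "qentry q r s =
     (if r = 1 then (if s = 1 then Complex (qre q) (qi q) else Complex (qj q) (qk q))
      else (if s = 1 then Complex (- qj q) (qk q) else Complex (qre q) (- qi q)))"

lemma qentry_mult:
  "qentry (p * q) r s = (\<Sum>t\<in>{1, -1}. qentry p r t * qentry q t s)"
  by (simp add: qentry_def times_quat_def complex_eq_iff algebra_simps)

lemma qentry_qcnj:
  assumes "r \<in> {1, -1}" "s \<in> {1, -1}"
  shows "qentry (qcnj q) r s = cnj (qentry q s r)"
  using assms by (auto simp: qentry_def qcnj_def complex_eq_iff)

definition qadjoint :: "quat^'m^'n \<Rightarrow> quat^'n^'m" where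
  "qadjoint A = (\<chi> i j. qcnj (A $ j $ i))"

text \<open>\<open>A\<^sup>(\<^sup>k\<^sup>)\<close> for a nonzero integer \<open>k\<close>.\<close>

definition signed_mat :: "(int \<Rightarrow> quat^'n^'n) \<Rightarrow> int \<Rightarrow> quat^'n^'n" where
  "signed_mat A k = (if k > 0 then A k else qadjoint (A (- k)))"


section \<open>Permutations of signed index sets\<close>

text \<open>Permutations of a set \<open>S\<close> of integers are functions on all integers that are the identity
  outside \<open>S\<close>, and the involution \<open>\<delta>\<close> is \<^term>\<open>uminus :: int \<Rightarrow> int\<close>. The
  underlying set is therefore an explicit argument wherever it matters.\<close>

definition pm :: "int set \<Rightarrow> int set" where
  "pm I = I \<union> uminus ` I"

definition num_cycles :: "int set \<Rightarrow> (int \<Rightarrow> int) \<Rightarrow> nat" where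
  "num_cycles S \<pi> = card (orbit \<pi> ` S)"

definition PM :: "int set \<Rightarrow> (int \<Rightarrow> int) set" where
  "PM I = {\<pi>. \<pi> permutes pm I \<and> uminus \<circ> \<pi> \<circ> uminus = inv \<pi> \<and> (\<forall>k\<in>pm I. - k \<notin> orbit \<pi> k)}"

definition FD :: "int set \<Rightarrow> (int \<Rightarrow> int) \<Rightarrow> int set" where
  "FD I \<pi> = {k \<in> pm I. \<exists>m\<in>orbit \<pi> k. m > 0 \<and> (\<forall>l\<in>orbit \<pi> k. \<bar>m\<bar> \<le> \<bar>l\<bar>)}"

definition perm_minus :: "(int \<Rightarrow> int) \<Rightarrow> int \<Rightarrow> int" where
  "perm_minus \<phi> = uminus \<circ> \<phi> \<circ> uminus"

definition Kreweras :: "(int \<Rightarrow> int) \<Rightarrow> (int \<Rightarrow> int) \<Rightarrow> int \<Rightarrow> int" where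
  "Kreweras \<phi> \<alpha> = inv \<phi> \<circ> inv \<alpha> \<circ> perm_minus \<phi>"

text \<open>If \<open>I\<close> and \<open>-I\<close> are disjoint, \<open>\<phi>\<close> permutes \<open>I\<close> and \<open>\<alpha> \<in> PM I\<close>, then all three permutations below lie in \<open>PM I\<close>, so their cycles come in pairs
  and the integer divisions are exact.\<close>

definition euler_char :: "int set \<Rightarrow> (int \<Rightarrow> int) \<Rightarrow> (int \<Rightarrow> int) \<Rightarrow> int" where
  "euler_char I \<phi> \<alpha> =
     int (num_cycles (pm I) (\<phi> \<circ> inv (perm_minus \<phi>))) div 2
     + int (num_cycles (pm I) \<alpha>) div 2
     + int (num_cycles (pm I) (Kreweras \<phi> \<alpha>)) div 2
     - int (card I)"

text \<open>\<open>\<delta>\<^sub>\<epsilon>\<close>, extended by the identity outside \<open>\<plusminus>I\<close>.\<close>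

definition sign_flip :: "int set \<Rightarrow> (int \<Rightarrow> int) \<Rightarrow> int \<Rightarrow> int" where
  "sign_flip I \<epsilon> k = (if k \<in> pm I then \<epsilon> \<bar>k\<bar> * k else k)"


section \<open>Traces along permutations\<close>

definition Re_tr ::
  "nat \<Rightarrow> (int \<Rightarrow> int) \<Rightarrow> (int \<Rightarrow> int) \<Rightarrow> (int \<Rightarrow> quat^'n^'n) \<Rightarrow> complex" where
  "Re_tr n \<pi> \<rho> A =
     (let I = {1..int n} in
       2 powi (- int (num_cycles (FD I \<pi>) \<pi>)) *
       of_nat CARD('n) powi (- int (num_cycles (FD I \<rho>) \<rho>)) *
       (\<Sum>i\<in>{i \<in> pm I \<rightarrow>\<^sub>E UNIV. \<forall>k\<in>pm I. i (- k) = i (\<rho> k)}.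
         \<Sum>h\<in>FD I \<pi> \<rightarrow>\<^sub>E {1, -1}.
           \<Prod>k\<in>FD I \<pi>. qentry (signed_mat A k $ i k $ i (- k)) (h k) (h (\<pi> k))))"

text \<open>The subscript \<open>\<phi> \<in> S\<^sub>n\<close> abbreviates \<open>\<phi> \<delta> \<phi>\<^sup>-\<^sup>1 \<delta>\<close>. Since this permutation
  preserves the positive integers, its \<open>FD\<close> is \<open>{1..n}\<close>, on which it acts as \<open>\<phi>\<close>.\<close>

definition doubled :: "(int \<Rightarrow> int) \<Rightarrow> int \<Rightarrow> int" where
  "doubled \<phi> = \<phi> \<circ> uminus \<circ> inv \<phi> \<circ> uminus"

end

theory Submission
  imports Defs
begin

text \<open>
  Write \<open>P\<close> for the set of signed indices. All data of the theorem are pairings of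
  \<open>P\<close>, that is, involutions without fixed points: for \<open>\<pi> \<in> PM\<close> both
  \<open>\<delta>\<pi>\<close> and \<open>\<pi>\<delta>\<close> are pairings, and conversely the condition on cycles in
  \<^const>\<open>PM\<close> only says that these involutions have no fixed point (\<open>PM_I\<close>). The
  entry of a matrix number \<open>k\<close> carries its row data at \<open>k\<close> and its column data at
  \<open>-k\<close>.

  Fix the \<open>Y\<^sub>k\<close> and expand the trace of the products. The indices and signs of the
  \<open>X\<^sub>k\<close> then run over all functions on \<open>P\<close>, and those of the \<open>Y\<^sub>k\<close> are their compositions with
  \<open>\<phi>\<delta>\<close> (\<open>trace_sum_doubled\<close>). The moment formula, transported through the
  adjoints by \<open>\<delta>\<^sub>\<epsilon>\<close>, requires that indices agree, and that \<open>\<zeta> = sgn \<cdot> \<eta>\<close>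
  changes sign, along the pairing \<open>\<delta>\<beta>\<close> with \<open>\<beta> = \<delta>\<^sub>\<epsilon>\<alpha>\<delta>\<^sub>\<epsilon>\<close>. Since \<open>\<phi>\<delta>\<close>
  conjugates \<open>\<delta>K(\<phi>,\<beta>)\<close> into \<open>\<delta>\<beta>\<close>, the \<open>Y\<^sub>k\<close> are subject to the same kind of constraint
  for the Kreweras complement (\<open>sum_Kreweras_shift\<close>), and this is the constraint in the
  trace along \<open>K\<^sup>-\<^sup>1\<close>. Counting powers of \<open>2\<close> and \<open>N\<close> gives the Euler characteristics.

  What remains is the sign. The entry of a conjugate quaternion at \<open>(r, s)\<close> is
  \<open>rs\<close> times the entry of the quaternion at \<open>(-s, -r)\<close>, so replacing a matrix by its
  adjoint costs a sign, and passing from the positive indices to a half \<open>R\<close> of a permutation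
  multiplies a product of entries by \<open>\<Prod>\<^sub>R \<eta> \<cdot> \<Prod>\<^sub>I \<eta>\<close> (\<open>prod_reorient\<close>). The
  total sign is a product of values of \<open>\<zeta>\<close> on halves of \<open>\<beta>\<close> and of \<open>K\<close>, and it
  does not depend on \<open>\<zeta>\<close>: both halves select one element from each pair, and the bijection
  between the selections that is induced by \<open>\<phi>\<delta>\<close>, read in suitable frames, is a
  permutation commuting with negation. Its sign counts the pairs at which the selections differ. It
  is also the product of the signs of \<open>\<phi>\<close>, of \<open>\<beta>\<close> on its half and of \<open>K\<close> on its half, up to a
  power of \<open>-1\<close> given by \<open>n\<close> and the numbers of negative elements of the halves
  (\<open>prod_Kreweras\<close>). As the sign of a permutation is determined by its number of cycles, the total
  is \<open>(-1)\<close> to the power \<open>#(\<phi>) + #(\<beta>)/2 + #(K)/2 - n\<close> (\<open>sign_total\<close>), which turns \<open>2\<close> into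
  \<open>-2\<close> in the statement.

  The probabilistic part is Fubini's theorem (\<open>integral_indep_var\<close>): the \<open>X\<^sub>k\<close> are
  integrated out for fixed \<open>Y\<^sub>k\<close>, where the independent sets of \<open>X\<^sub>k\<close> contribute a product of moments
  that is again a sum over glued permutations (\<open>prod_moments\<close>).
\<close>


section \<open>Orbits and signs of finite permutations\<close>

lemma orbit_eq_orbit:
  assumes "permutation p" "y \<in> orbit p x"
  shows "orbit p y = orbit p x"
  using cyclic_on_orbit'[OF assms(1)] assms(2) by (rule orbit_cyclic_eq3)

lemma orbit_conj:
  assumes "\<And>x. q (g x) = g (p x)"
  shows "orbit q (g x) = g ` orbit p x"
proof (intro equalityI subsetI)
  fix y assume "y \<in> orbit q (g x)"
  then show "y \<in> g ` orbit p x"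
    by induct (auto simp: assms intro: orbit.intros)
next
  fix y assume "y \<in> g ` orbit p x"
  then obtain z where "z \<in> orbit p x" "y = g z" by auto
  from this(1) have "g z \<in> orbit q (g x)"
    by induct (auto simp flip: assms intro: orbit.intros)
  then show "y \<in> orbit q (g x)" using \<open>y = g z\<close> by simp
qed

text \<open>Multiplying by the transposition of \<open>x\<close> and \<open>p x\<close> takes \<open>x\<close> out of its
  cycle, which raises the number of cycles by one and changes the sign. Repeating this leads to
  the identity.\<close>

lemma sign_eq_orbits:
  assumes "p permutes S" "finite S"
  shows "sign p = (- 1) ^ (card S + card (orbit p ` S))"
  using assms(1)
proof (induction "card {x. p x \<noteq> x}" arbitrary: p rule: less_induct)
  case less
  note p = less.prems
  have perm: "permutation p" using p assms(2) permutes_imp_permutation by blast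
  have supp: "{x. p x \<noteq> x} \<subseteq> S" using p by (auto simp: permutes_def)
  then have fin: "finite {x. p x \<noteq> x}" using assms(2) finite_subset by blast
  show ?case
  proof (cases "p = id")
    case True
    have "orbit p ` S = (\<lambda>x. {x}) ` S"
      by (intro image_cong refl) (simp add: True orbit_eq_singleton_iff)
    then have "card (orbit p ` S) = card S"
      by (simp add: card_image)
    then show ?thesis using True by (simp flip: mult_2 add: power_mult)
  next
    case False
    then obtain x where x: "p x \<noteq> x" by (auto simp: fun_eq_iff)
    define q where "q = Transposition.transpose x (p x) \<circ> p"
    have xS: "x \<in> S" "p x \<in> S" using supp x p by (auto simp: permutes_in_image)
    have q: "q permutes S" unfolding q_def
      using p xS by (intro permutes_compose permutes_swap_id)
    have permq: "permutation q" using q assms(2) permutes_imp_permutation by blast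
    have qx: "q x = x" by (simp add: q_def)
    have inj: "p y = p z \<longleftrightarrow> y = z" for y z using p by (metis permutes_inj injD)
    have q_eq: "q y = (if p y = x then p x else if y = x then x else p y)" for y
      using x inj by (auto simp: q_def Transposition.transpose_def)
    have sub: "{y. q y \<noteq> y} \<subset> {y. p y \<noteq> y}"
    proof (rule psubsetI)
      show "{y. q y \<noteq> y} \<subseteq> {y. p y \<noteq> y}" using x by (auto simp: q_eq)
      show "{y. q y \<noteq> y} \<noteq> {y. p y \<noteq> y}" using x qx by blast
    qed
    have IH: "sign q = (- 1) ^ (card S + card (orbit q ` S))"
      using less.hyps[OF psubset_card_mono[OF fin sub] q] .
    have "sign q = sign (Transposition.transpose x (p x)) * sign p"
      unfolding q_def by (intro sign_compose permutation_swap_id perm)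
    then have sign: "sign p = - sign q" using x by (simp add: sign_swap_id)
    \<comment> \<open>Only the cycle through \<open>x\<close> changes: it splits into \<open>{x}\<close> and the rest.\<close>
    let ?O = "orbit p x"
    have self: "x \<in> ?O" by (rule permutation_self_in_orbit[OF perm])
    have selfq: "y \<in> orbit q y" for y by (rule permutation_self_in_orbit[OF permq])
    have split: "orbit q (p x) = ?O - {x}"
    proof (intro equalityI subsetI)
      fix y assume "y \<in> orbit q (p x)"
      then show "y \<in> ?O - {x}"
        by induct (use x in \<open>auto simp: q_eq intro: orbit.intros\<close>)
    next
      have "y \<noteq> x \<longrightarrow> y \<in> orbit q (p x)" if "y \<in> ?O" for y
        using that
      proof induct
        case base then show ?case using selfq by blast
      next
        case (step y)
        show ?case
        proof (cases "y = x")
          case True then show ?thesis using selfq by blast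
        next
          case False
          then have "y \<in> orbit q (p x)" using step by blast
          then show ?thesis using orbit.step[of y q "p x"] False by (auto simp: q_eq[of y] split: if_splits)
        qed
      qed
      then show "y \<in> orbit q (p x)" if "y \<in> ?O - {x}" for y using that by blast
    qed
    have other: "orbit q y = orbit p y" if "y \<notin> ?O" for y
    proof (rule orbit_cong)
      show "y \<in> orbit p y" by (rule permutation_self_in_orbit[OF perm])
      fix s assume s: "s \<in> orbit p y"
      have "x \<notin> orbit p y"
        using that orbit_eq_orbit[OF perm, of x y] permutation_self_in_orbit[OF perm, of y] by auto
      then show "q s = p s" using s orbit.step[OF s] by (auto simp: q_eq)
    qed
    let ?U = "orbit p ` S - {?O}"
    have disj: "z \<notin> Z" if "Z \<in> ?U" "z \<in> ?O" for z Z
      using that orbit_eq_orbit[OF perm] by (metis DiffE imageE insertI1)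
    have "orbit q ` S = insert {x} (insert (?O - {x}) ?U)"
    proof (intro equalityI subsetI)
      fix Z assume "Z \<in> orbit q ` S"
      then obtain y where y: "y \<in> S" "Z = orbit q y" by auto
      consider "y = x" | "y \<in> ?O - {x}" | "y \<notin> ?O" by blast
      then show "Z \<in> insert {x} (insert (?O - {x}) ?U)"
      proof cases
        case 1 then show ?thesis using qx y by (simp add: orbit_eq_singleton_iff[THEN iffD2])
      next
        case 2
        then have y': "y \<in> orbit q (p x)" using split by simp
        then have "Z = ?O - {x}" using orbit_eq_orbit[OF permq y'] y(2) split by simp
        then show ?thesis by simp
      next
        case 3
        then have "Z = orbit p y" using other y by simp
        moreover have "orbit p y \<noteq> ?O" using 3 permutation_self_in_orbit[OF perm, of y] by auto
        ultimately show ?thesis using y by auto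
      qed
    next
      fix Z assume Z: "Z \<in> insert {x} (insert (?O - {x}) ?U)"
      have "{x} = orbit q x" using qx by (simp add: orbit_eq_singleton_iff[THEN iffD2])
      moreover have "Z \<in> orbit q ` S" if U: "Z \<in> ?U"
      proof -
        obtain y where y: "y \<in> S" "Z = orbit p y" using U by auto
        have "y \<in> Z" using y permutation_self_in_orbit[OF perm, of y] by simp
        then have "y \<notin> ?O" using disj[OF U] by auto
        then show ?thesis using other y by auto
      qed
      ultimately show "Z \<in> orbit q ` S" using Z xS split by (metis imageI insertE)
    qed
    moreover have "card (insert {x} (insert (?O - {x}) ?U)) = card (orbit p ` S) + 1"
    proof -
      have finU: "finite ?U" using assms(2) by auto
      have "p x \<in> ?O" by (rule orbit.base)
      then have "?O - {x} \<notin> ?U" using disj x by blast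
      moreover have "{x} \<notin> insert (?O - {x}) ?U" using disj self by auto
      moreover have "?O \<in> orbit p ` S" using xS by auto
      then have "card (orbit p ` S) = card ?U + 1"
        using assms(2) by (metis Suc_eq_plus1 card_Suc_Diff1 finite_imageI)
      ultimately show ?thesis using finU by simp
    qed
    ultimately show ?thesis using IH sign by simp
  qed
qed

lemma sign_restrict_id:
  assumes "p permutes S" "R \<subseteq> S" "p ` R \<subseteq> R" "finite S"
  shows "restrict_id p R permutes S"
    and "sign (restrict_id p R) = (- 1) ^ (card R + card (orbit p ` R))"
proof -
  have fin: "finite R" using assms finite_subset by blast
  have inj: "inj_on p R" using assms(1) permutes_inj_on by blast
  then have "bij_betw p R R"
    using assms(3) fin by (simp add: bij_betw_def endo_inj_surj)
  then have R: "restrict_id p R permutes R" by (rule permutes_restrict_id)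
  then show "restrict_id p R permutes S" using assms(2) permutes_subset by blast
  have "orbit (restrict_id p R) x = orbit p x" if "x \<in> R" for x
    by (rule orbit_cong0[of x R]) (use that assms(3) in \<open>auto simp: restrict_id_def\<close>)
  then have "orbit (restrict_id p R) ` R = orbit p ` R" by (intro image_cong) auto
  then show "sign (restrict_id p R) = (- 1) ^ (card R + card (orbit p ` R))"
    using sign_eq_orbits[OF R fin] by simp
qed


section \<open>Permutations of a signed index set and their halves\<close>

lemma bij_fixing_permutes:
  assumes "bij p" "\<And>x. x \<notin> S \<Longrightarrow> p x = x"
  shows "p permutes S"
  using assms by (auto simp: permutes_def bij_iff)

locale signed_index =
  fixes I :: "int set"
  assumes finite_I: "finite I" and positive: "k \<in> I \<Longrightarrow> k > 0"
begin

lemma finite_pm: "finite (pm I)"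
  using finite_I by (simp add: pm_def)

lemma uminus_in_pm [simp]: "- k \<in> pm I \<longleftrightarrow> k \<in> pm I"
  by (force simp: pm_def)

lemma pm_nonzero: "k \<in> pm I \<Longrightarrow> k \<noteq> 0"
  using positive by (force simp: pm_def)

lemma in_I_iff: "k \<in> I \<longleftrightarrow> k \<in> pm I \<and> k > 0"
  using positive by (force simp: pm_def)

lemma subset_pm: "I \<subseteq> pm I"
  by (simp add: pm_def)

lemma abs_in_I_iff: "\<bar>k\<bar> \<in> I \<longleftrightarrow> k \<in> pm I"
  using in_I_iff[of k] in_I_iff[of "- k"] pm_nonzero[of k] by (auto simp: abs_if)

lemma card_pm: "card (pm I) = 2 * card I"
proof -
  have "k \<notin> uminus ` I" if "k \<in> I" for k
    using positive[OF that] positive[of "- k"] by auto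
  then have "I \<inter> uminus ` I = {}" by blast
  then have "card (pm I) = card I + card (uminus ` I)"
    unfolding pm_def using finite_I by (simp add: card_Un_disjoint)
  then show ?thesis by (simp add: card_image)
qed

lemma PM_permutes: "\<pi> \<in> PM I \<Longrightarrow> \<pi> permutes pm I"
  by (simp add: PM_def)

lemma PM_permutation: "\<pi> \<in> PM I \<Longrightarrow> permutation \<pi>"
  by (rule permutes_imp_permutation[OF finite_pm PM_permutes])

lemma PM_in_pm [simp]: "\<pi> \<in> PM I \<Longrightarrow> \<pi> k \<in> pm I \<longleftrightarrow> k \<in> pm I"
  by (rule permutes_in_image[OF PM_permutes])

lemma PM_skew: "\<pi> \<in> PM I \<Longrightarrow> \<pi> (- \<pi> k) = - k"
proof -
  assume "\<pi> \<in> PM I"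
  then have perm: "\<pi> permutes pm I" and inv: "uminus \<circ> \<pi> \<circ> uminus = inv \<pi>"
    by (simp_all add: PM_def)
  have "- \<pi> (- \<pi> k) = inv \<pi> (\<pi> k)" by (simp flip: inv)
  then show ?thesis by (simp add: permutes_inverses[OF perm])
qed

lemma PM_uminus: "\<pi> \<in> PM I \<Longrightarrow> \<pi> (- k) = - inv \<pi> k"
  using PM_skew[of \<pi> "inv \<pi> k"] by (simp add: permutes_inverses[OF PM_permutes])

lemma PM_no_flip: "\<pi> \<in> PM I \<Longrightarrow> k \<in> pm I \<Longrightarrow> \<pi> k \<noteq> - k"
  using orbit.base[of \<pi> k] by (auto simp: PM_def)

text \<open>The disjointness of \<open>k\<close> and \<open>-k\<close> in every cycle is a local condition: \<open>\<pi>\<close> and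
  negation generate a dihedral group, so if \<open>\<pi>\<^sup>m k = -k\<close> then halfway between
  the two there is a point fixed by negation (\<open>m\<close> even) or by \<open>-\<pi>\<close> (\<open>m\<close> odd).\<close>

lemma PM_I:
  assumes perm: "\<pi> permutes pm I" and skew: "\<And>k. \<pi> (- \<pi> k) = - k"
    and no_flip: "\<And>k. k \<in> pm I \<Longrightarrow> \<pi> k \<noteq> - k"
  shows "\<pi> \<in> PM I"
  unfolding PM_def
proof (intro CollectI conjI ballI)
  show "uminus \<circ> \<pi> \<circ> uminus = inv \<pi>"
  proof
    fix x
    have "\<pi> (- \<pi> (- x)) = x" using skew[of "- x"] by simp
    then show "(uminus \<circ> \<pi> \<circ> uminus) x = inv \<pi> x"
      using permutes_inv_eq[OF perm] by (metis comp_apply)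
  qed
  fix k assume k: "k \<in> pm I"
  have pow_skew: "(\<pi> ^^ j) (- (\<pi> ^^ j) x) = - x" for j x
    by (induction j arbitrary: x) (auto simp: funpow_swap1 skew)
  have inj: "inj (\<pi> ^^ j)" for j
    using perm permutes_inj by (intro inj_fn) auto
  have in_pm: "(\<pi> ^^ j) k \<in> pm I" for j
    using k perm by (induction j) (auto simp: permutes_in_image)
  show "- k \<notin> orbit \<pi> k"
  proof
    assume "- k \<in> orbit \<pi> k"
    then obtain m where m: "- k = (\<pi> ^^ m) k" unfolding orbit_altdef by auto
    show False
    proof (cases "even m")
      case True
      then obtain j where "m = j + j" by (metis evenE mult_2)
      then have "(\<pi> ^^ j) ((\<pi> ^^ j) k) = (\<pi> ^^ j) (- (\<pi> ^^ j) k)"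
        using m pow_skew by (simp add: funpow_add)
      then have "(\<pi> ^^ j) k = - (\<pi> ^^ j) k" using inj injD by metis
      then show False using in_pm[of j] pm_nonzero by fastforce
    next
      case False
      then obtain j where "m = 2 * j + 1" by (rule oddE)
      then have "m = j + Suc j" by simp
      then have "(\<pi> ^^ j) (\<pi> ((\<pi> ^^ j) k)) = (\<pi> ^^ j) (- (\<pi> ^^ j) k)"
        using m pow_skew by (simp add: funpow_add funpow_swap1)
      then have "\<pi> ((\<pi> ^^ j) k) = - (\<pi> ^^ j) k" using inj injD by metis
      then show False using in_pm[of j] no_flip by blast
    qed
  qed
qed (fact perm)

lemma PM_inv:
  assumes "\<pi> \<in> PM I"
  shows "inv \<pi> \<in> PM I"
proof (rule PM_I)
  note perm = PM_permutes[OF assms]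
  show "inv \<pi> permutes pm I" using perm by (rule permutes_inv)
  show "inv \<pi> (- inv \<pi> k) = - k" for k
    by (simp add: permutes_inverses[OF perm] flip: PM_uminus[OF assms])
  show "inv \<pi> k \<noteq> - k" if "k \<in> pm I" for k
    using PM_no_flip[OF assms, of "- k"] that by (metis minus_minus permutes_inv_eq perm uminus_in_pm)
qed

lemma orbit_inv: "\<pi> \<in> PM I \<Longrightarrow> orbit (inv \<pi>) = orbit \<pi>"
  by (intro ext orbit_inv_eq PM_permutation)

lemma FD_inv: "\<pi> \<in> PM I \<Longrightarrow> FD I (inv \<pi>) = FD I \<pi>"
  by (simp add: FD_def orbit_inv)

lemma num_cycles_inv: "\<pi> \<in> PM I \<Longrightarrow> num_cycles S (inv \<pi>) = num_cycles S \<pi>"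
  by (simp add: num_cycles_def orbit_inv)

lemma orbit_uminus:
  assumes "\<pi> \<in> PM I"
  shows "orbit \<pi> (- k) = uminus ` orbit \<pi> k"
proof -
  have "orbit (inv \<pi>) (- k) = uminus ` orbit \<pi> k"
    by (rule orbit_conj) (simp add: PM_uminus[OF PM_inv[OF assms]] permutes_inv_inv[OF PM_permutes[OF assms]])
  then show ?thesis using orbit_inv[OF assms] by simp
qed

text \<open>A half of \<open>\<pi>\<close> generalizes \<^const>\<open>FD\<close>: it consists of one cycle from each pair of cycles
  of \<open>\<pi>\<close>, chosen arbitrarily. This is the freedom needed below, because conjugation with a
  sign flip maps \<^const>\<open>FD\<close> to a half that is no longer normalized by smallest elements.\<close>

definition half :: "(int \<Rightarrow> int) \<Rightarrow> int set \<Rightarrow> bool" where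
  "half \<pi> R \<longleftrightarrow> R \<subseteq> pm I \<and> (\<forall>k\<in>pm I. - k \<in> R \<longleftrightarrow> k \<notin> R) \<and> \<pi> ` R \<subseteq> R"

lemma half_subset: "half \<pi> R \<Longrightarrow> R \<subseteq> pm I"
  by (simp add: half_def)

lemma half_uminus: "half \<pi> R \<Longrightarrow> k \<in> pm I \<Longrightarrow> - k \<in> R \<longleftrightarrow> k \<notin> R"
  by (simp add: half_def)

lemma half_closed: "half \<pi> R \<Longrightarrow> k \<in> R \<Longrightarrow> \<pi> k \<in> R"
  by (auto simp: half_def)

lemma half_finite: "half \<pi> R \<Longrightarrow> finite R"
  using half_subset finite_pm finite_subset by blast

lemma half_image:
  assumes "\<pi> permutes pm I" "half \<pi> R"
  shows "\<pi> ` R = R"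
  using assms half_finite[OF assms(2)] permutes_inj_on[OF assms(1)]
  by (intro endo_inj_surj) (auto simp: half_def)

lemma half_inv:
  assumes "\<pi> permutes pm I" "half \<pi> R"
  shows "half (inv \<pi>) R"
proof -
  have "inv \<pi> ` R = inv \<pi> ` \<pi> ` R" using half_image[OF assms] by simp
  also have "\<dots> = R" by (simp add: image_image permutes_inverses[OF assms(1)])
  finally show ?thesis using assms(2) by (simp add: half_def)
qed

lemma prod_half:
  fixes g :: "int \<Rightarrow> 'b::comm_monoid_mult"
  assumes "half \<pi> R" "\<And>k. k \<in> pm I \<Longrightarrow> g (- k) = g k"
  shows "prod g R = prod g I"
proof (rule prod.reindex_bij_witness[where i="\<lambda>k. if k \<in> R then k else - k" and j=abs])
  note R = half_subset[OF assms(1)] half_uminus[OF assms(1)]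
  fix k
  show "\<bar>k\<bar> \<in> I" "(if \<bar>k\<bar> \<in> R then \<bar>k\<bar> else - \<bar>k\<bar>) = k" "g \<bar>k\<bar> = g k" if "k \<in> R"
    using that R(1) R(2)[of k] assms(2)[of k] pm_nonzero[of k] abs_in_I_iff[of k]
    by (auto simp: abs_if)
  show "(if k \<in> R then k else - k) \<in> R" "\<bar>if k \<in> R then k else - k\<bar> = k" if "k \<in> I"
    using that R(2)[of k] positive[of k] subset_pm by auto
qed

lemma card_half: "half \<pi> R \<Longrightarrow> card R = card I"
  using prod_half[of \<pi> R "\<lambda>_. 2::nat"] by simp

text \<open>Negation reverses the cycles of \<open>\<pi>\<close>, so the cycles outside of a half are the negatives of
  those inside.\<close>

lemma half_num_cycles:
  assumes "\<pi> \<in> PM I" "half \<pi> R"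
  shows "num_cycles (pm I) \<pi> = 2 * num_cycles R \<pi>"
proof -
  note R = half_subset[OF assms(2)] half_uminus[OF assms(2)]
  have pm: "pm I = R \<union> uminus ` R"
  proof (intro equalityI subsetI)
    fix k assume "k \<in> pm I"
    then have "k \<in> R \<or> - k \<in> R" using R(2) by auto
    then show "k \<in> R \<union> uminus ` R" by (metis UnI1 UnI2 image_eqI minus_minus)
  next
    fix k assume "k \<in> R \<union> uminus ` R" then show "k \<in> pm I" using R(1) by auto
  qed
  have "orbit \<pi> ` uminus ` R = (`) uminus ` orbit \<pi> ` R"
    unfolding image_image using orbit_uminus[OF assms(1)] by (intro image_cong refl) blast
  moreover have "inj_on ((`) uminus) (orbit \<pi> ` R)"
    by (rule inj_on_inverseI[where g="(`) uminus"]) (simp add: image_image)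
  ultimately have card: "card (orbit \<pi> ` uminus ` R) = card (orbit \<pi> ` R)"
    by (simp add: card_image)
  have "orbit \<pi> k \<subseteq> R" if "k \<in> R" for k
  proof
    fix x assume "x \<in> orbit \<pi> k" then show "x \<in> R"
      by induct (use that assms(2) half_closed in auto)
  qed
  moreover have "k \<in> orbit \<pi> k" for k
    by (rule permutation_self_in_orbit[OF PM_permutation[OF assms(1)]])
  moreover have "- k \<notin> R" if "k \<in> R" for k using R that by blast
  ultimately have "orbit \<pi> ` R \<inter> orbit \<pi> ` uminus ` R = {}" by blast
  then show ?thesis
    unfolding num_cycles_def pm image_Un using half_finite[OF assms(2)] card
    by (simp add: card_Un_disjoint)
qed

text \<open>An element of smallest absolute value in the cycle of \<open>k\<close> is unique, because the cycle does not
  contain its negative. Its sign decides which of \<open>k\<close> and \<open>-k\<close> belongs to \<^const>\<open>FD\<close>.\<close>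

lemma half_FD:
  assumes "\<pi> \<in> PM I"
  shows "half \<pi> (FD I \<pi>)"
  unfolding half_def
proof (intro conjI ballI)
  note perm = PM_permutation[OF assms]
  show "FD I \<pi> \<subseteq> pm I" by (auto simp: FD_def)
  show "\<pi> ` FD I \<pi> \<subseteq> FD I \<pi>"
    using assms orbit_eq_orbit[OF perm orbit.base] by (auto simp: FD_def)
  fix k assume k: "k \<in> pm I"
  have fin: "finite (orbit \<pi> k)" by (rule finite_orbit[OF permutation_self_in_orbit[OF perm]])
  define m where "m = arg_min_on abs (orbit \<pi> k)"
  have m: "m \<in> orbit \<pi> k" "\<And>l. l \<in> orbit \<pi> k \<Longrightarrow> \<bar>m\<bar> \<le> \<bar>l\<bar>"
    unfolding m_def using arg_min_if_finite(1)[OF fin orbit_nonempty]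
      arg_min_least[OF fin orbit_nonempty] by auto
  have in_pm: "l \<in> pm I" if "l \<in> orbit \<pi> k" for l
    using permutes_orbit_subset[OF PM_permutes[OF assms] k] that by blast
  have excl: "- l \<notin> orbit \<pi> k" if "l \<in> orbit \<pi> k" for l
    using assms in_pm[OF that] orbit_eq_orbit[OF perm that] by (auto simp: PM_def)
  have m_unique: "l = m" if "l \<in> orbit \<pi> k" "\<bar>l\<bar> \<le> \<bar>m\<bar>" for l
    using m(2)[OF that(1)] that excl[OF that(1)] m(1) by (auto simp: abs_if split: if_splits)
  have min: "(\<exists>l\<in>orbit \<pi> k. Q l \<and> (\<forall>j\<in>orbit \<pi> k. \<bar>l\<bar> \<le> \<bar>j\<bar>)) \<longleftrightarrow> Q m" for Q
  proof
    assume "\<exists>l\<in>orbit \<pi> k. Q l \<and> (\<forall>j\<in>orbit \<pi> k. \<bar>l\<bar> \<le> \<bar>j\<bar>)"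
    then obtain l where l: "l \<in> orbit \<pi> k" "Q l" "\<forall>j\<in>orbit \<pi> k. \<bar>l\<bar> \<le> \<bar>j\<bar>" by auto
    then have "l = m" using m(1) by (intro m_unique) auto
    then show "Q m" using l(2) by simp
  next
    assume "Q m" then show "\<exists>l\<in>orbit \<pi> k. Q l \<and> (\<forall>j\<in>orbit \<pi> k. \<bar>l\<bar> \<le> \<bar>j\<bar>)"
      using m by (intro bexI[of _ m]) auto
  qed
  have "k \<in> FD I \<pi> \<longleftrightarrow> m > 0"
    using k min[of "\<lambda>l. 0 < l"] by (simp add: FD_def)
  moreover have "- k \<in> FD I \<pi> \<longleftrightarrow> m < 0"
    using k min[of "\<lambda>l. l < 0"] by (simp add: FD_def orbit_uminus[OF assms])
  ultimately show "- k \<in> FD I \<pi> \<longleftrightarrow> k \<notin> FD I \<pi>"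
    using pm_nonzero[OF in_pm[OF m(1)]] by linarith
qed

lemma num_cycles_pm_div_2:
  assumes "\<pi> \<in> PM I" "half \<pi> R"
  shows "int (num_cycles (pm I) \<pi>) div 2 = int (num_cycles R \<pi>)"
  by (simp add: half_num_cycles[OF assms])


subsection \<open>Doubling, Kreweras complements and sign flips\<close>

lemma permutes_pm: "\<phi> permutes I \<Longrightarrow> \<phi> permutes pm I"
  by (rule permutes_subset[OF _ subset_pm])

lemma permutes_neg: "\<phi> permutes I \<Longrightarrow> k < 0 \<Longrightarrow> \<phi> k = k"
  using positive[of k] permutes_not_in[of \<phi> I k] by force

lemma permutes_pos: "\<phi> permutes I \<Longrightarrow> 0 < \<phi> k \<longleftrightarrow> 0 < k"
  using positive[of k] positive[of "\<phi> k"] permutes_in_image[of \<phi> I k] permutes_not_in[of \<phi> I k]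
  by fastforce


lemma permutes_perm_minus:
  assumes "\<phi> permutes I"
  shows "perm_minus \<phi> permutes pm I" and "inv (perm_minus \<phi>) = uminus \<circ> inv \<phi> \<circ> uminus"
proof -
  have "bij (perm_minus \<phi>)" unfolding perm_minus_def
    using permutes_bij[OF assms] by (intro bij_comp bij_uminus)
  moreover have "perm_minus \<phi> k = k" if "k \<notin> pm I" for k
    using that permutes_not_in[OF permutes_pm[OF assms], of "- k"] by (simp add: perm_minus_def)
  ultimately show "perm_minus \<phi> permutes pm I" by (rule bij_fixing_permutes)
  show "inv (perm_minus \<phi>) = uminus \<circ> inv \<phi> \<circ> uminus"
    by (rule inv_unique_comp) (auto simp: perm_minus_def fun_eq_iff permutes_inverses[OF assms])
qed

lemma doubled_eq: "\<phi> permutes I \<Longrightarrow> doubled \<phi> = \<phi> \<circ> inv (perm_minus \<phi>)"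
  by (simp add: doubled_def permutes_perm_minus comp_assoc)

lemma doubled_pos:
  assumes "\<phi> permutes I" "k > 0"
  shows "doubled \<phi> k = \<phi> k"
  using assms permutes_neg[OF permutes_inv[OF assms(1)], of "- k"] by (simp add: doubled_def)

lemma doubled_PM:
  assumes "\<phi> permutes I"
  shows "doubled \<phi> \<in> PM I"
proof (rule PM_I)
  show "doubled \<phi> permutes pm I" unfolding doubled_eq[OF assms]
    by (intro permutes_compose permutes_inv permutes_perm_minus permutes_pm assms)
  show "doubled \<phi> (- doubled \<phi> k) = - k" for k
    by (simp add: doubled_def permutes_inverses[OF assms])
  fix k assume "k \<in> pm I"
  then show "doubled \<phi> k \<noteq> - k"
    using permutes_pos[OF assms, of k] permutes_pos[OF permutes_inv[OF assms], of "- k"]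
      doubled_pos[OF assms, of k] permutes_neg[OF assms, of "- inv \<phi> (- k)"] pm_nonzero
    by (cases "k > 0") (auto simp: doubled_def)
qed

lemma half_doubled: "\<phi> permutes I \<Longrightarrow> half (doubled \<phi>) I"
  unfolding half_def
  by (auto simp: in_I_iff doubled_pos permutes_pos permutes_in_image[OF permutes_pm] dest: pm_nonzero)

lemma num_cycles_doubled:
  assumes "\<phi> permutes I"
  shows "num_cycles I (doubled \<phi>) = num_cycles I \<phi>"
proof -
  have "orbit (doubled \<phi>) k = orbit \<phi> k" if "k \<in> I" for k
    by (rule orbit_cong0[of k I])
       (use that in \<open>auto simp: positive doubled_pos[OF assms] permutes_in_image[OF assms]\<close>)
  then have "orbit (doubled \<phi>) ` I = orbit \<phi> ` I" by (intro image_cong) auto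
  then show ?thesis by (simp add: num_cycles_def)
qed

lemma FD_doubled:
  assumes "\<phi> permutes I"
  shows "FD I (doubled \<phi>) = I"
proof (rule card_subset_eq[OF finite_I])
  note D = doubled_PM[OF assms] and half = half_doubled[OF assms]
  show "card (FD I (doubled \<phi>)) = card I" by (rule card_half[OF half_FD[OF D]])
  show "FD I (doubled \<phi>) \<subseteq> I"
  proof
    fix k assume k: "k \<in> FD I (doubled \<phi>)"
    then obtain m where "k \<in> pm I" and m: "m \<in> orbit (doubled \<phi>) k" "m > 0"
      by (auto simp: FD_def)
    have step: "doubled \<phi> l < 0" if "l < 0" for l
      using that permutes_pos[OF permutes_inv[OF assms], of "- l"]
        permutes_neg[OF assms, of "- inv \<phi> (- l)"]
      by (simp add: doubled_def)
    have "x < 0" if "x \<in> orbit (doubled \<phi>) k" "k < 0" for x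
      using that(1) by induct (use step that(2) in auto)
    then have "\<not> k < 0" using m by fastforce
    then show "k \<in> I" using pm_nonzero[OF \<open>k \<in> pm I\<close>] \<open>k \<in> pm I\<close> in_I_iff[of k] by auto
  qed
qed

lemma Kreweras_eq:
  assumes "\<beta> \<in> PM I"
  shows "Kreweras \<phi> \<beta> k = inv \<phi> (- \<beta> (\<phi> (- k)))"
  using PM_uminus[OF PM_inv[OF assms]] PM_permutes[OF assms]
  by (simp add: Kreweras_def perm_minus_def permutes_inv_inv)

lemma Kreweras_PM:
  assumes "\<phi> permutes I" "\<beta> \<in> PM I"
  shows "Kreweras \<phi> \<beta> \<in> PM I"
proof (rule PM_I)
  show "Kreweras \<phi> \<beta> permutes pm I" unfolding Kreweras_def
    by (intro permutes_compose permutes_inv permutes_perm_minus permutes_pm PM_permutes assms)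
  show "Kreweras \<phi> \<beta> (- Kreweras \<phi> \<beta> k) = - k" for k
    by (simp add: Kreweras_eq[OF assms(2)] permutes_inverses[OF assms(1)] PM_skew[OF assms(2)])
  fix k assume "k \<in> pm I"
  then have "\<phi> (- k) \<in> pm I" using permutes_in_image[OF permutes_pm[OF assms(1)]] by simp
  then have "- \<beta> (\<phi> (- k)) \<noteq> \<phi> (- k)" using PM_no_flip[OF assms(2)] by fastforce
  then show "Kreweras \<phi> \<beta> k \<noteq> - k"
    unfolding Kreweras_eq[OF assms(2)] by (metis permutes_inv_eq[OF assms(1)])
qed

text \<open>As \<open>\<phi>\<delta> \<cdot> \<delta>K = \<delta>\<beta> \<cdot> \<phi>\<delta>\<close>, the map \<open>\<phi>\<delta>\<close> carries the pairing \<open>\<delta>K\<close> to the pairing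
  \<open>\<delta>\<beta>\<close>.\<close>

lemma phi_Kreweras:
  assumes "\<phi> permutes I" "\<beta> \<in> PM I"
  shows "\<phi> (Kreweras \<phi> \<beta> k) = - \<beta> (\<phi> (- k))"
  by (simp add: Kreweras_eq[OF assms(2)] permutes_inverses[OF assms(1)])

lemma sign_flip_uminus: "sign_flip I e (- k) = - sign_flip I e k"
  by (simp add: sign_flip_def)

context
  fixes e :: "int \<Rightarrow> int"
  assumes e: "\<And>k. k \<in> I \<Longrightarrow> e k = 1 \<or> e k = - 1"
begin

lemma sign_flip_sign_flip [simp]: "sign_flip I e (sign_flip I e k) = k"
  using e[of "\<bar>k\<bar>"] by (auto simp: sign_flip_def abs_in_I_iff)

lemma sign_flip_permutes: "sign_flip I e permutes pm I"
proof (rule bij_fixing_permutes)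
  show "bij (sign_flip I e)" by (rule o_bij[where g="sign_flip I e"]) auto
qed (simp add: sign_flip_def)

lemma sign_flip_in_pm [simp]: "sign_flip I e k \<in> pm I \<longleftrightarrow> k \<in> pm I"
  using permutes_in_image[OF sign_flip_permutes] .

lemma sign_sign_flip: "sign (sign_flip I e) = (\<Prod>k\<in>I. e k)"
proof -
  define neg where "neg = (\<lambda>F k. if \<bar>k\<bar> \<in> F then - k else k :: int)"
  have perm_neg: "permutation (neg F)" if "F \<subseteq> I" for F
  proof (rule permutes_imp_permutation[OF finite_pm bij_fixing_permutes])
    show "bij (neg F)" by (rule o_bij[where g="neg F"]) (auto simp: neg_def)
    show "neg F x = x" if "x \<notin> pm I" for x
      using that \<open>F \<subseteq> I\<close> abs_in_I_iff by (auto simp: neg_def)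
  qed
  have "sign (neg F) = (- 1) ^ card F" if "F \<subseteq> I" for F
    using finite_subset[OF that finite_I] that
  proof (induction F rule: finite_induct)
    case empty
    have "neg {} = id" by (auto simp: neg_def)
    then show ?case by simp
  next
    case (insert m F)
    then have m: "m > 0" using positive by blast
    have "neg (insert m F) = Transposition.transpose m (- m) \<circ> neg F"
      using insert.hyps(2) m by (auto simp: neg_def fun_eq_iff Transposition.transpose_def abs_if)
    moreover have "sign (Transposition.transpose m (- m) \<circ> neg F) =
        sign (Transposition.transpose m (- m)) * sign (neg F)"
      using insert.prems by (intro sign_compose permutation_swap_id perm_neg) simp
    ultimately show ?case using insert m by (simp add: sign_swap_id del: comp_apply)
  qed
  moreover have "sign_flip I e = neg {k \<in> I. e k = - 1}"
    using e abs_in_I_iff by (auto simp: neg_def sign_flip_def fun_eq_iff)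
  moreover have "(\<Prod>k\<in>I. e k) = (\<Prod>k\<in>I. if e k = - 1 then - 1 else 1)"
    using e by (intro prod.cong) auto
  then have "(\<Prod>k\<in>I. e k) = (- 1) ^ card {k \<in> I. e k = - 1}"
    using finite_I by (simp add: prod.If_cases Int_def)
  ultimately show ?thesis by simp
qed

lemma sign_flip_conj:
  assumes "\<alpha> \<in> PM I"
  defines "\<beta> \<equiv> sign_flip I e \<circ> \<alpha> \<circ> sign_flip I e"
  shows sign_flip_conj_PM: "\<beta> \<in> PM I"
    and half_sign_flip_conj: "half \<beta> (sign_flip I e ` FD I \<alpha>)"
    and num_cycles_sign_flip_conj: "num_cycles (pm I) \<beta> = num_cycles (pm I) \<alpha>"
proof -
  show PM: "\<beta> \<in> PM I"
  proof (rule PM_I)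
    show "\<beta> permutes pm I" unfolding \<beta>_def
      by (intro permutes_compose sign_flip_permutes PM_permutes assms)
    show "\<beta> (- \<beta> k) = - k" for k
      by (simp add: \<beta>_def flip: sign_flip_uminus) (simp add: sign_flip_uminus PM_skew[OF assms(1)])
    show "\<beta> k \<noteq> - k" if "k \<in> pm I" for k
      using PM_no_flip[OF assms(1), of "sign_flip I e k"] that
      by (metis \<beta>_def comp_apply sign_flip_in_pm sign_flip_sign_flip sign_flip_uminus)
  qed
  note FD = half_FD[OF assms(1)]
  have mem: "k \<in> sign_flip I e ` FD I \<alpha> \<longleftrightarrow> sign_flip I e k \<in> FD I \<alpha>" for k
    by (metis image_iff sign_flip_sign_flip)
  show "half \<beta> (sign_flip I e ` FD I \<alpha>)"
    unfolding half_def
  proof (intro conjI ballI)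
    show "sign_flip I e ` FD I \<alpha> \<subseteq> pm I" using half_subset[OF FD] by auto
    show "- k \<in> sign_flip I e ` FD I \<alpha> \<longleftrightarrow> k \<notin> sign_flip I e ` FD I \<alpha>" if "k \<in> pm I" for k
      unfolding mem sign_flip_uminus using half_uminus[OF FD] that by simp
    show "\<beta> ` sign_flip I e ` FD I \<alpha> \<subseteq> sign_flip I e ` FD I \<alpha>"
      using half_closed[OF FD] by (auto simp: \<beta>_def)
  qed
  have orb: "orbit \<beta> (sign_flip I e k) = sign_flip I e ` orbit \<alpha> k" for k
    by (rule orbit_conj) (simp add: \<beta>_def)
  have "orbit \<beta> ` pm I = orbit \<beta> ` sign_flip I e ` pm I"
    using permutes_image[OF sign_flip_permutes] by simp
  also have "\<dots> = (`) (sign_flip I e) ` orbit \<alpha> ` pm I"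
    by (simp add: image_image orb)
  finally have eq: "orbit \<beta> ` pm I = (`) (sign_flip I e) ` orbit \<alpha> ` pm I" .
  have "inj_on ((`) (sign_flip I e)) (orbit \<alpha> ` pm I)"
    by (rule inj_on_inverseI[where g="(`) (sign_flip I e)"]) (simp add: image_image)
  then show "num_cycles (pm I) \<beta> = num_cycles (pm I) \<alpha>"
    unfolding num_cycles_def eq by (rule card_image)
qed

end

end


section \<open>The sign of a Kreweras complement\<close>

context signed_index
begin

text \<open>The number of cycles of a permutation in \<^const>\<open>PM\<close> is even, and so is the number of points.\<close>

lemma sign_PM:
  assumes "\<pi> \<in> PM I" "half \<pi> R"
  shows "sign \<pi> = 1"
proof -
  have "card (pm I) + card (orbit \<pi> ` pm I) = 2 * (card I + num_cycles R \<pi>)"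
    using half_num_cycles[OF assms] by (simp add: num_cycles_def card_pm)
  then show ?thesis
    using sign_eq_orbits[OF PM_permutes[OF assms(1)] finite_pm] by (simp add: power_mult)
qed

lemma sign_permutes:
  assumes "\<phi> permutes I"
  shows "sign \<phi> = (- 1) ^ (card I + num_cycles I \<phi>)"
  using sign_eq_orbits[OF assms finite_I] by (simp add: num_cycles_def)

text \<open>A permutation that commutes with negation permutes the pairs \<open>{k, -k}\<close>, which is an
  even permutation, and flips some of them. So its sign counts the flips, and this is the factor by
  which the product of an odd function over one representative of each pair changes.\<close>

lemma prod_odd_permute:
  assumes \<theta>: "\<theta> permutes pm I" "\<And>k. k \<in> pm I \<Longrightarrow> \<theta> (- k) = - \<theta> k"
    and v: "\<And>k. k \<in> pm I \<Longrightarrow> v (- k) = - (v k :: int)"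
  shows "(\<Prod>k\<in>I. v (\<theta> k)) = sign \<theta> * (\<Prod>k\<in>I. v k)"
proof -
  define \<pi> where "\<pi> = restrict_id (\<lambda>k. \<bar>\<theta> k\<bar>) I"
  have in_pm: "\<theta> k \<in> pm I" if "k \<in> I" for k
    using that subset_pm by (auto simp: permutes_in_image[OF \<theta>(1)])
  have inj: "inj_on (\<lambda>k. \<bar>\<theta> k\<bar>) I"
  proof (rule inj_onI)
    fix k l assume k: "k \<in> I" and l: "l \<in> I" and "\<bar>\<theta> k\<bar> = \<bar>\<theta> l\<bar>"
    then have "\<theta> k = \<theta> l \<or> \<theta> k = \<theta> (- l)"
      using \<theta>(2)[of l] subset_pm by (auto simp: abs_eq_iff)
    then have "k = l \<or> k = - l" using permutes_inj[OF \<theta>(1)] by (metis injD)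
    then show "k = l" using positive[OF k] positive[OF l] by auto
  qed
  have "(\<lambda>k. \<bar>\<theta> k\<bar>) ` I \<subseteq> I" using in_pm abs_in_I_iff by auto
  then have "bij_betw (\<lambda>k. \<bar>\<theta> k\<bar>) I I"
    using inj finite_I by (simp add: bij_betw_def endo_inj_surj)
  then have \<pi>: "\<pi> permutes I" unfolding \<pi>_def by (rule permutes_restrict_id)
  define e where "e = (\<lambda>m. sgn (\<theta> (inv \<pi> m)))"
  have e: "e k = 1 \<or> e k = - 1" if "k \<in> I" for k
    using pm_nonzero[OF in_pm[of "inv \<pi> k"]] permutes_in_image[OF permutes_inv[OF \<pi>]] that
    by (auto simp: e_def sgn_if)
  have \<pi>_eq: "\<pi> k = \<bar>\<theta> k\<bar>" if "k \<in> I" for k using that by (simp add: \<pi>_def)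
  have e_\<pi>: "e (\<pi> k) = sgn (\<theta> k)" for k by (simp add: e_def permutes_inverses[OF \<pi>])
  have eq_pos: "\<theta> k = sign_flip I e (\<pi> k)" if "k \<in> I" for k
  proof -
    have "\<pi> k \<in> I" using that permutes_in_image[OF \<pi>] by simp
    then have "sign_flip I e (\<pi> k) = sgn (\<theta> k) * \<pi> k"
      using subset_pm positive[of "\<pi> k"] e_\<pi>[of k] by (auto simp: sign_flip_def abs_if)
    then show ?thesis using \<pi>_eq[OF that] by (simp add: mult_sgn_abs)
  qed
  \<comment> \<open>\<open>\<theta>\<close> permutes the pairs by \<open>\<pi>\<close>, acting on both signs alike, and then flips some of them.\<close>
  have eq: "\<theta> = sign_flip I e \<circ> (\<pi> \<circ> perm_minus \<pi>)"
  proof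
    fix k
    consider "k \<in> I" | "- k \<in> I" | "k \<notin> pm I"
      using in_I_iff[of k] in_I_iff[of "- k"] pm_nonzero[of k] by force
    then show "\<theta> k = (sign_flip I e \<circ> (\<pi> \<circ> perm_minus \<pi>)) k"
    proof cases
      case 1
      then have "\<pi> (- k) = - k" using positive[OF 1] permutes_neg[OF \<pi>, of "- k"] by simp
      then show ?thesis using eq_pos[OF 1] by (simp add: perm_minus_def)
    next
      case 2
      then have "\<pi> (- k) > 0" using positive permutes_pos[OF \<pi>] by blast
      then have "\<pi> (- \<pi> (- k)) = - \<pi> (- k)" using permutes_neg[OF \<pi>] by simp
      moreover have "\<theta> k = - \<theta> (- k)" using \<theta>(2)[of "- k"] 2 subset_pm by auto
      ultimately show ?thesis using eq_pos[OF 2] by (simp add: perm_minus_def sign_flip_uminus)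
    next
      case 3
      then show ?thesis
        using permutes_not_in[OF \<theta>(1) 3] permutes_not_in[OF permutes_pm[OF \<pi>], of "- k"]
          permutes_not_in[OF permutes_pm[OF \<pi>] 3]
        by (simp add: perm_minus_def sign_flip_def)
    qed
  qed
  have perms: "permutation \<pi>" "permutation (perm_minus \<pi>)" "permutation (sign_flip I e)"
    using permutes_imp_permutation[OF finite_I \<pi>]
      permutes_imp_permutation[OF finite_pm permutes_perm_minus(1)[OF \<pi>]]
      permutes_imp_permutation[OF finite_pm sign_flip_permutes[OF e]] by auto
  \<comment> \<open>The two copies of \<open>\<pi>\<close> have equal signs since \<open>doubled \<pi>\<close>, which combines one copy with the
    inverse of the other, is in \<^const>\<open>PM\<close> and hence even.\<close>
  have "sign \<pi> * sign (perm_minus \<pi>) = sign (doubled \<pi>)"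
    unfolding doubled_eq[OF \<pi>] using perms
    by (simp add: sign_compose sign_inverse permutation_inverse del: o_apply)
  also have "\<dots> = 1" by (rule sign_PM[OF doubled_PM[OF \<pi>] half_doubled[OF \<pi>]])
  finally have "sign (\<pi> \<circ> perm_minus \<pi>) = 1" using perms by (simp add: sign_compose del: o_apply)
  then have "sign \<theta> = (\<Prod>k\<in>I. e k)"
    unfolding eq using perms sign_sign_flip[OF e]
    by (simp add: sign_compose permutation_compose del: o_apply)
  moreover have "v (\<theta> k) = e (\<pi> k) * v (\<pi> k)" if "k \<in> I" for k
    using in_pm[OF that] v[of "\<theta> k"] \<pi>_eq[OF that] e_\<pi>[of k] pm_nonzero[OF in_pm[OF that]]
    by (auto simp: sgn_if abs_if)
  then have "(\<Prod>k\<in>I. v (\<theta> k)) = (\<Prod>k\<in>I. e (\<pi> k) * v (\<pi> k))" by (intro prod.cong) auto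
  moreover have "\<dots> = (\<Prod>k\<in>I. e k * v k)"
    using prod.permute[OF \<pi>, of "\<lambda>k. e k * v k"] by (simp add: comp_def)
  ultimately show ?thesis by (simp add: prod.distrib)
qed

text \<open>A frame of \<open>\<pi>\<close> along a half \<open>R\<close> carries the standard pairing
  \<open>k \<mapsto> -k\<close>, oriented by the positive elements, to the pairing \<open>k \<mapsto> -\<pi>(k)\<close>, oriented by
  \<open>R\<close>. Comparing two orientations of a pairing thus becomes the computation of a sign.\<close>

definition frame :: "(int \<Rightarrow> int) \<Rightarrow> int set \<Rightarrow> int \<Rightarrow> int" where
  "frame \<pi> R = restrict_id (inv \<pi>) R \<circ> sign_flip I (\<lambda>k. if k \<in> R then 1 else - 1)"

context
  fixes \<pi> :: "int \<Rightarrow> int" and R :: "int set"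
  assumes \<pi>: "\<pi> \<in> PM I" and R: "half \<pi> R"
begin

lemma flip_values: "k \<in> I \<Longrightarrow> (if k \<in> R then 1 else - 1 :: int) = 1 \<or>
    (if k \<in> R then 1 else - 1 :: int) = - 1"
  by auto

lemma flip_in_R: "k \<in> I \<Longrightarrow> sign_flip I (\<lambda>k. if k \<in> R then 1 else - 1) k \<in> R"
  using half_uminus[OF R, of k] subset_pm positive[of k] by (auto simp: sign_flip_def abs_if)

lemma frame_permutes: "frame \<pi> R permutes pm I"
  unfolding frame_def
  using sign_restrict_id(1)[OF permutes_inv[OF PM_permutes[OF \<pi>]]]
    half_inv[OF PM_permutes[OF \<pi>] R] finite_pm sign_flip_permutes[OF flip_values]
  by (intro permutes_compose) (auto simp: half_def)

lemma frame_uminus: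
  assumes "k \<in> pm I"
  shows "frame \<pi> R (- k) = - \<pi> (frame \<pi> R k)"
proof -
  define x where "x = sign_flip I (\<lambda>k. if k \<in> R then 1 else - 1) k"
  have x: "x \<in> pm I" unfolding x_def using sign_flip_in_pm[OF flip_values] assms by simp
  note perm = PM_permutes[OF \<pi>]
  have "restrict_id (inv \<pi>) R (- x) = - \<pi> (restrict_id (inv \<pi>) R x)"
    using half_uminus[OF R x] PM_uminus[OF PM_inv[OF \<pi>], of x]
    by (auto simp: restrict_id_def permutes_inverses[OF perm] permutes_inv_inv[OF perm])
  then show ?thesis by (simp add: frame_def sign_flip_uminus x_def)
qed

lemma prod_frame: "(\<Prod>k\<in>I. g (frame \<pi> R k)) = (\<Prod>k\<in>R. g k)"
proof -
  have "frame \<pi> R ` I \<subseteq> R"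
    using flip_in_R half_closed[OF half_inv[OF PM_permutes[OF \<pi>] R]]
    by (auto simp: frame_def restrict_id_def)
  moreover have inj: "inj_on (frame \<pi> R) I"
    by (rule permutes_inj_on[OF frame_permutes])
  ultimately have "frame \<pi> R ` I = R"
    using half_finite[OF R] card_half[OF R] by (intro card_subset_eq) (auto simp: card_image)
  then show ?thesis using prod.reindex[OF inj, of g] by simp
qed

lemma sign_frame:
  "sign (frame \<pi> R) = (- 1) ^ (card I + num_cycles R \<pi>) * (\<Prod>k\<in>R. sgn k)"
proof -
  let ?e = "\<lambda>k. if k \<in> R then 1 else - 1 :: int"
  note perm = PM_permutes[OF \<pi>]
  note fin = permutes_imp_permutation[OF finite_pm]
  note restr = sign_restrict_id[OF permutes_inv[OF perm], of R]
  have closed: "R \<subseteq> pm I" "inv \<pi> ` R \<subseteq> R" using half_inv[OF perm R] by (auto simp: half_def)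
  have "sign (frame \<pi> R) = sign (restrict_id (inv \<pi>) R) * sign (sign_flip I ?e)"
    unfolding frame_def
    by (intro sign_compose fin[OF restr(1)[OF closed finite_pm]] fin[OF sign_flip_permutes[OF flip_values]])
  also have "sign (sign_flip I ?e) = (\<Prod>k\<in>I. ?e k)" by (rule sign_sign_flip[OF flip_values])
  also have "\<dots> = (\<Prod>k\<in>I. sgn (sign_flip I ?e k))"
    using subset_pm by (intro prod.cong) (auto simp: sign_flip_def abs_if sgn_if dest: positive)
  also have "\<dots> = (\<Prod>k\<in>R. sgn k)"
  proof -
    have inj: "inj_on (sign_flip I ?e) I"
      by (rule permutes_inj_on[OF sign_flip_permutes[OF flip_values]])
    have "sign_flip I ?e ` I = R"
      using half_finite[OF R] card_half[OF R] flip_in_R inj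
      by (intro card_subset_eq) (auto simp: card_image)
    then show ?thesis using prod.reindex[OF inj, of sgn] by simp
  qed
  also have "sign (restrict_id (inv \<pi>) R) = (- 1) ^ (card I + num_cycles R \<pi>)"
    using restr(2)[OF closed finite_pm] orbit_inv[OF \<pi>] card_half[OF R]
    by (simp add: num_cycles_def)
  finally show ?thesis .
qed

end

lemma sgn_square_pm: "k \<in> pm I \<Longrightarrow> sgn k * sgn k = (1::int)"
  using pm_nonzero by (auto simp: sgn_if)

text \<open>Transporting the frame of \<open>K\<close> along \<open>\<phi>\<delta>\<close> gives another frame for the pairing
  of \<open>\<beta>\<close>; the two differ by a permutation \<open>\<theta>\<close> commuting with negation, and the sign of
  \<open>\<theta>\<close> is the product of the signs of all the permutations involved.\<close>

lemma prod_Kreweras: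
  assumes \<phi>: "\<phi> permutes I" and \<beta>: "\<beta> \<in> PM I" and R: "half \<beta> R"
    and R': "half (Kreweras \<phi> \<beta>) R'"
    and \<zeta>: "\<And>k. k \<in> pm I \<Longrightarrow> \<zeta> (- \<beta> k) = - (\<zeta> k :: int)"
  shows "(\<Prod>k\<in>R'. \<zeta> (\<phi> (- k))) =
    (- 1) ^ (num_cycles I \<phi> + num_cycles R \<beta> + num_cycles R' (Kreweras \<phi> \<beta>)) *
    (\<Prod>k\<in>R. sgn k) * (\<Prod>k\<in>R'. sgn k) * (\<Prod>k\<in>R. \<zeta> k)"
proof -
  let ?K = "Kreweras \<phi> \<beta>"
  note K = Kreweras_PM[OF \<phi> \<beta>]
  define \<sigma> where "\<sigma> = frame \<beta> R"
  define \<sigma>' where "\<sigma>' = frame ?K R'"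
  \<comment> \<open>Negation, restricted to the signed indices to make it a finite permutation.\<close>
  define \<Delta> where "\<Delta> = sign_flip I (\<lambda>_. - 1)"
  define \<theta> where "\<theta> = inv \<sigma> \<circ> (\<phi> \<circ> (\<Delta> \<circ> \<sigma>'))"
  have perms: "\<sigma> permutes pm I" "\<sigma>' permutes pm I" "\<Delta> permutes pm I" "\<phi> permutes pm I"
    unfolding \<sigma>_def \<sigma>'_def \<Delta>_def
    by (auto intro!: frame_permutes[OF \<beta> R] frame_permutes[OF K R'] sign_flip_permutes permutes_pm[OF \<phi>])
  have \<theta>_perm: "\<theta> permutes pm I" unfolding \<theta>_def
    by (intro permutes_compose permutes_inv perms)
  have \<sigma>_\<theta>: "\<sigma> (\<theta> k) = \<phi> (- \<sigma>' k)" if "k \<in> pm I" for k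
    using permutes_in_image[OF perms(2), of k] that
    by (simp add: \<theta>_def permutes_inverses[OF perms(1)] \<Delta>_def sign_flip_def)
  have \<theta>_uminus: "\<theta> (- k) = - \<theta> k" if k: "k \<in> pm I" for k
  proof -
    have \<theta>k: "\<theta> k \<in> pm I" using permutes_in_image[OF \<theta>_perm] k by simp
    have "\<sigma> (\<theta> (- k)) = \<phi> (- \<sigma>' (- k))" using \<sigma>_\<theta>[of "- k"] k by simp
    also have "\<sigma>' (- k) = - ?K (\<sigma>' k)" unfolding \<sigma>'_def by (rule frame_uminus[OF K R' k])
    also have "\<phi> (- (- ?K (\<sigma>' k))) = - \<beta> (\<phi> (- \<sigma>' k))" by (simp add: phi_Kreweras[OF \<phi> \<beta>])
    also have "\<dots> = - \<beta> (\<sigma> (\<theta> k))" using \<sigma>_\<theta>[OF k] by simp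
    also have "\<dots> = \<sigma> (- \<theta> k)" unfolding \<sigma>_def by (rule frame_uminus[OF \<beta> R \<theta>k, symmetric])
    finally show ?thesis using permutes_inj[OF perms(1)] by (metis injD)
  qed
  have "(\<Prod>k\<in>R'. \<zeta> (\<phi> (- k))) = (\<Prod>k\<in>I. \<zeta> (\<phi> (- \<sigma>' k)))"
    unfolding \<sigma>'_def by (rule prod_frame[OF K R', symmetric])
  also have "\<dots> = (\<Prod>k\<in>I. \<zeta> (\<sigma> (\<theta> k)))"
    using subset_pm by (intro prod.cong) (auto simp: \<sigma>_\<theta>)
  also have "\<dots> = sign \<theta> * (\<Prod>k\<in>I. \<zeta> (\<sigma> k))"
  proof (rule prod_odd_permute[OF \<theta>_perm \<theta>_uminus])
    fix k assume k: "k \<in> pm I"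
    then have "\<sigma> k \<in> pm I" using permutes_in_image[OF perms(1)] by simp
    then show "\<zeta> (\<sigma> (- k)) = - \<zeta> (\<sigma> k)"
      using \<zeta> frame_uminus[OF \<beta> R k] by (simp add: \<sigma>_def)
  qed
  also have "(\<Prod>k\<in>I. \<zeta> (\<sigma> k)) = (\<Prod>k\<in>R. \<zeta> k)" unfolding \<sigma>_def by (rule prod_frame[OF \<beta> R])
  also have "sign \<theta> = sign \<sigma> * (sign \<phi> * (sign \<Delta> * sign \<sigma>'))"
  proof -
    note fin = permutes_imp_permutation[OF finite_pm]
    note p = fin[OF perms(1)] fin[OF perms(2)] fin[OF perms(3)] fin[OF perms(4)]
    show ?thesis unfolding \<theta>_def
      by (simp only: sign_compose sign_inverse permutation_compose permutation_inverse p)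
  qed
  also have "sign \<Delta> = (- 1) ^ card I"
    unfolding \<Delta>_def by (subst sign_sign_flip) auto
  also have "sign \<phi> = (- 1) ^ (card I + num_cycles I \<phi>)" by (rule sign_permutes[OF \<phi>])
  also have "sign \<sigma> = (- 1) ^ (card I + num_cycles R \<beta>) * (\<Prod>k\<in>R. sgn k)"
    unfolding \<sigma>_def by (rule sign_frame[OF \<beta> R])
  also have "sign \<sigma>' = (- 1) ^ (card I + num_cycles R' ?K) * (\<Prod>k\<in>R'. sgn k)"
    unfolding \<sigma>'_def by (rule sign_frame[OF K R'])
  finally show ?thesis
    by (simp add: power_add ac_simps)
qed

text \<open>The sign that is left over when the entries on all halves have been reoriented. The
  constraint on \<open>\<eta>\<close> is that \<open>sgn \<cdot> \<eta>\<close> changes sign along the pairing of \<open>\<beta>\<close>.\<close>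

lemma sign_total:
  assumes \<phi>: "\<phi> permutes I" and \<beta>: "\<beta> \<in> PM I" and R: "half \<beta> R"
    and R': "half (Kreweras \<phi> \<beta>) R'"
    and \<eta>: "\<And>k. k \<in> pm I \<Longrightarrow> \<eta> k = 1 \<or> \<eta> k = (- 1 :: int)"
    and pairing: "\<And>k. k \<in> pm I \<Longrightarrow> sgn k * \<eta> k = sgn (\<beta> k) * \<eta> (- \<beta> k)"
  shows "(\<Prod>k\<in>R. \<eta> k) * (\<Prod>k\<in>I. \<eta> k) * (\<Prod>k\<in>R'. \<eta> (\<phi> (- k))) * (\<Prod>k\<in>I. \<eta> (- k)) =
    (- 1) ^ (num_cycles I \<phi> + num_cycles R \<beta> + num_cycles R' (Kreweras \<phi> \<beta>) + card I)"
proof -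
  define \<zeta> where "\<zeta> = (\<lambda>k. sgn k * \<eta> k)"
  have \<zeta>: "\<zeta> (- \<beta> k) = - \<zeta> k" if "k \<in> pm I" for k using pairing[OF that] by (simp add: \<zeta>_def)
  have square: "\<zeta> k * \<zeta> k = 1" if "k \<in> pm I" for k
    using \<eta>[OF that] sgn_square_pm[OF that] by (auto simp: \<zeta>_def)
  have \<eta>_eq: "\<eta> k = sgn k * \<zeta> k" if "k \<in> pm I" for k
    using sgn_square_pm[OF that] by (simp add: \<zeta>_def flip: mult.assoc)
  have "(\<Prod>k\<in>R. \<eta> k) = (\<Prod>k\<in>R. sgn k * \<zeta> k)"
    using half_subset[OF R] by (intro prod.cong) (auto simp: \<eta>_eq)
  then have 1: "(\<Prod>k\<in>R. \<eta> k) = (\<Prod>k\<in>R. sgn k) * (\<Prod>k\<in>R. \<zeta> k)" by (simp add: prod.distrib)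
  have "(\<Prod>k\<in>R'. \<eta> (\<phi> (- k))) = (\<Prod>k\<in>R'. - 1 * sgn k * \<zeta> (\<phi> (- k)))"
  proof (rule prod.cong)
    fix k assume "k \<in> R'"
    then have "\<phi> (- k) \<in> pm I" "k \<in> pm I"
      using half_subset[OF R'] permutes_in_image[OF permutes_pm[OF \<phi>]] by auto
    moreover have "sgn (\<phi> (- k)) = - sgn k"
      using permutes_pos[OF \<phi>, of "- k"] pm_nonzero[OF \<open>\<phi> (- k) \<in> pm I\<close>] pm_nonzero[OF \<open>k \<in> pm I\<close>]
      by (auto simp: sgn_if)
    ultimately show "\<eta> (\<phi> (- k)) = - 1 * sgn k * \<zeta> (\<phi> (- k))" using \<eta>_eq by simp
  qed simp
  also have "\<dots> = (- 1) ^ card I * (\<Prod>k\<in>R'. sgn k) * (\<Prod>k\<in>R'. \<zeta> (\<phi> (- k)))"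
    using card_half[OF R'] by (simp only: prod.distrib prod_constant)
  finally have 2: "(\<Prod>k\<in>R'. \<eta> (\<phi> (- k))) =
    (- 1) ^ card I * (\<Prod>k\<in>R'. sgn k) * (\<Prod>k\<in>R'. \<zeta> (\<phi> (- k)))" .
  have 3: "(\<Prod>k\<in>I. \<eta> k) * (\<Prod>k\<in>I. \<eta> (- k)) = 1"
  proof -
    \<comment> \<open>The product over all signed indices can be taken along the pairing of \<open>\<beta>\<close>.\<close>
    have all: "(\<Prod>k\<in>I. g k * g (- k)) = prod g (pm I)" for g :: "int \<Rightarrow> int"
    proof -
      have "k \<notin> uminus ` I" if "k \<in> I" for k
        using positive[OF that] positive[of "- k"] by auto
      then have "prod g (pm I) = prod g I * prod g (uminus ` I)"
        unfolding pm_def using finite_I by (intro prod.union_disjoint) auto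
      then show ?thesis by (simp add: prod.reindex prod.distrib)
    qed
    have "(\<Prod>k\<in>I. \<zeta> k * \<zeta> (- k)) = prod \<zeta> (pm I)" by (rule all)
    also have "\<dots> = (\<Prod>k\<in>pm I. \<zeta> (frame \<beta> R k))"
      using prod.permute[OF frame_permutes[OF \<beta> R], of \<zeta>] by (simp add: comp_def)
    also have "\<dots> = (\<Prod>k\<in>I. \<zeta> (frame \<beta> R k) * \<zeta> (frame \<beta> R (- k)))" by (rule all[symmetric])
    also have "\<dots> = (\<Prod>k\<in>I. - 1)"
    proof (rule prod.cong)
      fix k assume "k \<in> I"
      then have k: "k \<in> pm I" using subset_pm by auto
      then have f: "frame \<beta> R k \<in> pm I" using permutes_in_image[OF frame_permutes[OF \<beta> R]] by simp
      show "\<zeta> (frame \<beta> R k) * \<zeta> (frame \<beta> R (- k)) = - 1"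
        using frame_uminus[OF \<beta> R k] \<zeta>[OF f] square[OF f] by simp
    qed simp
    finally have *: "(\<Prod>k\<in>I. \<zeta> k * \<zeta> (- k)) = (\<Prod>k\<in>I. - 1)" .
    have "(\<Prod>k\<in>I. \<eta> k) * (\<Prod>k\<in>I. \<eta> (- k)) = (\<Prod>k\<in>I. - 1 * (\<zeta> k * \<zeta> (- k)))"
      unfolding prod.distrib[symmetric]
    proof (rule prod.cong)
      fix k assume "k \<in> I"
      then have k: "k \<in> pm I" using subset_pm by auto
      then show "\<eta> k * \<eta> (- k) = - 1 * (\<zeta> k * \<zeta> (- k))"
        using sgn_square_pm[OF k] by (simp add: \<zeta>_def ac_simps)
    qed simp
    also have "\<dots> = (\<Prod>k\<in>I. - 1) * (\<Prod>k\<in>I. \<zeta> k * \<zeta> (- k))" by (simp only: prod.distrib)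
    also have "\<dots> = 1" unfolding * by (simp flip: power_mult_distrib)
    finally show ?thesis .
  qed
  have "(\<Prod>k\<in>R. \<zeta> k) * (\<Prod>k\<in>R. \<zeta> k) = 1" "(\<Prod>k\<in>R. sgn k) * (\<Prod>k\<in>R. sgn k) = (1::int)"
    "(\<Prod>k\<in>R'. sgn k) * (\<Prod>k\<in>R'. sgn k) = (1::int)"
    using half_subset[OF R] half_subset[OF R'] square sgn_square_pm
    by (auto simp flip: prod.distrib intro!: prod.neutral)
  then show ?thesis
    using 3 prod_Kreweras[where \<zeta>=\<zeta>, OF \<phi> \<beta> R R' \<zeta>] unfolding 1 2
    by (simp add: power_add ac_simps) (simp flip: mult.assoc)
qed

end


section \<open>Entries of quaternionic matrices\<close>

lemma qentry_zero [simp]: "qentry 0 r s = 0"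
  by (simp add: qentry_def zero_quat_def complex_eq_iff)

lemma qentry_add: "qentry (p + q) r s = qentry p r s + qentry q r s"
  by (simp add: qentry_def plus_quat_def complex_eq_iff)

lemma qentry_sum: "qentry (sum g S) r s = (\<Sum>x\<in>S. qentry (g x) r s)"
  by (induction S rule: infinite_finite_induct) (simp_all add: qentry_add)

lemma qentry_matrix_mult:
  "qentry ((A ** B) $ a $ b) r s =
    (\<Sum>j\<in>UNIV. \<Sum>t\<in>{1, - 1}. qentry (A $ a $ j) r t * qentry (B $ j $ b) t s)"
  by (simp add: matrix_matrix_mult_def qentry_sum qentry_mult)

text \<open>The conjugate transpose of the matrix of a quaternion is also its adjugate, which has the same entries
  up to position and sign. All signs in the theorem come from this.\<close>

lemma qentry_qcnj_adjugate:
  assumes "r = 1 \<or> r = - 1" "s = 1 \<or> s = - 1"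
  shows "qentry (qcnj q) r s = of_int (r * s) * qentry q (- s) (- r)"
  using assms by (auto simp: qentry_def qcnj_def complex_eq_iff)

lemma qentry_qadjoint:
  assumes "r = 1 \<or> r = - 1" "s = 1 \<or> s = - 1"
  shows "qentry (qadjoint A $ a $ b) r s = of_int (r * s) * qentry (A $ b $ a) (- s) (- r)"
  unfolding qadjoint_def using qentry_qcnj_adjugate[OF assms] by simp

lemma qentry_signed_mat_uminus:
  assumes "k \<noteq> 0" "r = 1 \<or> r = - 1" "s = 1 \<or> s = - 1"
  shows "qentry (signed_mat A (- k) $ b $ a) r s =
    of_int (r * s) * qentry (signed_mat A k $ a $ b) (- s) (- r)"
  using assms(1) qentry_qadjoint[OF assms(2,3)] qentry_qadjoint[of "- s" "- r" "A (- k)" a b] assms(2,3)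
  by (auto simp: signed_mat_def)


section \<open>Index sums\<close>

lemma sum_nested_filter:
  fixes c :: "'c::semiring_0"
  assumes "finite S" "finite T"
  shows "(\<Sum>x\<in>S. \<Sum>y\<in>T. if P x then if Q y then c * g x y else 0 else 0) =
    c * (\<Sum>x\<in>{x \<in> S. P x}. \<Sum>y\<in>{y \<in> T. Q y}. g x y)"
proof -
  have "(\<Sum>y\<in>T. if P x then if Q y then c * g x y else 0 else 0) =
      (if P x then c * (\<Sum>y\<in>{y \<in> T. Q y}. g x y) else 0)" for x
    unfolding sum.inter_filter[OF assms(2)] sum_distrib_left by (auto intro!: sum.cong)
  then show ?thesis
    by (simp only: sum.inter_filter[OF assms(1), symmetric] sum_distrib_left)
qed

context signed_index
begin

text \<open>The sum in \<^const>\<open>Re_tr\<close> without its normalization, with the product taken over an arbitrary set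
  in place of \<^const>\<open>FD\<close>.\<close>

definition trace_sum ::
  "int set \<Rightarrow> (int \<Rightarrow> int) \<Rightarrow> (int \<Rightarrow> int) \<Rightarrow> (int \<Rightarrow> quat^'n^'n) \<Rightarrow> complex" where
  "trace_sum R \<pi> \<rho> A =
    (\<Sum>i\<in>{i \<in> pm I \<rightarrow>\<^sub>E UNIV. \<forall>k\<in>pm I. i (- k) = i (\<rho> k)}.
      \<Sum>h\<in>R \<rightarrow>\<^sub>E {1, - 1}. \<Prod>k\<in>R. qentry (signed_mat A k $ i k $ i (- k)) (h k) (h (\<pi> k)))"

text \<open>A function whose values on each pair of opposite cycles determine each other is determined by
  its values on a half. This is applied to indices with \<open>c = id\<close> and to signs with \<open>c\<close> the
  negation.\<close>

lemma sum_paired: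
  assumes \<rho>: "\<rho> \<in> PM I" and R: "half \<rho> R"
    and c: "\<And>x. x \<in> B \<Longrightarrow> c x \<in> B" "\<And>x. x \<in> B \<Longrightarrow> c (c x) = x"
  shows "(\<Sum>h\<in>R \<rightarrow>\<^sub>E B. g h) =
    (\<Sum>i\<in>{i \<in> pm I \<rightarrow>\<^sub>E B. \<forall>k\<in>pm I. i (- k) = c (i (\<rho> k))}. g (restrict i R))"
proof (rule sum.reindex_bij_witness[where j="\<lambda>h. \<lambda>k\<in>pm I. if k \<in> R then h k else c (h (\<rho> (- k)))"
      and i="\<lambda>i. restrict i R"])
  note sub = half_subset[OF R] and opp = half_uminus[OF R] and closed = half_closed[OF R]
  fix h assume h: "h \<in> R \<rightarrow>\<^sub>E B"
  let ?i = "\<lambda>k\<in>pm I. if k \<in> R then h k else c (h (\<rho> (- k)))"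
  show "restrict ?i R = h"
    using h sub by (auto simp: fun_eq_iff PiE_def extensional_def)
  then show "g (restrict ?i R) = g h" by simp
  have "?i (- k) = c (?i (\<rho> k))" if k: "k \<in> pm I" for k
  proof (cases "k \<in> R")
    case True
    then show ?thesis using k opp[OF k] closed PM_in_pm[OF \<rho>] by auto
  next
    case False
    then have "- k \<in> R" using opp[OF k] by simp
    then have "inv \<rho> (- k) \<in> R" using half_closed[OF half_inv[OF PM_permutes[OF \<rho>] R]] by simp
    moreover have eq: "\<rho> k = - inv \<rho> (- k)" using PM_uminus[OF \<rho>, of "- k"] by simp
    ultimately have "\<rho> k \<notin> R" using opp[of "inv \<rho> (- k)"] sub by auto
    moreover have "\<rho> (- \<rho> k) = - k" by (rule PM_skew[OF \<rho>])
    ultimately show ?thesis using \<open>- k \<in> R\<close> k PM_in_pm[OF \<rho>] h c by (auto simp: PiE_iff)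
  qed
  moreover have "?i \<in> pm I \<rightarrow>\<^sub>E B" using h c(1) opp closed by (auto simp: PiE_iff)
  ultimately show "?i \<in> {i \<in> pm I \<rightarrow>\<^sub>E B. \<forall>k\<in>pm I. i (- k) = c (i (\<rho> k))}" by blast
next
  note sub = half_subset[OF R] and opp = half_uminus[OF R] and closed = half_closed[OF R]
  fix i assume i: "i \<in> {i \<in> pm I \<rightarrow>\<^sub>E B. \<forall>k\<in>pm I. i (- k) = c (i (\<rho> k))}"
  then show "restrict i R \<in> R \<rightarrow>\<^sub>E B" using sub by (auto simp: PiE_iff)
  show "(\<lambda>k\<in>pm I. if k \<in> R then restrict i R k else c (restrict i R (\<rho> (- k)))) = i"
  proof
    fix k
    show "(\<lambda>k\<in>pm I. if k \<in> R then restrict i R k else c (restrict i R (\<rho> (- k)))) k = i k"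
    proof (cases "k \<in> pm I")
      case True
      then have "k \<notin> R \<Longrightarrow> \<rho> (- k) \<in> R" using opp closed by blast
      moreover have "i (- (- k)) = c (i (\<rho> (- k)))" using i True by (metis (mono_tags, lifting) mem_Collect_eq uminus_in_pm)
      ultimately show ?thesis using True by auto
    next
      case False
      then show ?thesis using i by (auto simp: PiE_iff extensional_def)
    qed
  qed
qed

lemma sum_pm_functions:
  "(\<Sum>i\<in>pm I \<rightarrow>\<^sub>E B. g i) =
    (\<Sum>a\<in>I \<rightarrow>\<^sub>E B. \<Sum>b\<in>I \<rightarrow>\<^sub>E B. g (\<lambda>k\<in>pm I. if k > 0 then a k else b (- k)))"
  unfolding sum.cartesian_product
proof (rule sum.reindex_bij_witness[
      where j="\<lambda>i. (restrict i I, \<lambda>k\<in>I. i (- k))"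
        and i="\<lambda>(a, b). \<lambda>k\<in>pm I. if k > 0 then a k else b (- k)"])
  have neg: "- k \<in> I" if "k \<in> pm I" "\<not> 0 < k" for k
    using that pm_nonzero[of k] by (auto simp: in_I_iff)
  fix i assume i: "i \<in> pm I \<rightarrow>\<^sub>E B"
  show *: "(case (restrict i I, \<lambda>k\<in>I. i (- k)) of (a, b) \<Rightarrow> \<lambda>k\<in>pm I. if k > 0 then a k else b (- k)) = i"
    using i neg in_I_iff by (auto simp: fun_eq_iff PiE_iff extensional_def)
  show "(case (restrict i I, \<lambda>k\<in>I. i (- k)) of (a, b) \<Rightarrow>
      g (\<lambda>k\<in>pm I. if k > 0 then a k else b (- k))) = g i"
    using * by simp
  show "(restrict i I, \<lambda>k\<in>I. i (- k)) \<in> (I \<rightarrow>\<^sub>E B) \<times> (I \<rightarrow>\<^sub>E B)"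
    using i subset_pm by (auto simp: PiE_iff)
next
  have neg: "- k \<in> I" if "k \<in> pm I" "\<not> 0 < k" for k
    using that pm_nonzero[of k] by (auto simp: in_I_iff)
  fix ab assume ab: "ab \<in> (I \<rightarrow>\<^sub>E B) \<times> (I \<rightarrow>\<^sub>E B)"
  then obtain a b where [simp]: "ab = (a, b)" and a: "a \<in> I \<rightarrow>\<^sub>E B" and b: "b \<in> I \<rightarrow>\<^sub>E B" by auto
  show "(case ab of (a, b) \<Rightarrow> \<lambda>k\<in>pm I. if k > 0 then a k else b (- k)) \<in> pm I \<rightarrow>\<^sub>E B"
    using a b neg in_I_iff by (auto simp: PiE_iff)
  have "restrict (\<lambda>k\<in>pm I. if k > 0 then a k else b (- k)) I = a"
    using a subset_pm positive by (auto simp: fun_eq_iff PiE_iff extensional_def)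
  moreover have "(\<lambda>k\<in>I. (\<lambda>k\<in>pm I. if k > 0 then a k else b (- k)) (- k)) = b"
    using b subset_pm by (auto simp: fun_eq_iff PiE_iff extensional_def dest: positive)
  ultimately show "(restrict (case ab of (a, b) \<Rightarrow> \<lambda>k\<in>pm I. if k > 0 then a k else b (- k)) I,
      \<lambda>k\<in>I. (case ab of (a, b) \<Rightarrow> \<lambda>k\<in>pm I. if k > 0 then a k else b (- k)) (- k)) = ab"
    by simp
qed

text \<open>Once the matrix products are written out, the indices of \<open>B\<^sub>k\<close> run freely over all functions on
  the signed indices, and the indices of \<open>Y\<^sub>k\<close> are theirs shifted by \<open>\<phi>\<delta>\<close>.\<close>

lemma trace_sum_doubled:
  fixes B Y :: "int \<Rightarrow> quat^'n^'n"
  assumes \<phi>: "\<phi> permutes I" and \<psi>: "\<psi> permutes I"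
  shows "trace_sum I (doubled \<phi>) (doubled \<psi>) (\<lambda>k. B k ** Y k) =
    (\<Sum>i\<in>pm I \<rightarrow>\<^sub>E UNIV. \<Sum>\<eta>\<in>pm I \<rightarrow>\<^sub>E {1, - 1}.
      (\<Prod>k\<in>I. qentry (B k $ i k $ i (- k)) (\<eta> k) (\<eta> (- k))) *
      (\<Prod>k\<in>I. qentry (Y k $ i (- k) $ i (\<psi> k)) (\<eta> (- k)) (\<eta> (\<phi> k))))"
proof -
  define g where "g = (\<lambda>a. \<Sum>h\<in>I \<rightarrow>\<^sub>E {1, - 1}.
    \<Prod>k\<in>I. qentry ((B k ** Y k) $ a k $ a (\<psi> k)) (h k) (h (\<phi> k)))"
  define G where "G = (\<lambda>a b h s. (\<Prod>k\<in>I. qentry (B k $ a k $ b k) (h k) (s k)) *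
    (\<Prod>k\<in>I. qentry (Y k $ b k $ a (\<psi> k)) (s k) (h (\<phi> k))))"
  have "trace_sum I (doubled \<phi>) (doubled \<psi>) (\<lambda>k. B k ** Y k) =
      (\<Sum>i\<in>{i \<in> pm I \<rightarrow>\<^sub>E UNIV. \<forall>k\<in>pm I. i (- k) = id (i (doubled \<psi> k))}. g (restrict i I))"
    unfolding trace_sum_def g_def
  proof (intro sum.cong prod.cong refl)
    fix i :: "int \<Rightarrow> 'n" and h k
    assume i: "i \<in> {i \<in> pm I \<rightarrow>\<^sub>E UNIV. \<forall>k\<in>pm I. i (- k) = id (i (doubled \<psi> k))}" and k: "k \<in> I"
    then show "qentry (signed_mat (\<lambda>k. B k ** Y k) k $ i k $ i (- k)) (h k) (h (doubled \<phi> k)) =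
        qentry ((B k ** Y k) $ restrict i I k $ restrict i I (\<psi> k)) (h k) (h (\<phi> k))"
      using positive[OF k] subset_pm doubled_pos[OF \<phi>] doubled_pos[OF \<psi>] permutes_in_image[OF \<psi>]
      by (auto simp: signed_mat_def)
  qed auto
  also have "\<dots> = (\<Sum>a\<in>I \<rightarrow>\<^sub>E UNIV. g a)"
    by (rule sum_paired[OF doubled_PM[OF \<psi>] half_doubled[OF \<psi>], symmetric]) auto
  also have "\<dots> = (\<Sum>a\<in>I \<rightarrow>\<^sub>E UNIV. \<Sum>h\<in>I \<rightarrow>\<^sub>E {1, - 1}. \<Sum>b\<in>I \<rightarrow>\<^sub>E UNIV. \<Sum>s\<in>I \<rightarrow>\<^sub>E {1, - 1}. G a b h s)"
    unfolding g_def qentry_matrix_mult G_def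
    by (simp only: prod_sum_PiE finite_I finite finite.intros finite_class.finite_UNIV
        prod.distrib flip: prod.distrib)
  also have "\<dots> = (\<Sum>a\<in>I \<rightarrow>\<^sub>E UNIV. \<Sum>b\<in>I \<rightarrow>\<^sub>E UNIV. \<Sum>h\<in>I \<rightarrow>\<^sub>E {1, - 1}. \<Sum>s\<in>I \<rightarrow>\<^sub>E {1, - 1}. G a b h s)"
    by (intro sum.cong refl sum.swap)
  also have "\<dots> = (\<Sum>i\<in>pm I \<rightarrow>\<^sub>E UNIV. \<Sum>\<eta>\<in>pm I \<rightarrow>\<^sub>E {1, - 1}. G i (\<lambda>k. i (- k)) \<eta> (\<lambda>k. \<eta> (- k)))"
    unfolding sum_pm_functions
  proof (intro sum.cong refl)
    fix a :: "int \<Rightarrow> 'n" and b h s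
    have "\<psi> k \<in> I" "\<phi> k \<in> I" if "k \<in> I" for k
      using that permutes_in_image[OF \<phi>] permutes_in_image[OF \<psi>] by auto
    then show "G a b h s = G (\<lambda>k\<in>pm I. if k > 0 then a k else b (- k))
        (\<lambda>k. (\<lambda>k\<in>pm I. if k > 0 then a k else b (- k)) (- k))
        (\<lambda>k\<in>pm I. if k > 0 then h k else s (- k))
        (\<lambda>k. (\<lambda>k\<in>pm I. if k > 0 then h k else s (- k)) (- k))"
      unfolding G_def using in_I_iff
      by (intro arg_cong2[where f="(*)"] prod.cong refl) auto
  qed
  finally show ?thesis by (simp add: G_def)
qed

text \<open>The entry at \<open>k\<close> multiplied by \<open>\<eta> k\<close> is an even function of \<open>k\<close> if adjoints are used at negative
  \<open>k\<close>, and the product of an even function does not depend on the half.\<close>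

lemma prod_reorient:
  fixes Y :: "int \<Rightarrow> quat^'n^'n"
  assumes R: "half \<pi> R" and \<eta>: "\<And>k. k \<in> pm I \<Longrightarrow> \<eta> k = 1 \<or> \<eta> k = - 1"
  shows "(\<Prod>k\<in>I. qentry (Y k $ j k $ j (- k)) (\<eta> k) (\<eta> (- k))) =
    of_int ((\<Prod>k\<in>R. \<eta> k) * (\<Prod>k\<in>I. \<eta> k)) *
    (\<Prod>k\<in>R. qentry (signed_mat Y k $ j k $ j (- k)) (sgn k * \<eta> k) (sgn k * \<eta> (- k)))"
proof -
  define g where "g = (\<lambda>k. of_int (\<eta> k) *
    qentry (signed_mat Y k $ j k $ j (- k)) (sgn k * \<eta> k) (sgn k * \<eta> (- k)))"
  have "g (- k) = g k" if k: "k \<in> pm I" for k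
  proof -
    have \<eta>k: "\<eta> k = 1 \<or> \<eta> k = - 1" "\<eta> (- k) = 1 \<or> \<eta> (- k) = - 1" using \<eta> k by auto
    have s: "sgn k = 1 \<or> sgn k = - 1" using pm_nonzero[OF k] by (auto simp: sgn_if)
    have v: "- sgn k * \<eta> (- k) = 1 \<or> - sgn k * \<eta> (- k) = - 1"
      "- sgn k * \<eta> k = 1 \<or> - sgn k * \<eta> k = - 1" using \<eta>k s by auto
    have "g (- k) = of_int (\<eta> (- k)) *
        qentry (signed_mat Y (- k) $ j (- k) $ j k) (- sgn k * \<eta> (- k)) (- sgn k * \<eta> k)"
      by (simp add: g_def)
    also have "\<dots> = of_int (\<eta> (- k)) * (of_int ((- sgn k * \<eta> (- k)) * (- sgn k * \<eta> k)) *
        qentry (signed_mat Y k $ j k $ j (- k)) (sgn k * \<eta> k) (sgn k * \<eta> (- k)))"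
      unfolding qentry_signed_mat_uminus[OF pm_nonzero[OF k] v] by simp
    also have "\<dots> = g k" using \<eta>k s by (auto simp: g_def)
    finally show ?thesis .
  qed
  then have gR: "prod g R = prod g I" by (rule prod_half[OF R])
  have gI: "prod g I = of_int (\<Prod>k\<in>I. \<eta> k) *
      (\<Prod>k\<in>I. qentry (Y k $ j k $ j (- k)) (\<eta> k) (\<eta> (- k)))"
    unfolding g_def prod.distrib of_int_prod
    by (intro arg_cong2[where f="(*)"] prod.cong refl) (auto simp: signed_mat_def dest: positive)
  have "(\<Prod>k\<in>I. \<eta> k) * (\<Prod>k\<in>I. \<eta> k) = 1"
    unfolding prod.distrib[symmetric] using \<eta> subset_pm by (intro prod.neutral) fastforce
  then have "of_int (\<Prod>k\<in>I. \<eta> k) * of_int (\<Prod>k\<in>I. \<eta> k) = (1::complex)"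
    by (metis of_int_1 of_int_mult)
  then have "(\<Prod>k\<in>I. qentry (Y k $ j k $ j (- k)) (\<eta> k) (\<eta> (- k))) =
      of_int (\<Prod>k\<in>I. \<eta> k) * (of_int (\<Prod>k\<in>I. \<eta> k) *
        (\<Prod>k\<in>I. qentry (Y k $ j k $ j (- k)) (\<eta> k) (\<eta> (- k))))"
    by (simp only: mult.assoc[symmetric] mult_1)
  also have "\<dots> = of_int (\<Prod>k\<in>I. \<eta> k) * prod g R"
    unfolding gR gI ..
  also have "prod g R = of_int (\<Prod>k\<in>R. \<eta> k) *
      (\<Prod>k\<in>R. qentry (signed_mat Y k $ j k $ j (- k)) (sgn k * \<eta> k) (sgn k * \<eta> (- k)))"
    by (simp add: g_def prod.distrib)
  finally show ?thesis by (simp add: ac_simps)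
qed

text \<open>The constraints that \<open>\<beta>\<close> imposes on the entries of the \<open>X\<^sub>k\<close> become,
  after the shift by \<open>\<phi>\<delta>\<close>, those that the Kreweras complement imposes on the entries of the
  \<open>Y\<^sub>k\<close>. The twist \<open>u\<close> is trivial for indices and is the sign of the argument for the
  row and column signs.\<close>

lemma sum_Kreweras_shift:
  assumes \<phi>: "\<phi> permutes I" and \<beta>: "\<beta> \<in> PM I"
    and u_in: "\<And>k x. k \<in> pm I \<Longrightarrow> x \<in> B \<Longrightarrow> u k x \<in> B"
    and u_u: "\<And>k x. k \<in> pm I \<Longrightarrow> x \<in> B \<Longrightarrow> u k (u k x) = x"
    and u_sgn: "\<And>k l x. sgn k = sgn l \<Longrightarrow> u k x = u l x"
    and u_uminus: "\<And>k x. u (- k) x = c (u k x)"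
    and c: "\<And>x. x \<in> B \<Longrightarrow> c (c x) = x"
  shows "(\<Sum>i\<in>{i \<in> pm I \<rightarrow>\<^sub>E B. \<forall>k\<in>pm I. u k (i k) = u (\<beta> k) (i (- \<beta> k))}.
      g (\<lambda>k\<in>pm I. u k (i (\<phi> (- k))))) =
    (\<Sum>j\<in>{j \<in> pm I \<rightarrow>\<^sub>E B. \<forall>k\<in>pm I. j (- k) = c (j (inv (Kreweras \<phi> \<beta>) k))}. g j)"
proof -
  let ?K = "Kreweras \<phi> \<beta>"
  let ?S = "{i \<in> pm I \<rightarrow>\<^sub>E B. \<forall>k\<in>pm I. u k (i k) = u (\<beta> k) (i (- \<beta> k))}"
  let ?T = "{j \<in> pm I \<rightarrow>\<^sub>E B. \<forall>k\<in>pm I. j (- k) = c (j (inv ?K k))}"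
  let ?f = "\<lambda>i. \<lambda>k\<in>pm I. u k (i (\<phi> (- k)))"
  let ?f' = "\<lambda>j. \<lambda>m\<in>pm I. u (- inv \<phi> m) (j (- inv \<phi> m))"
  note K = Kreweras_PM[OF \<phi> \<beta>]
  have \<phi>_pm: "\<phi> k \<in> pm I \<longleftrightarrow> k \<in> pm I" "inv \<phi> k \<in> pm I \<longleftrightarrow> k \<in> pm I" for k
    using permutes_in_image[OF permutes_pm[OF \<phi>]]
      permutes_in_image[OF permutes_pm[OF permutes_inv[OF \<phi>]]] by auto
  have \<phi>_inv: "\<phi> (inv \<phi> k) = k" "inv \<phi> (\<phi> k) = k" for k
    by (simp_all add: permutes_inverses[OF \<phi>])
  have sgn_\<phi>: "sgn (\<phi> k) = sgn k" if "k \<in> pm I" for k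
    using permutes_pos[OF \<phi>, of k] pm_nonzero[OF that] pm_nonzero[of "\<phi> k"] that \<phi>_pm
    by (auto simp: sgn_if)
  have \<phi>K: "\<phi> (- inv ?K k) = - \<beta> (\<phi> k)" for k
    using phi_Kreweras[OF \<phi> \<beta>, of "- k"] PM_uminus[OF K, of k] by simp
  have sgn_K: "sgn (inv ?K k) = sgn (\<beta> (\<phi> k))" if "k \<in> pm I" for k
  proof -
    have "sgn (\<phi> (- inv ?K k)) = sgn (- inv ?K k)"
      using that PM_in_pm[OF PM_inv[OF K]] by (intro sgn_\<phi>) simp
    then show ?thesis unfolding \<phi>K by simp
  qed
  have constraint: "?f i (- k) = c (?f i (inv ?K k)) \<longleftrightarrow>
      u (\<phi> k) (i (\<phi> k)) = u (\<beta> (\<phi> k)) (i (- \<beta> (\<phi> k)))"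
    if i: "i \<in> pm I \<rightarrow>\<^sub>E B" and k: "k \<in> pm I" for i k
  proof -
    have "?f i (- k) = c (u (\<phi> k) (i (\<phi> k)))"
      using k u_sgn[OF sgn_\<phi>[OF k]] by (simp add: u_uminus)
    moreover have "?f i (inv ?K k) = u (\<beta> (\<phi> k)) (i (- \<beta> (\<phi> k)))"
      using k PM_in_pm[OF PM_inv[OF K]] \<phi>K u_sgn[OF sgn_K[OF k]] by simp
    moreover have "u (\<phi> k) (i (\<phi> k)) \<in> B" "u (\<beta> (\<phi> k)) (i (- \<beta> (\<phi> k))) \<in> B"
      using i k \<phi>_pm PM_in_pm[OF \<beta>] by (auto intro!: u_in simp: PiE_iff)
    ultimately show ?thesis using c by metis
  qed
  show ?thesis
  proof (rule sum.reindex_bij_witness[where j="?f" and i="?f'"])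
    fix i assume i: "i \<in> ?S"
    show "?f' (?f i) = i"
      using i \<phi>_pm u_u by (auto simp: fun_eq_iff PiE_iff extensional_def \<phi>_inv)
    show "?f i \<in> ?T"
      using i constraint \<phi>_pm by (auto intro!: u_in simp: PiE_iff simp del: restrict_apply)
         (auto simp: u_in)
    show "g (?f i) = g (?f i)" ..
  next
    fix j assume j: "j \<in> ?T"
    show *: "?f (?f' j) = j"
      using j \<phi>_pm u_u by (auto simp: fun_eq_iff PiE_iff extensional_def \<phi>_inv)
    have jB: "j \<in> pm I \<rightarrow>\<^sub>E B" using j by blast
    have "u (- inv \<phi> m) (j (- inv \<phi> m)) \<in> B" if "m \<in> pm I" for m
      by (rule u_in[OF _ PiE_mem[OF jB]]) (simp_all add: \<phi>_pm that)
    then have f'j: "?f' j \<in> pm I \<rightarrow>\<^sub>E B" by simp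
    moreover have "u m (?f' j m) = u (\<beta> m) (?f' j (- \<beta> m))" if m: "m \<in> pm I" for m
    proof -
      have k: "inv \<phi> m \<in> pm I" using m \<phi>_pm by simp
      have "?f (?f' j) (- inv \<phi> m) = c (?f (?f' j) (inv ?K (inv \<phi> m)))"
        unfolding * using j k by blast
      then show ?thesis unfolding constraint[OF f'j k] \<phi>_inv .
    qed
    ultimately show "?f' j \<in> ?S" by blast
  qed
qed

text \<open>For a fixed \<open>\<beta>\<close>, the sum over all indices and signs that satisfy its constraints is up to sign the
  trace along the inverse of the Kreweras complement: the indices are shifted with \<open>\<psi>\<close> and the signs with \<open>\<phi>\<close>, and the product over
  the positive indices is moved to the half \<open>R'\<close>, where the signs are free.\<close>

lemma trace_sum_Kreweras:
  fixes Y :: "int \<Rightarrow> quat^'n^'n"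
  assumes \<phi>: "\<phi> permutes I" and \<psi>: "\<psi> permutes I" and \<beta>: "\<beta> \<in> PM I" and R: "half \<beta> R"
    and R': "half (Kreweras \<phi> \<beta>) R'"
  shows "(\<Sum>i\<in>{i \<in> pm I \<rightarrow>\<^sub>E UNIV. \<forall>k\<in>pm I. i k = i (- \<beta> k)}.
      \<Sum>\<eta>\<in>{\<eta> \<in> pm I \<rightarrow>\<^sub>E {1, - 1}. \<forall>k\<in>pm I. sgn k * \<eta> k = sgn (\<beta> k) * \<eta> (- \<beta> k)}.
        of_int ((\<Prod>k\<in>R. \<eta> k) * (\<Prod>k\<in>I. \<eta> k)) *
        (\<Prod>k\<in>I. qentry (Y k $ i (- k) $ i (\<psi> k)) (\<eta> (- k)) (\<eta> (\<phi> k)))) =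
    (- 1) ^ (num_cycles I \<phi> + num_cycles R \<beta> + num_cycles R' (Kreweras \<phi> \<beta>) + card I) *
    trace_sum R' (inv (Kreweras \<phi> \<beta>)) (inv (Kreweras \<psi> \<beta>)) Y"
proof -
  let ?K = "Kreweras \<phi> \<beta>"
  let ?s = "(- 1) ^ (num_cycles I \<phi> + num_cycles R \<beta> + num_cycles R' ?K + card I)"
  let ?N = "{\<eta> \<in> pm I \<rightarrow>\<^sub>E {1, - 1}. \<forall>k\<in>pm I. sgn k * \<eta> k = sgn (\<beta> k) * \<eta> (- \<beta> k)}"
  note K = Kreweras_PM[OF \<phi> \<beta>]
  define G where "G = (\<lambda>j h. \<Prod>k\<in>R'. qentry (signed_mat Y k $ j k $ j (- k)) (h k) (h (inv ?K k)))"
  have inner: "(\<Sum>\<eta>\<in>?N. of_int ((\<Prod>k\<in>R. \<eta> k) * (\<Prod>k\<in>I. \<eta> k)) *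
      (\<Prod>k\<in>I. qentry (Y k $ j k $ j (- k)) (\<eta> (- k)) (\<eta> (\<phi> k)))) =
    ?s * (\<Sum>h\<in>R' \<rightarrow>\<^sub>E {1, - 1}. G j h)" for j :: "int \<Rightarrow> 'n"
  proof -
    have "(\<Sum>\<eta>\<in>?N. of_int ((\<Prod>k\<in>R. \<eta> k) * (\<Prod>k\<in>I. \<eta> k)) *
        (\<Prod>k\<in>I. qentry (Y k $ j k $ j (- k)) (\<eta> (- k)) (\<eta> (\<phi> k)))) =
      (\<Sum>\<eta>\<in>?N. ?s * (\<Prod>k\<in>R'. qentry (signed_mat Y k $ j k $ j (- k))
        (sgn k * \<eta> (\<phi> (- k))) (- (sgn (- k) * \<eta> (\<phi> k)))))"
    proof (rule sum.cong)
      fix \<eta> assume "\<eta> \<in> ?N"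
      then have \<eta>: "\<eta> k = 1 \<or> \<eta> k = - 1" and pairing: "sgn k * \<eta> k = sgn (\<beta> k) * \<eta> (- \<beta> k)"
        if "k \<in> pm I" for k using that by auto
      define \<eta>' where "\<eta>' = (\<lambda>k. \<eta> (\<phi> (- k)))"
      have \<eta>': "\<eta>' k = 1 \<or> \<eta>' k = - 1" if "k \<in> pm I" for k
        unfolding \<eta>'_def using that permutes_in_image[OF permutes_pm[OF \<phi>]] by (intro \<eta>) simp
      have neg: "\<eta>' k = \<eta> (- k)" if "k \<in> I" for k
        using permutes_neg[OF \<phi>, of "- k"] positive[OF that] by (simp add: \<eta>'_def)
      have "(\<Prod>k\<in>I. qentry (Y k $ j k $ j (- k)) (\<eta> (- k)) (\<eta> (\<phi> k))) =
          (\<Prod>k\<in>I. qentry (Y k $ j k $ j (- k)) (\<eta>' k) (\<eta>' (- k)))"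
        using neg by (intro prod.cong) (auto simp: \<eta>'_def)
      also have "\<dots> = of_int ((\<Prod>k\<in>R'. \<eta>' k) * (\<Prod>k\<in>I. \<eta>' k)) *
          (\<Prod>k\<in>R'. qentry (signed_mat Y k $ j k $ j (- k)) (sgn k * \<eta>' k) (sgn k * \<eta>' (- k)))"
        by (rule prod_reorient[OF R' \<eta>'])
      finally have "of_int ((\<Prod>k\<in>R. \<eta> k) * (\<Prod>k\<in>I. \<eta> k)) *
          (\<Prod>k\<in>I. qentry (Y k $ j k $ j (- k)) (\<eta> (- k)) (\<eta> (\<phi> k))) =
        of_int ((\<Prod>k\<in>R. \<eta> k) * (\<Prod>k\<in>I. \<eta> k) * (\<Prod>k\<in>R'. \<eta>' k) * (\<Prod>k\<in>I. \<eta>' k)) *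
          (\<Prod>k\<in>R'. qentry (signed_mat Y k $ j k $ j (- k)) (sgn k * \<eta>' k) (sgn k * \<eta>' (- k)))"
        by (simp add: ac_simps)
      also have "(\<Prod>k\<in>I. \<eta>' k) = (\<Prod>k\<in>I. \<eta> (- k))" using neg by (intro prod.cong) auto
      also have "(\<Prod>k\<in>R. \<eta> k) * (\<Prod>k\<in>I. \<eta> k) * (\<Prod>k\<in>R'. \<eta>' k) * (\<Prod>k\<in>I. \<eta> (- k)) = ?s"
        unfolding \<eta>'_def by (rule sign_total[OF \<phi> \<beta> R R' \<eta> pairing])
      finally show "of_int ((\<Prod>k\<in>R. \<eta> k) * (\<Prod>k\<in>I. \<eta> k)) *
          (\<Prod>k\<in>I. qentry (Y k $ j k $ j (- k)) (\<eta> (- k)) (\<eta> (\<phi> k))) =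
        ?s * (\<Prod>k\<in>R'. qentry (signed_mat Y k $ j k $ j (- k))
          (sgn k * \<eta> (\<phi> (- k))) (- (sgn (- k) * \<eta> (\<phi> k))))"
        by (simp add: \<eta>'_def)
    qed simp
    also have "\<dots> = (\<Sum>\<eta>\<in>?N. ?s * (\<lambda>\<zeta>. \<Prod>k\<in>R'. qentry (signed_mat Y k $ j k $ j (- k))
        (\<zeta> k) (- \<zeta> (- k))) (\<lambda>k\<in>pm I. sgn k * \<eta> (\<phi> (- k))))"
      using half_subset[OF R'] by (intro sum.cong arg_cong2[where f="(*)"] prod.cong refl) auto
    also have "\<dots> = (\<Sum>\<zeta>\<in>{\<zeta> \<in> pm I \<rightarrow>\<^sub>E {1, - 1}. \<forall>k\<in>pm I. \<zeta> (- k) = - \<zeta> (inv ?K k)}.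
        ?s * (\<Prod>k\<in>R'. qentry (signed_mat Y k $ j k $ j (- k)) (\<zeta> k) (- \<zeta> (- k))))"
      by (rule sum_Kreweras_shift[OF \<phi> \<beta>])
         (auto simp: sgn_if dest: pm_nonzero)
    also have "\<dots> = (\<Sum>\<zeta>\<in>{\<zeta> \<in> pm I \<rightarrow>\<^sub>E {1, - 1}. \<forall>k\<in>pm I. \<zeta> (- k) = - \<zeta> (inv ?K k)}.
        ?s * G j (restrict \<zeta> R'))"
      unfolding G_def
      using half_subset[OF R'] half_closed[OF half_inv[OF PM_permutes[OF K] R']]
      by (intro sum.cong arg_cong2[where f="(*)"] prod.cong refl) auto
    also have "\<dots> = (\<Sum>h\<in>R' \<rightarrow>\<^sub>E {1, - 1}. ?s * G j h)"
      by (rule sum_paired[OF PM_inv[OF K] half_inv[OF PM_permutes[OF K] R'], symmetric]) auto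
    finally show ?thesis by (simp add: sum_distrib_left)
  qed
  have "(\<Sum>i\<in>{i \<in> pm I \<rightarrow>\<^sub>E UNIV. \<forall>k\<in>pm I. i k = i (- \<beta> k)}.
      \<Sum>\<eta>\<in>?N. of_int ((\<Prod>k\<in>R. \<eta> k) * (\<Prod>k\<in>I. \<eta> k)) *
        (\<Prod>k\<in>I. qentry (Y k $ i (- k) $ i (\<psi> k)) (\<eta> (- k)) (\<eta> (\<phi> k)))) =
    (\<Sum>i\<in>{i \<in> pm I \<rightarrow>\<^sub>E UNIV. \<forall>k\<in>pm I. (\<lambda>_. id) k (i k) = (\<lambda>_. id) (\<beta> k) (i (- \<beta> k))}.
      (\<lambda>j. \<Sum>\<eta>\<in>?N. of_int ((\<Prod>k\<in>R. \<eta> k) * (\<Prod>k\<in>I. \<eta> k)) *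
        (\<Prod>k\<in>I. qentry (Y k $ j k $ j (- k)) (\<eta> (- k)) (\<eta> (\<phi> k))))
      (\<lambda>k\<in>pm I. (\<lambda>_. id) k (i (\<psi> (- k)))))"
  proof (intro sum.cong refl arg_cong2[where f="(*)"] prod.cong)
    fix i :: "int \<Rightarrow> 'n" and \<eta> k assume k: "k \<in> I"
    then show "qentry (Y k $ i (- k) $ i (\<psi> k)) (\<eta> (- k)) (\<eta> (\<phi> k)) =
      qentry (Y k $ (\<lambda>k\<in>pm I. (\<lambda>_. id) k (i (\<psi> (- k)))) k $
        (\<lambda>k\<in>pm I. (\<lambda>_. id) k (i (\<psi> (- k)))) (- k)) (\<eta> (- k)) (\<eta> (\<phi> k))"
      using permutes_neg[OF \<psi>, of "- k"] positive[OF k] subset_pm by auto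
  qed simp
  also have "\<dots> = (\<Sum>j\<in>{j \<in> pm I \<rightarrow>\<^sub>E UNIV. \<forall>k\<in>pm I. j (- k) = id (j (inv (Kreweras \<psi> \<beta>) k))}.
      \<Sum>\<eta>\<in>?N. of_int ((\<Prod>k\<in>R. \<eta> k) * (\<Prod>k\<in>I. \<eta> k)) *
        (\<Prod>k\<in>I. qentry (Y k $ j k $ j (- k)) (\<eta> (- k)) (\<eta> (\<phi> k))))"
    by (rule sum_Kreweras_shift[OF \<psi> \<beta>]) auto
  finally show ?thesis
    unfolding inner trace_sum_def by (simp add: G_def sum_distrib_left)
qed


subsection \<open>Adjoints and moments\<close>

text \<open>Taking adjoints of the \<open>X\<^sub>k\<close> with \<open>\<epsilon>(k) = -1\<close> amounts to applying
  \<open>\<delta>\<^sub>\<epsilon>\<close> to the indices and to the signs multiplied by \<open>sgn\<close>.\<close>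

definition flipped_signs :: "(int \<Rightarrow> int) \<Rightarrow> (int \<Rightarrow> int) \<Rightarrow> int \<Rightarrow> int" where
  "flipped_signs e \<eta> k = sgn k * sgn (sign_flip I e k) * \<eta> (sign_flip I e k)"

context
  fixes e :: "int \<Rightarrow> int"
  assumes e: "\<And>k. k \<in> I \<Longrightarrow> e k = 1 \<or> e k = - 1"
begin

lemma sign_flip_eq: "k \<in> I \<Longrightarrow> sign_flip I e k = e k * k"
  using subset_pm by (auto simp: sign_flip_def abs_if dest: positive)

lemma flipped_signs_values:
  assumes "\<And>k. k \<in> pm I \<Longrightarrow> \<eta> k = 1 \<or> \<eta> k = - 1" "k \<in> pm I"
  shows "flipped_signs e \<eta> k = 1 \<or> flipped_signs e \<eta> k = - 1"
  using assms(1)[of "sign_flip I e k"] assms(2) sign_flip_in_pm[where e=e and k=k, OF e]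
    pm_nonzero[of k] pm_nonzero[of "sign_flip I e k"]
  by (auto simp: flipped_signs_def sgn_if)

lemma prod_adjoints:
  fixes X :: "int \<Rightarrow> quat^'n^'n"
  assumes \<eta>: "\<And>k. k \<in> pm I \<Longrightarrow> \<eta> k = 1 \<or> \<eta> k = - 1"
  shows "(\<Prod>k\<in>I. qentry ((if e k = 1 then X k else qadjoint (X k)) $ i k $ i (- k)) (\<eta> k) (\<eta> (- k))) =
    of_int (\<Prod>k\<in>I. flipped_signs e \<eta> k * flipped_signs e \<eta> (sign_flip I e k)) *
    (\<Prod>k\<in>I. qentry (X k $ i (sign_flip I e k) $ i (sign_flip I e (- k)))
      (flipped_signs e \<eta> k) (flipped_signs e \<eta> (- k)))"
  unfolding of_int_prod prod.distrib[symmetric]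
proof (rule prod.cong)
  fix k assume k: "k \<in> I"
  then have pm: "k \<in> pm I" "- k \<in> pm I" and k0: "k > 0" using subset_pm positive by auto
  show "qentry ((if e k = 1 then X k else qadjoint (X k)) $ i k $ i (- k)) (\<eta> k) (\<eta> (- k)) =
    of_int (flipped_signs e \<eta> k * flipped_signs e \<eta> (sign_flip I e k)) *
    qentry (X k $ i (sign_flip I e k) $ i (sign_flip I e (- k)))
      (flipped_signs e \<eta> k) (flipped_signs e \<eta> (- k))"
  proof (cases "e k = 1")
    case True
    then have "sign_flip I e k = k" using sign_flip_eq[OF k] by simp
    then show ?thesis using True k0 \<eta>[OF pm(1)]
      by (auto simp: flipped_signs_def sign_flip_uminus)
  next
    case False
    then have "sign_flip I e k = - k" using sign_flip_eq[OF k] e[OF k] by auto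
    then have "sign_flip I e (- k) = k" "sign_flip I e k = - k" by (simp_all add: sign_flip_uminus)
    then show ?thesis using False k0 \<eta>[OF pm(1)] \<eta>[OF pm(2)]
      by (simp add: flipped_signs_def qentry_qadjoint)
  qed
qed simp

lemma flipped_index_constraint:
  "(\<forall>k\<in>pm I. i (sign_flip I e k) = i (sign_flip I e (- \<alpha> k))) \<longleftrightarrow>
    (\<forall>k\<in>pm I. i k = i (- (sign_flip I e \<circ> \<alpha> \<circ> sign_flip I e) k))"
  (is "?L \<longleftrightarrow> ?R")
proof
  assume ?L then show ?R
    using sign_flip_in_pm[where e=e, OF e] sign_flip_sign_flip[where e=e, OF e] by (metis comp_apply sign_flip_uminus)
next
  assume ?R then show ?L
    using sign_flip_in_pm[where e=e, OF e] sign_flip_sign_flip[where e=e, OF e] by (metis comp_apply sign_flip_uminus)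
qed

lemma flipped_sign_constraint:
  assumes \<alpha>: "\<alpha> \<in> PM I"
  shows "(\<forall>k\<in>pm I. sgn k * flipped_signs e \<eta> k = sgn (\<alpha> k) * flipped_signs e \<eta> (- \<alpha> k)) \<longleftrightarrow>
    (\<forall>k\<in>pm I. sgn k * \<eta> k = sgn ((sign_flip I e \<circ> \<alpha> \<circ> sign_flip I e) k) *
      \<eta> (- (sign_flip I e \<circ> \<alpha> \<circ> sign_flip I e) k))"
proof -
  have "(\<forall>k\<in>pm I. sgn k * flipped_signs e \<eta> k = sgn (\<alpha> k) * flipped_signs e \<eta> (- \<alpha> k)) \<longleftrightarrow>
    (\<forall>k\<in>pm I. sgn (sign_flip I e k) * \<eta> (sign_flip I e k) =
      sgn (sign_flip I e (\<alpha> k)) * \<eta> (- sign_flip I e (\<alpha> k)))"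
    using sgn_square_pm PM_in_pm[OF \<alpha>]
    by (intro ball_cong refl) (simp add: flipped_signs_def sign_flip_uminus flip: mult.assoc)
  also have "\<dots> \<longleftrightarrow> (\<forall>k\<in>pm I. sgn k * \<eta> k = sgn ((sign_flip I e \<circ> \<alpha> \<circ> sign_flip I e) k) *
      \<eta> (- (sign_flip I e \<circ> \<alpha> \<circ> sign_flip I e) k))" (is "?L \<longleftrightarrow> ?R")
  proof
    assume ?L then show ?R
      using sign_flip_in_pm[where e=e, OF e] sign_flip_sign_flip[where e=e, OF e] by (metis comp_apply)
  next
    assume ?R then show ?L
      using sign_flip_in_pm[where e=e, OF e] sign_flip_sign_flip[where e=e, OF e] by (metis comp_apply)
  qed
  finally show ?thesis .
qed

text \<open>The sign in the moment formula, taken over the negative elements of \<^const>\<open>FD\<close>, is the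
  quotient of the products of \<open>\<eta>\<close> over two halves: over \<^const>\<open>FD\<close> and over the positive
  elements. In this form the effect of the sign flip is visible.\<close>

lemma flipped_prod_signs:
  assumes \<alpha>: "\<alpha> \<in> PM I" and \<eta>: "\<And>k. k \<in> pm I \<Longrightarrow> \<eta> k = 1 \<or> \<eta> k = - 1"
  shows "(\<Prod>k\<in>I. flipped_signs e \<eta> k * flipped_signs e \<eta> (sign_flip I e k)) *
    (\<Prod>k\<in>{k \<in> I. - k \<in> FD I \<alpha>}. flipped_signs e \<eta> k * flipped_signs e \<eta> (- k)) =
    (\<Prod>k\<in>sign_flip I e ` FD I \<alpha>. \<eta> k) * (\<Prod>k\<in>I. \<eta> k)"
proof -
  define F where "F = FD I \<alpha>"
  define \<eta>' where "\<eta>' = flipped_signs e \<eta>"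
  note F = half_FD[OF \<alpha>, folded F_def]
  have \<eta>': "\<eta>' k * \<eta>' k = 1" if "k \<in> pm I" for k
    using flipped_signs_values[where \<eta>=\<eta> and k=k, OF \<eta> that] by (auto simp: \<eta>'_def)
  have "(\<Prod>k\<in>{k \<in> I. - k \<in> F}. \<eta>' k * \<eta>' (- k)) = (\<Prod>k\<in>I. if - k \<in> F then \<eta>' k * \<eta>' (- k) else 1)"
    using finite_I by (rule prod.inter_filter)
  also have "\<dots> = (\<Prod>k\<in>I. (if k \<in> F then \<eta>' k else \<eta>' (- k)) * \<eta>' k)"
    using half_uminus[OF F] subset_pm \<eta>' by (intro prod.cong) auto
  also have "\<dots> = (\<Prod>k\<in>I. if k \<in> F then \<eta>' k else \<eta>' (- k)) * (\<Prod>k\<in>I. \<eta>' k)"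
    by (rule prod.distrib)
  also have "(\<Prod>k\<in>I. if k \<in> F then \<eta>' k else \<eta>' (- k)) = (\<Prod>k\<in>F. if k \<in> F then \<eta>' k else \<eta>' (- k))"
    using half_uminus[OF F] by (intro prod_half[OF F, symmetric]) auto
  also have "\<dots> = (\<Prod>k\<in>F. \<eta>' k)" by (intro prod.cong) auto
  also have "\<dots> = (\<Prod>k\<in>F. e \<bar>k\<bar> * \<eta> (sign_flip I e k))"
  proof (rule prod.cong)
    fix k assume "k \<in> F"
    then have k: "k \<in> pm I" using half_subset[OF F] by auto
    then show "\<eta>' k = e \<bar>k\<bar> * \<eta> (sign_flip I e k)"
      using pm_nonzero[OF k] e[of "\<bar>k\<bar>"] abs_in_I_iff[of k]
      by (auto simp: \<eta>'_def flipped_signs_def sign_flip_def sgn_if)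
  qed simp
  also have "\<dots> = (\<Prod>k\<in>F. e \<bar>k\<bar>) * (\<Prod>k\<in>sign_flip I e ` F. \<eta> k)"
    by (simp add: prod.distrib prod.reindex permutes_inj_on[OF sign_flip_permutes[where e=e, OF e]])
  also have "(\<Prod>k\<in>F. e \<bar>k\<bar>) = (\<Prod>k\<in>I. e \<bar>k\<bar>)" by (rule prod_half[OF F]) simp
  also have "\<dots> = (\<Prod>k\<in>I. e k)" by (intro prod.cong) (auto dest: positive)
  finally have 1: "(\<Prod>k\<in>{k \<in> I. - k \<in> F}. \<eta>' k * \<eta>' (- k)) =
    (\<Prod>k\<in>I. e k) * (\<Prod>k\<in>sign_flip I e ` F. \<eta> k) * (\<Prod>k\<in>I. \<eta>' k)" .
  have 2: "\<eta>' (sign_flip I e k) = e k * \<eta> k" if "k \<in> I" for k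
    using positive[OF that] e[OF that] sign_flip_eq[OF that] sign_flip_sign_flip[where e=e and k=k, OF e]
    by (auto simp: \<eta>'_def flipped_signs_def)
  have "(\<Prod>k\<in>I. \<eta>' k * \<eta>' (sign_flip I e k)) = (\<Prod>k\<in>I. \<eta>' k) * ((\<Prod>k\<in>I. e k) * (\<Prod>k\<in>I. \<eta> k))"
    unfolding prod.distrib[symmetric] by (intro prod.cong refl) (simp add: 2)
  moreover have "(\<Prod>k\<in>I. \<eta>' k) * (\<Prod>k\<in>I. \<eta>' k) = 1"
    unfolding prod.distrib[symmetric] using \<eta>' subset_pm by (intro prod.neutral) blast
  moreover have "(\<Prod>k\<in>I. e k) * (\<Prod>k\<in>I. e k) = 1"
    unfolding prod.distrib[symmetric] using e by (intro prod.neutral) fastforce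
  ultimately have "(\<Prod>k\<in>I. \<eta>' k * \<eta>' (sign_flip I e k)) * (\<Prod>k\<in>{k \<in> I. - k \<in> F}. \<eta>' k * \<eta>' (- k)) =
    (\<Prod>k\<in>sign_flip I e ` F. \<eta> k) * (\<Prod>k\<in>I. \<eta> k)"
    unfolding 1 by (simp add: ac_simps)
  then show ?thesis by (simp only: \<eta>'_def F_def)
qed

end

end


section \<open>Permutations glued from disjoint pieces\<close>

lemma finite_PM:
  assumes "finite K"
  shows "finite (PM K)"
proof -
  have "finite (pm K)" using assms by (simp add: pm_def)
  then have "finite {\<pi>. \<pi> permutes pm K}" by (rule finite_permutations)
  then show ?thesis by (rule finite_subset[rotated]) (auto simp: PM_def)
qed

lemma foldr_comp_Cons: "foldr (\<circ>) (map \<alpha> (d # cs)) id k = \<alpha> d (foldr (\<circ>) (map \<alpha> cs) id k)"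
  by simp

lemma foldr_permutes_outside:
  assumes "\<And>c. c \<in> set cs \<Longrightarrow> \<alpha> c permutes S c" "\<And>c. c \<in> set cs \<Longrightarrow> k \<notin> S c"
  shows "foldr (\<circ>) (map \<alpha> cs) id k = k"
  using assms
proof (induction cs)
  case (Cons d cs)
  then have "\<alpha> d k = k" using permutes_not_in[of "\<alpha> d" "S d" k] by simp
  moreover have "foldr (\<circ>) (map \<alpha> cs) id k = k" using Cons.prems by (intro Cons.IH) auto
  ultimately show ?case unfolding foldr_comp_Cons by (simp only:)
qed simp

lemma foldr_permutes_inside:
  assumes "distinct cs" "\<And>c. c \<in> set cs \<Longrightarrow> \<alpha> c permutes S c"
    "\<And>c d. c \<in> set cs \<Longrightarrow> d \<in> set cs \<Longrightarrow> c \<noteq> d \<Longrightarrow> S c \<inter> S d = {}"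
    "c \<in> set cs" "k \<in> S c"
  shows "foldr (\<circ>) (map \<alpha> cs) id k = \<alpha> c k"
  using assms
proof (induction cs)
  case (Cons d cs)
  show ?case
  proof (cases "c = d")
    case True
    have "k \<notin> S c'" if "c' \<in> set cs" for c'
      using Cons.prems(1) Cons.prems(3)[of c c'] Cons.prems(4,5) True that by auto
    then have "foldr (\<circ>) (map \<alpha> cs) id k = k"
      using Cons.prems(2) by (intro foldr_permutes_outside[where S=S]) auto
    then show ?thesis unfolding foldr_comp_Cons using True by simp
  next
    case False
    then have c: "c \<in> set cs" using Cons.prems(4) by simp
    have "foldr (\<circ>) (map \<alpha> cs) id k = \<alpha> c k"
      using Cons.prems c by (intro Cons.IH) auto
    moreover have "\<alpha> c k \<in> S c"
      using Cons.prems(2)[of c] c Cons.prems(5) permutes_in_image[of "\<alpha> c" "S c" k] by simp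
    then have "\<alpha> d (\<alpha> c k) = \<alpha> c k"
      using Cons.prems(2)[of d] Cons.prems(3)[of c d] c False by (intro permutes_not_in) auto
    ultimately show ?thesis unfolding foldr_comp_Cons by simp
  qed
qed simp

context signed_index
begin

text \<open>From here on \<open>a\<close> is the permutation that acts as \<open>\<alpha> c\<close> on the piece of colour \<open>c\<close>, regardless of how
  it is composed. Its cycles are those of the \<open>\<alpha> c\<close>.\<close>

context
  fixes D :: "nat set" and w :: "int \<Rightarrow> nat" and \<alpha> :: "nat \<Rightarrow> int \<Rightarrow> int" and a :: "int \<Rightarrow> int"
    and J :: "nat \<Rightarrow> int set"
  defines "J \<equiv> \<lambda>c. {k \<in> I. w k = c}"
  assumes finite_D: "finite D" and w: "w \<in> I \<rightarrow> D"
    and \<alpha>: "\<And>c. c \<in> D \<Longrightarrow> \<alpha> c \<in> PM (J c)"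
    and a_inside: "\<And>c k. c \<in> D \<Longrightarrow> k \<in> pm (J c) \<Longrightarrow> a k = \<alpha> c k"
    and a_outside: "\<And>k. k \<notin> pm I \<Longrightarrow> a k = k"
begin

lemma signed_index_piece: "signed_index (J c)"
  using finite_I positive by unfold_locales (auto simp: J_def)

lemma in_pm_piece: "k \<in> pm (J c) \<longleftrightarrow> k \<in> pm I \<and> w \<bar>k\<bar> = c"
  using signed_index.abs_in_I_iff[OF signed_index_piece[of c], of k] abs_in_I_iff[of k]
  by (auto simp: J_def)

lemma color_in_D: "k \<in> pm I \<Longrightarrow> w \<bar>k\<bar> \<in> D"
  using w abs_in_I_iff by auto

lemma piece_of: "k \<in> pm I \<Longrightarrow> k \<in> pm (J (w \<bar>k\<bar>))"
  by (simp add: in_pm_piece)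

lemma a_eq: "k \<in> pm I \<Longrightarrow> a k = \<alpha> (w \<bar>k\<bar>) k"
  by (rule a_inside[OF color_in_D piece_of])

lemma piece_closed: "k \<in> pm I \<Longrightarrow> \<alpha> (w \<bar>k\<bar>) k \<in> pm (J (w \<bar>k\<bar>))"
  using signed_index.PM_in_pm[OF signed_index_piece \<alpha>[OF color_in_D]] piece_of by blast

lemma glued_PM: "a \<in> PM I"
proof (rule PM_I)
  have skew: "a (- a k) = - k" for k
  proof (cases "k \<in> pm I")
    case True
    let ?c = "w \<bar>k\<bar>"
    have "- a k \<in> pm (J ?c)"
      using piece_closed[OF True] a_eq[OF True] signed_index.uminus_in_pm[OF signed_index_piece] by simp
    then have "a (- a k) = \<alpha> ?c (- \<alpha> ?c k)"
      using a_inside[OF color_in_D[OF True]] a_eq[OF True] by simp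
    then show ?thesis
      using signed_index.PM_skew[OF signed_index_piece \<alpha>[OF color_in_D[OF True]]] by simp
  next
    case False
    then show ?thesis using a_outside[of k] a_outside[of "- k"] by simp
  qed
  have "bij a"
    by (rule o_bij[where g="\<lambda>k. - a (- k)"]) (simp_all add: fun_eq_iff skew)
  then show "a permutes pm I" by (rule bij_fixing_permutes[OF _ a_outside])
  show "a (- a k) = - k" for k by (rule skew)
  show "a k \<noteq> - k" if "k \<in> pm I" for k
    using signed_index.PM_no_flip[OF signed_index_piece \<alpha>[OF color_in_D[OF that]] piece_of[OF that]]
      a_eq[OF that] by simp
qed

lemma glued_orbit:
  assumes "c \<in> D" "k \<in> pm (J c)"
  shows "orbit a k = orbit (\<alpha> c) k"
  by (rule orbit_cong0[of k "pm (J c)"])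
     (use assms a_inside signed_index.PM_in_pm[OF signed_index_piece \<alpha>] in auto)

lemma glued_FD: "c \<in> D \<Longrightarrow> k \<in> pm (J c) \<Longrightarrow> k \<in> FD I a \<longleftrightarrow> k \<in> FD (J c) (\<alpha> c)"
  using in_pm_piece by (simp add: FD_def glued_orbit)

lemma glued_all:
  "(\<forall>k\<in>pm I. P k (a k)) \<longleftrightarrow> (\<forall>c\<in>D. \<forall>k\<in>pm (J c). P k (\<alpha> c k))"
proof
  assume L: "\<forall>k\<in>pm I. P k (a k)"
  show "\<forall>c\<in>D. \<forall>k\<in>pm (J c). P k (\<alpha> c k)"
  proof (intro ballI)
    fix c k assume "c \<in> D" "k \<in> pm (J c)"
    then show "P k (\<alpha> c k)" using L a_inside[of c k] in_pm_piece[of k c] by auto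
  qed
next
  assume R: "\<forall>c\<in>D. \<forall>k\<in>pm (J c). P k (\<alpha> c k)"
  show "\<forall>k\<in>pm I. P k (a k)"
    using R color_in_D piece_of a_eq by auto
qed

lemma prod_pieces: "(\<Prod>c\<in>D. \<Prod>k\<in>J c. g k) = (\<Prod>k\<in>I. g k)"
  unfolding J_def using w by (intro prod.group finite_I finite_D) auto

lemma glued_prod_FD:
  "(\<Prod>c\<in>D. \<Prod>k\<in>{k \<in> J c. - k \<in> FD (J c) (\<alpha> c)}. g k) = (\<Prod>k\<in>{k \<in> I. - k \<in> FD I a}. g k)"
proof -
  have "(\<Prod>c\<in>D. \<Prod>k\<in>{k \<in> J c. - k \<in> FD (J c) (\<alpha> c)}. g k) =
      (\<Prod>c\<in>D. \<Prod>k\<in>J c. if - k \<in> FD I a then g k else 1)"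
  proof (rule prod.cong)
    fix c assume c: "c \<in> D"
    have fin: "finite (J c)" using finite_I by (simp add: J_def)
    have "- k \<in> FD I a \<longleftrightarrow> - k \<in> FD (J c) (\<alpha> c)" if "k \<in> J c" for k
      using that by (intro glued_FD c) (simp add: pm_def)
    then show "(\<Prod>k\<in>{k \<in> J c. - k \<in> FD (J c) (\<alpha> c)}. g k) =
        (\<Prod>k\<in>J c. if - k \<in> FD I a then g k else 1)"
      unfolding prod.inter_filter[OF fin] by (intro prod.cong) auto
  qed simp
  also have "\<dots> = (\<Prod>k\<in>{k \<in> I. - k \<in> FD I a}. g k)"
    unfolding prod_pieces using finite_I by (rule prod.inter_filter[symmetric])
  finally show ?thesis .
qed

text \<open>The divisions by \<open>2\<close> can be carried out colour by colour because each number of cycles is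
  even.\<close>

lemma glued_num_cycles:
  "(\<Sum>c\<in>D. int (num_cycles (pm (J c)) (\<alpha> c)) div 2 - int (card (J c))) =
    int (num_cycles (pm I) a) div 2 - int (card I)"
proof -
  have perm: "k \<in> orbit a k" for k
    by (rule permutation_self_in_orbit[OF PM_permutation[OF glued_PM]])
  have sub: "orbit a k \<subseteq> pm (J (w \<bar>k\<bar>))" if "k \<in> pm I" for k
    using glued_orbit[OF color_in_D piece_of, OF that that]
      permutes_orbit_subset[OF signed_index.PM_permutes[OF signed_index_piece \<alpha>] piece_of,
        OF color_in_D, OF that that] by simp
  have "num_cycles (pm I) a = card (\<Union>c\<in>D. orbit a ` pm (J c))"
    unfolding num_cycles_def image_UN[symmetric]
    by (rule arg_cong[where f="\<lambda>S. card (orbit a ` S)"]) (use color_in_D in \<open>auto simp: in_pm_piece\<close>)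
  also have "\<dots> = (\<Sum>c\<in>D. card (orbit a ` pm (J c)))"
  proof (rule card_UN_disjoint[OF finite_D]; intro ballI impI)
    show "finite (orbit a ` pm (J c))" for c
      using signed_index.finite_pm[OF signed_index_piece] by simp
    fix c d :: nat assume cd: "c \<noteq> d"
    show "orbit a ` pm (J c) \<inter> orbit a ` pm (J d) = {}"
    proof (rule ccontr)
      assume "orbit a ` pm (J c) \<inter> orbit a ` pm (J d) \<noteq> {}"
      then obtain k l where k: "k \<in> pm (J c)" and l: "l \<in> pm (J d)" and "orbit a k = orbit a l"
        by auto
      then have "k \<in> pm (J (w \<bar>l\<bar>))" using perm[of k] sub[of l] in_pm_piece by auto
      then show False using k l cd in_pm_piece by auto
    qed
  qed
  also have "\<dots> = (\<Sum>c\<in>D. num_cycles (pm (J c)) (\<alpha> c))"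
    unfolding num_cycles_def using glued_orbit by (intro sum.cong refl arg_cong[where f=card] image_cong)
  finally have "int (num_cycles (pm I) a) = (\<Sum>c\<in>D. int (num_cycles (pm (J c)) (\<alpha> c)))" by simp
  also have "\<dots> = 2 * (\<Sum>c\<in>D. int (num_cycles (pm (J c)) (\<alpha> c)) div 2)"
    unfolding sum_distrib_left
    using signed_index.half_num_cycles[OF signed_index_piece \<alpha> signed_index.half_FD[OF signed_index_piece \<alpha>]]
    by (intro sum.cong) auto
  finally have "int (num_cycles (pm I) a) div 2 = (\<Sum>c\<in>D. int (num_cycles (pm (J c)) (\<alpha> c)) div 2)"
    by simp
  moreover have "(\<Sum>c\<in>D. \<Sum>k\<in>{k \<in> I. w k = c}. 1 :: nat) = (\<Sum>k\<in>I. 1)"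
    using w by (intro sum.group finite_I finite_D) auto
  then have "card I = (\<Sum>c\<in>D. card (J c))" unfolding J_def by (simp only: card_eq_sum)
  then have "int (card I) = (\<Sum>c\<in>D. int (card (J c)))" by simp
  ultimately show ?thesis by (simp add: sum_subtractf)
qed

end

text \<open>The colours contribute one factor each to the moment; expanding the product of the sums over
  the \<open>\<alpha>\<^sub>c\<close> gives the sum over the glued permutations.\<close>

lemma prod_moments:
  fixes w :: "int \<Rightarrow> nat" and f :: "nat \<Rightarrow> int set \<Rightarrow> (int \<Rightarrow> int) \<Rightarrow> complex" and x :: complex
    and i :: "int \<Rightarrow> 'b" and a :: "(nat \<Rightarrow> int \<Rightarrow> int) \<Rightarrow> int \<Rightarrow> int"
  defines "J \<equiv> \<lambda>c. {k \<in> I. w k = c}"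
  assumes D: "finite D" and w: "w \<in> I \<rightarrow> D" and x: "x \<noteq> 0"
    and inside: "\<And>\<alpha> c k. \<alpha> \<in> PiE D (\<lambda>c. PM (J c)) \<Longrightarrow> c \<in> D \<Longrightarrow> k \<in> pm (J c) \<Longrightarrow> a \<alpha> k = \<alpha> c k"
    and outside: "\<And>\<alpha> k. \<alpha> \<in> PiE D (\<lambda>c. PM (J c)) \<Longrightarrow> k \<notin> pm I \<Longrightarrow> a \<alpha> k = k"
  shows "(\<Prod>c\<in>D. \<Sum>\<alpha>\<in>{\<alpha> \<in> PM (J c). (\<forall>k\<in>pm (J c). i k = i (- \<alpha> k)) \<and>
              (\<forall>k\<in>pm (J c). sgn k * \<eta> k = sgn (\<alpha> k) * \<eta> (- \<alpha> k))}.
        of_int (\<Prod>k\<in>{k \<in> J c. - k \<in> FD (J c) \<alpha>}. \<eta> k * \<eta> (- k)) *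
        x powi (int (num_cycles (pm (J c)) \<alpha>) div 2 - int (card (J c))) * f c (J c) \<alpha>) =
    (\<Sum>\<alpha>\<in>PiE D (\<lambda>c. PM (J c)).
      if (\<forall>k\<in>pm I. i k = i (- a \<alpha> k)) \<and> (\<forall>k\<in>pm I. sgn k * \<eta> k = sgn (a \<alpha> k) * \<eta> (- a \<alpha> k))
      then of_int (\<Prod>k\<in>{k \<in> I. - k \<in> FD I (a \<alpha>)}. \<eta> k * \<eta> (- k)) *
        (x powi (int (num_cycles (pm I) (a \<alpha>)) div 2 - int (card I)) * (\<Prod>c\<in>D. f c (J c) (\<alpha> c)))
      else 0)"
proof -
  have finite_PM: "finite (PM (J c))" for c
    using finite_I by (intro finite_PM) (simp add: J_def)
  have powi_sum: "(\<Prod>c\<in>E. x powi g c) = x powi (\<Sum>c\<in>E. g c)" for E :: "nat set" and g :: "nat \<Rightarrow> int"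
    using x by (induction E rule: infinite_finite_induct) (auto simp: power_int_add)
  let ?ok = "\<lambda>K \<pi>. (\<forall>k\<in>pm K. i k = i (- \<pi> k)) \<and> (\<forall>k\<in>pm K. sgn k * \<eta> k = sgn (\<pi> k) * \<eta> (- \<pi> k))"
  let ?t = "\<lambda>c \<pi>. of_int (\<Prod>k\<in>{k \<in> J c. - k \<in> FD (J c) \<pi>}. \<eta> k * \<eta> (- k)) *
      x powi (int (num_cycles (pm (J c)) \<pi>) div 2 - int (card (J c))) * f c (J c) \<pi>"
  have "(\<Prod>c\<in>D. \<Sum>\<alpha>\<in>{\<alpha> \<in> PM (J c). ?ok (J c) \<alpha>}. ?t c \<alpha>) =
      (\<Prod>c\<in>D. \<Sum>\<alpha>\<in>PM (J c). if ?ok (J c) \<alpha> then ?t c \<alpha> else 0)"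
    by (intro prod.cong refl sum.inter_filter finite_PM)
  also have "\<dots> = (\<Sum>\<alpha>\<in>PiE D (\<lambda>c. PM (J c)). \<Prod>c\<in>D. if ?ok (J c) (\<alpha> c) then ?t c (\<alpha> c) else 0)"
    by (rule prod_sum_PiE[OF D finite_PM])
  also have "\<dots> = (\<Sum>\<alpha>\<in>PiE D (\<lambda>c. PM (J c)). if ?ok I (a \<alpha>)
      then of_int (\<Prod>k\<in>{k \<in> I. - k \<in> FD I (a \<alpha>)}. \<eta> k * \<eta> (- k)) *
        (x powi (int (num_cycles (pm I) (a \<alpha>)) div 2 - int (card I)) * (\<Prod>c\<in>D. f c (J c) (\<alpha> c)))
      else 0)"
  proof (rule sum.cong)
    fix \<alpha> assume \<alpha>: "\<alpha> \<in> PiE D (\<lambda>c. PM (J c))"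
    note glued = D w PiE_mem[OF \<alpha>, unfolded J_def] inside[OF \<alpha>, unfolded J_def] outside[OF \<alpha>]
    have ok: "?ok I (a \<alpha>) \<longleftrightarrow> (\<forall>c\<in>D. ?ok (J c) (\<alpha> c))"
      using glued_all[OF glued, where P="\<lambda>k l. i k = i (- l)"]
        glued_all[OF glued, where P="\<lambda>k l. sgn k * \<eta> k = sgn l * \<eta> (- l)"]
      unfolding J_def by blast
    show "(\<Prod>c\<in>D. if ?ok (J c) (\<alpha> c) then ?t c (\<alpha> c) else 0) = (if ?ok I (a \<alpha>)
      then of_int (\<Prod>k\<in>{k \<in> I. - k \<in> FD I (a \<alpha>)}. \<eta> k * \<eta> (- k)) *
        (x powi (int (num_cycles (pm I) (a \<alpha>)) div 2 - int (card I)) * (\<Prod>c\<in>D. f c (J c) (\<alpha> c)))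
      else 0)"
    proof (cases "?ok I (a \<alpha>)")
      case True
      then have "(\<Prod>c\<in>D. if ?ok (J c) (\<alpha> c) then ?t c (\<alpha> c) else 0) = (\<Prod>c\<in>D. ?t c (\<alpha> c))"
        using ok by (intro prod.cong) auto
      also have "\<dots> = of_int (\<Prod>c\<in>D. \<Prod>k\<in>{k \<in> J c. - k \<in> FD (J c) (\<alpha> c)}. \<eta> k * \<eta> (- k)) *
          (x powi (\<Sum>c\<in>D. int (num_cycles (pm (J c)) (\<alpha> c)) div 2 - int (card (J c))) *
          (\<Prod>c\<in>D. f c (J c) (\<alpha> c)))"
        unfolding powi_sum[symmetric] by (simp add: prod.distrib ac_simps)
      also have "(\<Prod>c\<in>D. \<Prod>k\<in>{k \<in> J c. - k \<in> FD (J c) (\<alpha> c)}. \<eta> k * \<eta> (- k)) =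
          (\<Prod>k\<in>{k \<in> I. - k \<in> FD I (a \<alpha>)}. \<eta> k * \<eta> (- k))"
        unfolding J_def by (rule glued_prod_FD[OF glued])
      also have "(\<Sum>c\<in>D. int (num_cycles (pm (J c)) (\<alpha> c)) div 2 - int (card (J c))) =
          int (num_cycles (pm I) (a \<alpha>)) div 2 - int (card I)"
        unfolding J_def by (rule glued_num_cycles[OF glued])
      finally show ?thesis using True by simp
    next
      case False
      then obtain c where "c \<in> D" "\<not> ?ok (J c) (\<alpha> c)" using ok by blast
      then have "(\<Prod>c\<in>D. if ?ok (J c) (\<alpha> c) then ?t c (\<alpha> c) else 0) = 0"
        using D by (intro prod_zero) auto
      then show ?thesis by (simp only: if_not_P[OF False])
    qed
  qed simp
  finally show ?thesis .
qed

subsection \<open>Averaging with prescribed moments\<close>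

text \<open>The deterministic core of the theorem: the moments of the \<open>X\<^sub>k\<close> enter only through
  the function \<open>m\<close>, and the \<open>Y\<^sub>k\<close> are fixed.\<close>

lemma averaged_trace_sum:
  fixes Y :: "int \<Rightarrow> quat^'n^'n" and p :: "'s \<Rightarrow> int \<Rightarrow> int" and \<kappa> :: "'s \<Rightarrow> complex"
  assumes \<phi>: "\<phi> permutes I" and \<psi>: "\<psi> permutes I" and e: "\<And>k. k \<in> I \<Longrightarrow> e k = 1 \<or> e k = - 1"
    and A: "finite A" and p: "\<And>s. s \<in> A \<Longrightarrow> p s \<in> PM I"
    and m: "\<And>i \<eta>. \<eta> \<in> pm I \<rightarrow>\<^sub>E {1, - 1} \<Longrightarrow>
      m i \<eta> = of_int (\<Prod>k\<in>I. flipped_signs e \<eta> k * flipped_signs e \<eta> (sign_flip I e k)) *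
        (\<Sum>s\<in>A. if (\<forall>k\<in>pm I. i (sign_flip I e k) = i (sign_flip I e (- p s k))) \<and>
            (\<forall>k\<in>pm I. sgn k * flipped_signs e \<eta> k = sgn (p s k) * flipped_signs e \<eta> (- p s k))
          then of_int (\<Prod>k\<in>{k \<in> I. - k \<in> FD I (p s)}. flipped_signs e \<eta> k * flipped_signs e \<eta> (- k)) *
            \<kappa> s
          else 0)"
  defines "\<beta> \<equiv> \<lambda>s. sign_flip I e \<circ> p s \<circ> sign_flip I e"
  defines "R \<equiv> \<lambda>s. FD I (inv (Kreweras \<phi> (\<beta> s)))"
  shows "(\<Sum>i\<in>pm I \<rightarrow>\<^sub>E UNIV. \<Sum>\<eta>\<in>pm I \<rightarrow>\<^sub>E {1, - 1}. m i \<eta> *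
      (\<Prod>k\<in>I. qentry (Y k $ i (- k) $ i (\<psi> k)) (\<eta> (- k)) (\<eta> (\<phi> k)))) =
    (\<Sum>s\<in>A. \<kappa> s * ((- 1) ^ (num_cycles I \<phi> + num_cycles (sign_flip I e ` FD I (p s)) (\<beta> s) +
        num_cycles (R s) (Kreweras \<phi> (\<beta> s)) + card I) *
      trace_sum (R s) (inv (Kreweras \<phi> (\<beta> s))) (inv (Kreweras \<psi> (\<beta> s))) Y))"
proof -
  have fin: "finite (pm I \<rightarrow>\<^sub>E (UNIV :: 'n set))" "finite (pm I \<rightarrow>\<^sub>E {1, - 1 :: int})"
    by (auto intro!: finite_PiE finite_pm)
  let ?y = "\<lambda>i \<eta>. \<Prod>k\<in>I. qentry (Y k $ i (- k) $ i (\<psi> k)) (\<eta> (- k)) (\<eta> (\<phi> k))"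
  let ?R = "\<lambda>s. sign_flip I e ` FD I (p s)"
  let ?P = "\<lambda>s i. \<forall>k\<in>pm I. i k = i (- \<beta> s k)"
  let ?Q = "\<lambda>s \<eta>. \<forall>k\<in>pm I. sgn k * \<eta> k = sgn (\<beta> s k) * \<eta> (- \<beta> s k)"
  have gen: "u * (if b \<and> b' then v * x else 0) * y = (if b then if b' then x * (u * v * y) else 0 else 0)"
    for b b' and u v x y :: complex by simp
  let ?c = "\<lambda>s \<eta>. of_int ((\<Prod>k\<in>?R s. \<eta> k) * (\<Prod>k\<in>I. \<eta> k))"
  have "(\<Sum>i\<in>pm I \<rightarrow>\<^sub>E UNIV. \<Sum>\<eta>\<in>pm I \<rightarrow>\<^sub>E {1, - 1}. m i \<eta> * ?y i \<eta>) =
    (\<Sum>i\<in>pm I \<rightarrow>\<^sub>E UNIV. \<Sum>\<eta>\<in>pm I \<rightarrow>\<^sub>E {1, - 1}. \<Sum>s\<in>A.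
      if ?P s i then if ?Q s \<eta> then \<kappa> s * (?c s \<eta> * ?y i \<eta>) else 0 else 0)"
  proof (intro sum.cong refl)
    fix i :: "int \<Rightarrow> 'n" and \<eta> :: "int \<Rightarrow> int" assume \<eta>_in: "\<eta> \<in> pm I \<rightarrow>\<^sub>E {1, - 1}"
    then have \<eta>: "\<eta> k = 1 \<or> \<eta> k = - 1" if "k \<in> pm I" for k using that by auto
    show "m i \<eta> * ?y i \<eta> =
        (\<Sum>s\<in>A. if ?P s i then if ?Q s \<eta> then \<kappa> s * (?c s \<eta> * ?y i \<eta>) else 0 else 0)"
      unfolding m[OF \<eta>_in] sum_distrib_left sum_distrib_right
    proof (rule sum.cong)
      fix s assume s: "s \<in> A"
      have P: "(\<forall>k\<in>pm I. i (sign_flip I e k) = i (sign_flip I e (- p s k))) \<longleftrightarrow> ?P s i"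
        unfolding \<beta>_def by (rule flipped_index_constraint[OF e])
      have Q: "(\<forall>k\<in>pm I. sgn k * flipped_signs e \<eta> k = sgn (p s k) * flipped_signs e \<eta> (- p s k)) \<longleftrightarrow>
          ?Q s \<eta>"
        unfolding \<beta>_def by (rule flipped_sign_constraint[OF e p[OF s]])
      have signs: "(\<Prod>k\<in>I. flipped_signs e \<eta> k * flipped_signs e \<eta> (sign_flip I e k)) *
          (\<Prod>k\<in>{k \<in> I. - k \<in> FD I (p s)}. flipped_signs e \<eta> k * flipped_signs e \<eta> (- k)) =
          (\<Prod>k\<in>?R s. \<eta> k) * (\<Prod>k\<in>I. \<eta> k)"
        by (rule flipped_prod_signs[OF e p[OF s] \<eta>])
      show "of_int (\<Prod>k\<in>I. flipped_signs e \<eta> k * flipped_signs e \<eta> (sign_flip I e k)) *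
        (if (\<forall>k\<in>pm I. i (sign_flip I e k) = i (sign_flip I e (- p s k))) \<and>
            (\<forall>k\<in>pm I. sgn k * flipped_signs e \<eta> k = sgn (p s k) * flipped_signs e \<eta> (- p s k))
          then of_int (\<Prod>k\<in>{k \<in> I. - k \<in> FD I (p s)}. flipped_signs e \<eta> k * flipped_signs e \<eta> (- k)) *
            \<kappa> s
          else 0) * ?y i \<eta> =
        (if ?P s i then if ?Q s \<eta> then \<kappa> s * (?c s \<eta> * ?y i \<eta>) else 0 else 0)"
        unfolding P Q signs[symmetric] of_int_mult
        by (rule gen)
    qed simp
  qed
  also have "\<dots> = (\<Sum>s\<in>A. \<Sum>i\<in>pm I \<rightarrow>\<^sub>E UNIV. \<Sum>\<eta>\<in>pm I \<rightarrow>\<^sub>E {1, - 1}.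
      if ?P s i then if ?Q s \<eta> then \<kappa> s * (?c s \<eta> * ?y i \<eta>) else 0 else 0)"
    by (subst sum.swap[of _ A]) (intro sum.cong refl sum.swap)
  also have "\<dots> = (\<Sum>s\<in>A. \<kappa> s * (\<Sum>i\<in>{i \<in> pm I \<rightarrow>\<^sub>E UNIV. ?P s i}.
      \<Sum>\<eta>\<in>{\<eta> \<in> pm I \<rightarrow>\<^sub>E {1, - 1}. ?Q s \<eta>}. ?c s \<eta> * ?y i \<eta>))"
    by (intro sum.cong refl sum_nested_filter fin)
  also have "\<dots> = (\<Sum>s\<in>A. \<kappa> s * ((- 1) ^ (num_cycles I \<phi> + num_cycles (?R s) (\<beta> s) +
        num_cycles (R s) (Kreweras \<phi> (\<beta> s)) + card I) *
      trace_sum (R s) (inv (Kreweras \<phi> (\<beta> s))) (inv (Kreweras \<psi> (\<beta> s))) Y))"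
  proof (intro sum.cong refl arg_cong2[where f="(*)"])
    fix s assume s: "s \<in> A"
    have \<beta>: "\<beta> s \<in> PM I" "half (\<beta> s) (?R s)"
      using sign_flip_conj_PM[where e=e, OF e p[OF s]] half_sign_flip_conj[where e=e, OF e p[OF s]]
      by (simp_all add: \<beta>_def)
    note K = Kreweras_PM[OF \<phi> \<beta>(1)]
    have "half (Kreweras \<phi> (\<beta> s)) (R s)" unfolding R_def FD_inv[OF K] by (rule half_FD[OF K])
    then show "(\<Sum>i\<in>{i \<in> pm I \<rightarrow>\<^sub>E UNIV. ?P s i}.
        \<Sum>\<eta>\<in>{\<eta> \<in> pm I \<rightarrow>\<^sub>E {1, - 1}. ?Q s \<eta>}. ?c s \<eta> * ?y i \<eta>) =
      (- 1) ^ (num_cycles I \<phi> + num_cycles (?R s) (\<beta> s) +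
        num_cycles (R s) (Kreweras \<phi> (\<beta> s)) + card I) *
      trace_sum (R s) (inv (Kreweras \<phi> (\<beta> s))) (inv (Kreweras \<psi> (\<beta> s))) Y"
      by (rule trace_sum_Kreweras[OF \<phi> \<psi> \<beta>])
  qed
  finally show ?thesis .
qed

end


section \<open>Measurability, independence and expectations\<close>

lemma continuous_on_quat_components:
  "continuous_on UNIV qre" "continuous_on UNIV qi" "continuous_on UNIV qj" "continuous_on UNIV qk"
proof -
  have "open (qre -` B)" "open (qi -` B)" "open (qj -` B)" "open (qk -` B)" if "open B" for B
  proof -
    have "(\<lambda>(a, b, c, d). Quat a b c d) -` qre -` B = B \<times> UNIV \<times> UNIV \<times> UNIV"
      "(\<lambda>(a, b, c, d). Quat a b c d) -` qi -` B = UNIV \<times> B \<times> UNIV \<times> UNIV"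
      "(\<lambda>(a, b, c, d). Quat a b c d) -` qj -` B = UNIV \<times> UNIV \<times> B \<times> UNIV"
      "(\<lambda>(a, b, c, d). Quat a b c d) -` qk -` B = UNIV \<times> UNIV \<times> UNIV \<times> B"
      by auto
    then show "open (qre -` B)" "open (qi -` B)" "open (qj -` B)" "open (qk -` B)"
      unfolding open_quat_def using that by (simp_all add: open_Times)
  qed
  then show "continuous_on UNIV qre" "continuous_on UNIV qi" "continuous_on UNIV qj" "continuous_on UNIV qk"
    by (simp_all add: continuous_on_open_vimage)
qed

lemma borel_measurable_quat_components:
  "qre \<in> borel_measurable borel" "qi \<in> borel_measurable borel"
  "qj \<in> borel_measurable borel" "qk \<in> borel_measurable borel"
  using continuous_on_quat_components by (auto intro: borel_measurable_continuous_onI)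

lemma measurable_entry: "(\<lambda>A :: quat^'n^'m. A $ a $ b) \<in> borel_measurable borel"
  by (intro borel_measurable_continuous_onI continuous_intros)

lemma borel_measurable_Complex:
  assumes "f \<in> borel_measurable M" "g \<in> borel_measurable M"
  shows "(\<lambda>x. Complex (f x) (g x)) \<in> borel_measurable M"
  unfolding Complex_eq using assms by measurable

lemma borel_measurable_qentry:
  assumes "q \<in> borel_measurable M"
  shows "(\<lambda>x. qentry (q x) r s) \<in> borel_measurable M"
    and "(\<lambda>x. qentry (qcnj (q x)) r s) \<in> borel_measurable M"
proof -
  note components = borel_measurable_quat_components[THEN measurable_compose[OF assms]]
  show "(\<lambda>x. qentry (q x) r s) \<in> borel_measurable M"
    unfolding qentry_def
    by (cases "r = 1"; cases "s = 1")
       (auto intro!: borel_measurable_Complex borel_measurable_uminus components)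
  show "(\<lambda>x. qentry (qcnj (q x)) r s) \<in> borel_measurable M"
    unfolding qentry_def qcnj_def
    by (cases "r = 1"; cases "s = 1")
       (auto intro!: borel_measurable_Complex borel_measurable_uminus components)
qed

lemma borel_measurable_signed_entry:
  fixes x :: "'a \<Rightarrow> quat^'n^'n"
  assumes "x \<in> borel_measurable M"
  shows "(\<lambda>\<omega>. qentry (x \<omega> $ a $ b) r s) \<in> borel_measurable M"
    and "(\<lambda>\<omega>. qentry (qadjoint (x \<omega>) $ a $ b) r s) \<in> borel_measurable M"
  using borel_measurable_qentry[OF measurable_compose[OF assms measurable_entry]]
  by (simp_all add: qadjoint_def)

text \<open>The factors of different colours are independent, which yields both the product formula and the
  integrability of a monomial of mixed colours.\<close>

lemma (in prob_space) joint_moment: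
  fixes X :: "nat \<Rightarrow> int \<Rightarrow> 'a \<Rightarrow> quat^'n^'n"
  assumes fin: "finite I" "finite D" and w: "w \<in> I \<rightarrow> D"
    and indep: "indep_vars (\<lambda>c. PiM I (\<lambda>k. borel)) (\<lambda>c \<omega>. \<lambda>k\<in>I. X c k \<omega>) D"
    and int: "\<And>c. c \<in> D \<Longrightarrow> integrable M
      (\<lambda>\<omega>. \<Prod>k\<in>{k \<in> I. w k = c}. qentry (X c k \<omega> $ i k $ j k) (r k) (s k))"
  shows "integrable M (\<lambda>\<omega>. \<Prod>k\<in>I. qentry (X (w k) k \<omega> $ i k $ j k) (r k) (s k))"
    and "(\<integral>\<omega>. (\<Prod>k\<in>I. qentry (X (w k) k \<omega> $ i k $ j k) (r k) (s k)) \<partial>M) =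
      (\<Prod>c\<in>D. \<integral>\<omega>. (\<Prod>k\<in>{k \<in> I. w k = c}. qentry (X c k \<omega> $ i k $ j k) (r k) (s k)) \<partial>M)"
proof -
  define Z where "Z = (\<lambda>c \<omega>. \<Prod>k\<in>{k \<in> I. w k = c}. qentry (X c k \<omega> $ i k $ j k) (r k) (s k))"
  have "indep_vars (\<lambda>_. borel) (\<lambda>c \<omega>. (\<lambda>v. \<Prod>k\<in>{k \<in> I. w k = c}. qentry (v k $ i k $ j k) (r k) (s k))
      (\<lambda>k\<in>I. X c k \<omega>)) D"
  proof (rule indep_vars_compose2[OF indep])
    fix c assume "c \<in> D"
    show "(\<lambda>v. \<Prod>k\<in>{k \<in> I. w k = c}. qentry (v k $ i k $ j k) (r k) (s k))
        \<in> borel_measurable (PiM I (\<lambda>k. borel))"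
      by (intro borel_measurable_prod borel_measurable_signed_entry(1) measurable_component_singleton) auto
  qed
  also have "(\<lambda>c \<omega>. (\<lambda>v. \<Prod>k\<in>{k \<in> I. w k = c}. qentry (v k $ i k $ j k) (r k) (s k))
      (\<lambda>k\<in>I. X c k \<omega>)) = Z"
    by (auto simp: Z_def fun_eq_iff intro!: prod.cong)
  finally have Z: "indep_vars (\<lambda>_. borel) Z D" .
  have Z_prod: "(\<lambda>\<omega>. \<Prod>c\<in>D. Z c \<omega>) = (\<lambda>\<omega>. \<Prod>k\<in>I. qentry (X (w k) k \<omega> $ i k $ j k) (r k) (s k))"
  proof
    fix \<omega>
    have "(\<Prod>c\<in>D. Z c \<omega>) =
        (\<Prod>c\<in>D. \<Prod>k\<in>{k \<in> I. w k = c}. qentry (X (w k) k \<omega> $ i k $ j k) (r k) (s k))"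
      by (auto simp: Z_def intro!: prod.cong)
    also have "\<dots> = (\<Prod>k\<in>I. qentry (X (w k) k \<omega> $ i k $ j k) (r k) (s k))"
      using w by (intro prod.group fin) auto
    finally show "(\<Prod>c\<in>D. Z c \<omega>) = (\<Prod>k\<in>I. qentry (X (w k) k \<omega> $ i k $ j k) (r k) (s k))" .
  qed
  have Z_int: "integrable M (Z c)" if "c \<in> D" for c using int[OF that] by (simp add: Z_def)
  show "integrable M (\<lambda>\<omega>. \<Prod>k\<in>I. qentry (X (w k) k \<omega> $ i k $ j k) (r k) (s k))"
    using indep_vars_integrable[OF fin(2) Z Z_int] unfolding Z_prod .
  show "(\<integral>\<omega>. (\<Prod>k\<in>I. qentry (X (w k) k \<omega> $ i k $ j k) (r k) (s k)) \<partial>M) =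
      (\<Prod>c\<in>D. \<integral>\<omega>. (\<Prod>k\<in>{k \<in> I. w k = c}. qentry (X c k \<omega> $ i k $ j k) (r k) (s k)) \<partial>M)"
    using indep_vars_lebesgue_integral[OF fin(2) Z Z_int] unfolding Z_prod unfolding Z_def .
qed

text \<open>Fubini's theorem, applied to the joint distribution of two independent variables. Integrating out
  \<open>U\<close> first keeps together the monomials in \<open>V\<close> of which \<open>F\<close> is made up: what is integrated over the
  distribution of \<open>V\<close> is the function \<open>G\<close> as a whole.\<close>

lemma (in prob_space) integral_indep_var:
  fixes F :: "'b \<Rightarrow> 'b \<Rightarrow> 'd :: {banach, second_countable_topology}"
  assumes indep: "indep_var S U T V"
    and F: "case_prod F \<in> borel_measurable (S \<Otimes>\<^sub>M T)"
    and int: "integrable M (\<lambda>\<omega>. F (U \<omega>) (V \<omega>))"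
    and G: "\<And>y. y \<in> space T \<Longrightarrow> (\<integral>\<omega>. F (U \<omega>) y \<partial>M) = G y" "G \<in> borel_measurable T"
  shows "(\<integral>\<omega>. F (U \<omega>) (V \<omega>) \<partial>M) = (\<integral>\<omega>. G (V \<omega>) \<partial>M)"
proof -
  have rv: "random_variable S U" "random_variable T V"
    and distr: "distr M S U \<Otimes>\<^sub>M distr M T V = distr M (S \<Otimes>\<^sub>M T) (\<lambda>\<omega>. (U \<omega>, V \<omega>))"
    using indep by (simp_all add: indep_var_distribution_eq)
  interpret U: prob_space "distr M S U" by (rule prob_space_distr[OF rv(1)])
  interpret V: prob_space "distr M T V" by (rule prob_space_distr[OF rv(2)])
  interpret UV: pair_prob_space "distr M S U" "distr M T V" ..
  have pair: "(\<lambda>\<omega>. (U \<omega>, V \<omega>)) \<in> M \<rightarrow>\<^sub>M S \<Otimes>\<^sub>M T" using rv by measurable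
  have int': "integrable (distr M S U \<Otimes>\<^sub>M distr M T V) (case_prod F)"
    unfolding distr using int by (simp add: integrable_distr_eq[OF pair F])
  have "(\<integral>\<omega>. F (U \<omega>) (V \<omega>) \<partial>M) = (\<integral>z. case_prod F z \<partial>(distr M S U \<Otimes>\<^sub>M distr M T V))"
    unfolding distr by (simp add: integral_distr[OF pair F])
  also have "\<dots> = (\<integral>y. (\<integral>x. F x y \<partial>distr M S U) \<partial>distr M T V)"
    by (rule UV.integral_snd[OF int', symmetric])
  also have "\<dots> = (\<integral>y. G y \<partial>distr M T V)"
  proof (rule Bochner_Integration.integral_cong[OF refl])
    fix y assume "y \<in> space (distr M T V)"
    then have y: "y \<in> space T" by simp
    have "(\<lambda>x. F x y) \<in> borel_measurable S"
      using measurable_compose[OF measurable_Pair2'[OF y] F] by simp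
    then show "(\<integral>x. F x y \<partial>distr M S U) = G y"
      using G(1)[OF y] by (simp add: integral_distr[OF rv(1)])
  qed
  also have "\<dots> = (\<integral>\<omega>. G (V \<omega>) \<partial>M)" by (rule integral_distr[OF rv(2) G(2)])
  finally show ?thesis .
qed

lemma Re_tr_cong:
  assumes "\<And>k. k \<in> {1..int n} \<Longrightarrow> A k = B k"
  shows "Re_tr n \<pi> \<rho> A = Re_tr n \<pi> \<rho> B"
proof -
  have "signed_mat A k = signed_mat B k" if "k \<in> FD {1..int n} \<pi>" for k
    using that assms by (auto simp: signed_mat_def FD_def pm_def)
  then show ?thesis by (simp add: Re_tr_def Let_def cong: prod.cong)
qed

lemma borel_measurable_Re_tr:
  fixes Y :: "int \<Rightarrow> 'a \<Rightarrow> quat^'n^'n"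
  assumes "\<And>k. k \<in> {1..int n} \<Longrightarrow> Y k \<in> borel_measurable M"
  shows "(\<lambda>\<omega>. Re_tr n \<pi> \<rho> (\<lambda>k. Y k \<omega>)) \<in> borel_measurable M"
  unfolding Re_tr_def Let_def
proof (intro borel_measurable_times borel_measurable_const borel_measurable_sum borel_measurable_prod)
  fix i :: "int \<Rightarrow> 'n" and h k assume "k \<in> FD {1..int n} \<pi>"
  then have "(k > 0 \<and> k \<in> {1..int n}) \<or> (\<not> k > 0 \<and> - k \<in> {1..int n})"
    by (auto simp: FD_def pm_def)
  then show "(\<lambda>\<omega>. qentry (signed_mat (\<lambda>k. Y k \<omega>) k $ i k $ i (- k)) (h k) (h (\<pi> k)))
      \<in> borel_measurable M"
    using borel_measurable_signed_entry[OF assms] by (auto simp: signed_mat_def)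
qed

text \<open>The powers of \<open>2\<close> and \<open>N\<close> on the left come from the normalization of the trace of the products, from
  the moment formula and, with \<open>-1\<close>, from the total sign; on the right the normalization of the trace of
  the \<open>Y\<^sub>k\<close> is split off. The exponent of \<open>-2\<close> has the same parity as that of \<open>-1\<close>.\<close>

lemma coefficient_identity:
  fixes x y T :: complex
  assumes "x \<noteq> 0"
  shows "2 powi (- int p) * x powi (- int q) *
      ((2 * x) powi (int b - int m) * y * ((- 1) ^ (p + b + r + m) * T)) =
    (- 2) powi (int p + int b + int r - int m - 2 * int p) *
      x powi (int q + int b + int r' - int m - 2 * int q) * y *
      (2 powi (- int r) * x powi (- int r') * T)"
proof -
  have "(- 1 :: complex) ^ (p + b + r + m) =
      (- 1) powi ((int p + int b + int r - int m - 2 * int p) + 2 * (int p + int m))"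
    by (simp flip: power_int_of_nat) (simp add: algebra_simps)
  also have "\<dots> = (- 1) powi (int p + int b + int r - int m - 2 * int p)"
    by (subst power_int_add) (simp_all add: power_int_mult)
  finally have sgn: "(- 1 :: complex) ^ (p + b + r + m) =
      (- 1) powi (int p + int b + int r - int m - 2 * int p)" .
  have "(- 2 :: complex) = (- 1) * 2" by simp
  then have two: "(- 2 :: complex) powi z = (- 1) powi z * 2 powi z" for z
    by (metis power_int_mult_distrib)
  have e2: "(2 :: complex) powi (int p + int b + int r - int m - 2 * int p) * 2 powi (- int r) =
      2 powi (- int p) * 2 powi (int b - int m)"
    by (subst (1 2) power_int_add[symmetric]) (simp_all add: algebra_simps)
  have ex: "x powi (int q + int b + int r' - int m - 2 * int q) * x powi (- int r') =
      x powi (- int q) * x powi (int b - int m)"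
    using assms by (subst (1 2) power_int_add[symmetric]) (simp_all add: algebra_simps)
  show ?thesis
    unfolding sgn two power_int_mult_distrib
    using e2 ex by algebra
qed


section \<open>The expectation of traces of products\<close>

theorem proposition3p1:
  fixes M :: "'a measure" and n C :: nat
    and X :: "nat \<Rightarrow> int \<Rightarrow> 'a \<Rightarrow> quat^'N^'N"
    and Y :: "int \<Rightarrow> 'a \<Rightarrow> quat^'N^'N"
    and f :: "nat \<Rightarrow> int set \<Rightarrow> (int \<Rightarrow> int) \<Rightarrow> complex"
    and \<phi>Re \<phi>tr :: "int \<Rightarrow> int" and w :: "int \<Rightarrow> nat" and \<epsilon> :: "int \<Rightarrow> int"
  defines "XX \<equiv> \<lambda>k. X (w k) k"
  defines "XY \<equiv> \<lambda>\<omega> k. (if \<epsilon> k = 1 then XX k \<omega> else qadjoint (XX k \<omega>)) ** Y k \<omega>"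
  defines "A \<equiv> PiE {1..C} (\<lambda>c. PM {k \<in> {1..int n}. w k = c})"
  defines "\<beta> \<equiv> \<lambda>\<alpha> :: nat \<Rightarrow> int \<Rightarrow> int.
    sign_flip {1..int n} \<epsilon> \<circ> foldr (\<circ>) (map \<alpha> [1..<Suc C]) id \<circ> sign_flip {1..int n} \<epsilon>"
  defines "YRe_tr \<equiv> \<lambda>\<alpha> \<omega>.
    Re_tr n (inv (Kreweras \<phi>Re (\<beta> \<alpha>))) (inv (Kreweras \<phi>tr (\<beta> \<alpha>))) (\<lambda>k. Y k \<omega>)"
  assumes "prob_space M" and "n \<ge> 1" and "C \<ge> 1"
    and X_measurable: "\<And>c k. c \<in> {1..C} \<Longrightarrow> k \<in> {1..int n} \<Longrightarrow> X c k \<in> borel_measurable M"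
    and X_indep: "prob_space.indep_vars M (\<lambda>c. PiM {1..int n} (\<lambda>k. borel))
      (\<lambda>c \<omega>. \<lambda>k\<in>{1..int n}. X c k \<omega>) {1..C}"
    and X_integrable: "\<And>c I \<iota> \<eta>. c \<in> {1..C} \<Longrightarrow> I \<subseteq> {1..int n} \<Longrightarrow>
      (\<forall>k\<in>pm I. \<eta> k \<in> {1, -1}) \<Longrightarrow>
      integrable M (\<lambda>\<omega>. \<Prod>k\<in>I. qentry (X c k \<omega> $ \<iota> k $ \<iota> (- k)) (\<eta> k) (\<eta> (- k)))"
    and X_moments: "\<And>c I \<iota> \<eta>. c \<in> {1..C} \<Longrightarrow> I \<subseteq> {1..int n} \<Longrightarrow>
      (\<forall>k\<in>pm I. \<eta> k \<in> {1, -1}) \<Longrightarrow>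
      integral\<^sup>L M (\<lambda>\<omega>. \<Prod>k\<in>I. qentry (X c k \<omega> $ \<iota> k $ \<iota> (- k)) (\<eta> k) (\<eta> (- k))) =
      (\<Sum>\<alpha>\<in>{\<alpha> \<in> PM I. (\<forall>k\<in>pm I. \<iota> k = \<iota> (- \<alpha> k)) \<and>
              (\<forall>k\<in>pm I. sgn k * \<eta> k = sgn (\<alpha> k) * \<eta> (- \<alpha> k))}.
        of_int (\<Prod>k\<in>{k \<in> I. - k \<in> FD I \<alpha>}. \<eta> k * \<eta> (- k)) *
        of_nat (2 * CARD('N)) powi (int (num_cycles (pm I) \<alpha>) div 2 - int (card I)) *
        f c I \<alpha>)"
    and "\<phi>Re permutes {1..int n}" and "\<phi>tr permutes {1..int n}"
    and "w \<in> {1..int n} \<rightarrow> {1..C}" and "\<epsilon> \<in> {1..int n} \<rightarrow> {1, -1}"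
    and Y_measurable: "\<And>k. k \<in> {1..int n} \<Longrightarrow> Y k \<in> borel_measurable M"
    and XY_indep: "prob_space.indep_var M
      (PiM {1..int n} (\<lambda>k. borel)) (\<lambda>\<omega>. \<lambda>k\<in>{1..int n}. XX k \<omega>)
      (PiM {1..int n} (\<lambda>k. borel)) (\<lambda>\<omega>. \<lambda>k\<in>{1..int n}. Y k \<omega>)"
    and XY_integrable: "integrable M (\<lambda>\<omega>. Re_tr n (doubled \<phi>Re) (doubled \<phi>tr) (XY \<omega>))"
    and Y_integrable: "\<And>\<alpha>. \<alpha> \<in> A \<Longrightarrow> integrable M (YRe_tr \<alpha>)"
  shows "integral\<^sup>L M (\<lambda>\<omega>. Re_tr n (doubled \<phi>Re) (doubled \<phi>tr) (XY \<omega>)) =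
    (\<Sum>\<alpha>\<in>A.
      (-2) powi (euler_char {1..int n} \<phi>Re (\<beta> \<alpha>) - 2 * int (num_cycles {1..int n} \<phi>Re)) *
      of_nat CARD('N) powi
        (euler_char {1..int n} \<phi>tr (\<beta> \<alpha>) - 2 * int (num_cycles {1..int n} \<phi>tr)) *
      (\<Prod>c\<in>{1..C}. f c {k \<in> {1..int n}. w k = c} (\<alpha> c)) *
      integral\<^sup>L M (YRe_tr \<alpha>))"
proof -
  interpret prob_space M by fact
  let ?I = "{1..int n}"
  let ?N = "of_nat CARD('N) :: complex"
  interpret S: signed_index ?I by unfold_locales auto
  have \<phi>: "\<phi>Re permutes ?I" "\<phi>tr permutes ?I" by fact+
  have w: "w \<in> ?I \<rightarrow> {1..C}" by fact
  have e: "\<epsilon> k = 1 \<or> \<epsilon> k = - 1" if "k \<in> ?I" for k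
    using \<open>\<epsilon> \<in> ?I \<rightarrow> {1, - 1}\<close> that by auto
  define J where "J = (\<lambda>c. {k \<in> ?I. w k = c})"
  define a where "a = (\<lambda>\<alpha> :: nat \<Rightarrow> int \<Rightarrow> int. foldr (\<circ>) (map \<alpha> [1..<Suc C]) id)"
  define sf where "sf = sign_flip ?I \<epsilon>"
  have \<beta>_eq: "\<beta> \<alpha> = sf \<circ> a \<alpha> \<circ> sf" for \<alpha>
    by (simp only: \<beta>_def a_def sf_def)
  have A_eq: "A = PiE {1..C} (\<lambda>c. PM (J c))" by (simp add: A_def J_def)
  have colors: "set [1..<Suc C] = {1..C}" by auto
  have J_disjoint: "pm (J c) \<inter> pm (J d) = {}" if "c \<noteq> d" for c d
    using that by (auto simp: pm_def J_def)
  have J_subset: "pm (J c) \<subseteq> pm ?I" for c by (auto simp: pm_def J_def)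
  have inside: "a \<alpha> k = \<alpha> c k" if "\<alpha> \<in> A" "c \<in> {1..C}" "k \<in> pm (J c)" for \<alpha> c k
    unfolding a_def
  proof (rule foldr_permutes_inside[where S="\<lambda>c. pm (J c)"])
    show "\<alpha> d permutes pm (J d)" if "d \<in> set [1..<Suc C]" for d
      using \<open>\<alpha> \<in> A\<close> that unfolding A_eq colors by (auto simp: PM_def)
  qed (use that J_disjoint colors in auto)
  have outside: "a \<alpha> k = k" if "\<alpha> \<in> A" "k \<notin> pm ?I" for \<alpha> k
    unfolding a_def
  proof (rule foldr_permutes_outside[where S="\<lambda>c. pm (J c)"])
    show "\<alpha> d permutes pm (J d)" if "d \<in> set [1..<Suc C]" for d
      using \<open>\<alpha> \<in> A\<close> that unfolding A_eq colors by (auto simp: PM_def)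
  qed (use that J_subset in auto)
  have a_PM: "a \<alpha> \<in> PM ?I" if \<alpha>: "\<alpha> \<in> A" for \<alpha>
  proof (rule S.glued_PM[of "{1..C}" w \<alpha> "a \<alpha>"])
    show "\<alpha> c \<in> PM {k \<in> ?I. w k = c}" if "c \<in> {1..C}" for c
      using \<alpha> that unfolding A_eq J_def by (rule PiE_mem)
    show "a \<alpha> k = \<alpha> c k" if "c \<in> {1..C}" "k \<in> pm {k \<in> ?I. w k = c}" for c k
      using inside[OF \<alpha>] that unfolding J_def .
  qed (use w outside[OF \<alpha>] in auto)
  have finite_A: "finite A"
    unfolding A_eq by (intro finite_PiE finite_PM finite_subset[of "J _" ?I]) (auto simp: J_def)

  \<comment> \<open>The moments of the \<open>X\<^sub>k\<close> with adjoints, as a sum over the glued permutations.\<close>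
  define \<kappa> where "\<kappa> = (\<lambda>\<alpha>. of_nat (2 * CARD('N)) powi (int (num_cycles (pm ?I) (a \<alpha>)) div 2 - int (card ?I)) *
    (\<Prod>c\<in>{1..C}. f c (J c) (\<alpha> c)))"
  define X' where "X' = (\<lambda>k B :: quat^'N^'N. if \<epsilon> k = 1 then B else qadjoint B)"
  define mono where "mono = (\<lambda>i \<eta> x. \<Prod>k\<in>?I. qentry (X' k (x k) $ i k $ i (- k)) (\<eta> k) (\<eta> (- k)))"
  define mono_Y where "mono_Y = (\<lambda>i \<eta> y. \<Prod>k\<in>?I.
    qentry ((y k :: quat^'N^'N) $ i (- k) $ i (\<phi>tr k)) (\<eta> (- k)) (\<eta> (\<phi>Re k)))"
  define m where "m = (\<lambda>i \<eta>. \<integral>\<omega>. mono i \<eta> (\<lambda>k. XX k \<omega>) \<partial>M)"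
  have moments: "integrable M (\<lambda>\<omega>. mono i \<eta> (\<lambda>k. XX k \<omega>))"
    "m i \<eta> = of_int (\<Prod>k\<in>?I. S.flipped_signs \<epsilon> \<eta> k * S.flipped_signs \<epsilon> \<eta> (sign_flip ?I \<epsilon> k)) *
      (\<Sum>\<alpha>\<in>A. if (\<forall>k\<in>pm ?I. i (sign_flip ?I \<epsilon> k) = i (sign_flip ?I \<epsilon> (- a \<alpha> k))) \<and>
          (\<forall>k\<in>pm ?I. sgn k * S.flipped_signs \<epsilon> \<eta> k = sgn (a \<alpha> k) * S.flipped_signs \<epsilon> \<eta> (- a \<alpha> k))
        then of_int (\<Prod>k\<in>{k \<in> ?I. - k \<in> FD ?I (a \<alpha>)}.
          S.flipped_signs \<epsilon> \<eta> k * S.flipped_signs \<epsilon> \<eta> (- k)) * \<kappa> \<alpha>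
        else 0)"
    if \<eta>_in: "\<eta> \<in> pm ?I \<rightarrow>\<^sub>E {1, - 1}" for i :: "int \<Rightarrow> 'N" and \<eta>
  proof -
    have \<eta>: "\<eta> k = 1 \<or> \<eta> k = - 1" if "k \<in> pm ?I" for k using \<eta>_in that by auto
    define \<eta>' where "\<eta>' = S.flipped_signs \<epsilon> \<eta>"
    define i' where "i' = (\<lambda>k. i (sf k))"
    have \<eta>': "\<eta>' k = 1 \<or> \<eta>' k = - 1" if "k \<in> pm ?I" for k
      unfolding \<eta>'_def using e \<eta> that by (rule S.flipped_signs_values)
    have mono_eq: "mono i \<eta> (\<lambda>k. XX k \<omega>) = of_int (\<Prod>k\<in>?I. \<eta>' k * \<eta>' (sf k)) *
        (\<Prod>k\<in>?I. qentry (X (w k) k \<omega> $ i' k $ i' (- k)) (\<eta>' k) (\<eta>' (- k)))" for \<omega>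
      unfolding mono_def X'_def XX_def \<eta>'_def i'_def sf_def
      using e \<eta> by (rule S.prod_adjoints)
    have signs: "\<forall>k\<in>pm (J c). \<eta>' k \<in> {1, - 1}" for c using \<eta>' J_subset by blast
    have J_sub: "J c \<subseteq> ?I" for c by (auto simp: J_def)
    note X_int = X_integrable[OF _ J_sub signs, unfolded J_def]
    note joint = joint_moment[where I="?I" and D="{1..C}" and w=w and X=X and i=i' and j="\<lambda>k. i' (- k)"
        and r=\<eta>' and s="\<lambda>k. \<eta>' (- k)", OF _ _ w X_indep X_int]
    show "integrable M (\<lambda>\<omega>. mono i \<eta> (\<lambda>k. XX k \<omega>))"
      unfolding mono_eq using joint(1) by simp
    have "m i \<eta> = of_int (\<Prod>k\<in>?I. \<eta>' k * \<eta>' (sf k)) *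
        (\<integral>\<omega>. (\<Prod>k\<in>?I. qentry (X (w k) k \<omega> $ i' k $ i' (- k)) (\<eta>' k) (\<eta>' (- k))) \<partial>M)"
      unfolding m_def mono_eq by (rule integral_mult_right_zero)
    also have "(\<integral>\<omega>. (\<Prod>k\<in>?I. qentry (X (w k) k \<omega> $ i' k $ i' (- k)) (\<eta>' k) (\<eta>' (- k))) \<partial>M) =
        (\<Prod>c\<in>{1..C}. \<integral>\<omega>. (\<Prod>k\<in>J c. qentry (X c k \<omega> $ i' k $ i' (- k)) (\<eta>' k) (\<eta>' (- k))) \<partial>M)"
      unfolding J_def by (rule joint(2)) simp_all
    also have "\<dots> = (\<Prod>c\<in>{1..C}. \<Sum>\<alpha>\<in>{\<alpha> \<in> PM (J c). (\<forall>k\<in>pm (J c). i' k = i' (- \<alpha> k)) \<and>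
              (\<forall>k\<in>pm (J c). sgn k * \<eta>' k = sgn (\<alpha> k) * \<eta>' (- \<alpha> k))}.
        of_int (\<Prod>k\<in>{k \<in> J c. - k \<in> FD (J c) \<alpha>}. \<eta>' k * \<eta>' (- k)) *
        of_nat (2 * CARD('N)) powi (int (num_cycles (pm (J c)) \<alpha>) div 2 - int (card (J c))) * f c (J c) \<alpha>)"
      by (intro prod.cong refl X_moments J_sub signs)
    also have "\<dots> = (\<Sum>\<alpha>\<in>A. if (\<forall>k\<in>pm ?I. i' k = i' (- a \<alpha> k)) \<and>
          (\<forall>k\<in>pm ?I. sgn k * \<eta>' k = sgn (a \<alpha> k) * \<eta>' (- a \<alpha> k))
        then of_int (\<Prod>k\<in>{k \<in> ?I. - k \<in> FD ?I (a \<alpha>)}. \<eta>' k * \<eta>' (- k)) * \<kappa> \<alpha> else 0)"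
      unfolding \<kappa>_def A_eq unfolding J_def
      by (rule S.prod_moments[OF _ w])
         (use inside outside in \<open>simp_all add: A_eq J_def\<close>)
    finally show "m i \<eta> = of_int (\<Prod>k\<in>?I. S.flipped_signs \<epsilon> \<eta> k * S.flipped_signs \<epsilon> \<eta> (sign_flip ?I \<epsilon> k)) *
      (\<Sum>\<alpha>\<in>A. if (\<forall>k\<in>pm ?I. i (sign_flip ?I \<epsilon> k) = i (sign_flip ?I \<epsilon> (- a \<alpha> k))) \<and>
          (\<forall>k\<in>pm ?I. sgn k * S.flipped_signs \<epsilon> \<eta> k = sgn (a \<alpha> k) * S.flipped_signs \<epsilon> \<eta> (- a \<alpha> k))
        then of_int (\<Prod>k\<in>{k \<in> ?I. - k \<in> FD ?I (a \<alpha>)}.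
          S.flipped_signs \<epsilon> \<eta> k * S.flipped_signs \<epsilon> \<eta> (- k)) * \<kappa> \<alpha>
        else 0)"
      unfolding \<eta>'_def i'_def sf_def .
  qed

  \<comment> \<open>The trace of the products is a function \<open>F\<close> of the \<open>X\<^sub>k\<close> and the \<open>Y\<^sub>k\<close>, and each of its terms
    is a monomial in the former times a monomial in the latter.\<close>
  have Re_tr_eq: "Re_tr n \<pi> \<rho> B = 2 powi (- int (num_cycles (FD ?I \<pi>) \<pi>)) *
      ?N powi (- int (num_cycles (FD ?I \<rho>) \<rho>)) * S.trace_sum (FD ?I \<pi>) \<pi> \<rho> B"
    for \<pi> \<rho> and B :: "int \<Rightarrow> quat^'N^'N"
    by (simp add: Re_tr_def Let_def S.trace_sum_def)
  define c0 where "c0 = 2 powi (- int (num_cycles ?I \<phi>Re)) * ?N powi (- int (num_cycles ?I \<phi>tr))"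
  define F where "F = (\<lambda>x y. Re_tr n (doubled \<phi>Re) (doubled \<phi>tr) (\<lambda>k. X' k (x k) ** y k))"
  have F_eq: "F x y = c0 * (\<Sum>i\<in>pm ?I \<rightarrow>\<^sub>E UNIV. \<Sum>\<eta>\<in>pm ?I \<rightarrow>\<^sub>E {1, - 1}. mono i \<eta> x * mono_Y i \<eta> y)"
    for x y
    unfolding F_def Re_tr_eq S.FD_doubled[OF \<phi>(1)] S.FD_doubled[OF \<phi>(2)]
      S.num_cycles_doubled[OF \<phi>(1)] S.num_cycles_doubled[OF \<phi>(2)] S.trace_sum_doubled[OF \<phi>]
      c0_def mono_def mono_Y_def ..

  \<comment> \<open>For fixed \<open>Y\<^sub>k\<close> the expectation of \<open>F\<close> is the right-hand side \<open>G\<close> with these \<open>Y\<^sub>k\<close>.\<close>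
  define coeff where "coeff = (\<lambda>\<alpha>. (-2) powi (euler_char ?I \<phi>Re (\<beta> \<alpha>) - 2 * int (num_cycles ?I \<phi>Re)) *
      ?N powi (euler_char ?I \<phi>tr (\<beta> \<alpha>) - 2 * int (num_cycles ?I \<phi>tr)) *
      (\<Prod>c\<in>{1..C}. f c (J c) (\<alpha> c)))"
  define G where "G = (\<lambda>y :: int \<Rightarrow> quat^'N^'N. \<Sum>\<alpha>\<in>A. coeff \<alpha> *
    Re_tr n (inv (Kreweras \<phi>Re (\<beta> \<alpha>))) (inv (Kreweras \<phi>tr (\<beta> \<alpha>))) y)"
  have inner: "(\<integral>\<omega>. F (\<lambda>k\<in>?I. XX k \<omega>) y \<partial>M) = G y" for y
  proof -
    have "has_bochner_integral M (\<lambda>\<omega>. F (\<lambda>k\<in>?I. XX k \<omega>) y)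
        (c0 * (\<Sum>i\<in>pm ?I \<rightarrow>\<^sub>E UNIV. \<Sum>\<eta>\<in>pm ?I \<rightarrow>\<^sub>E {1, - 1}. m i \<eta> * mono_Y i \<eta> y))"
      unfolding F_eq
    proof (intro has_bochner_integral_mult_right has_bochner_integral_sum has_bochner_integral_mult_left)
      fix i :: "int \<Rightarrow> 'N" and \<eta> :: "int \<Rightarrow> int" assume "\<eta> \<in> pm ?I \<rightarrow>\<^sub>E {1, - 1}"
      moreover have "mono i \<eta> (\<lambda>k\<in>?I. XX k \<omega>) = mono i \<eta> (\<lambda>k. XX k \<omega>)" for \<omega>
        unfolding mono_def by (intro prod.cong) auto
      ultimately show "has_bochner_integral M (\<lambda>\<omega>. mono i \<eta> (\<lambda>k\<in>?I. XX k \<omega>)) (m i \<eta>)"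
        using moments(1) by (simp add: has_bochner_integral_iff m_def)
    qed
    then have "(\<integral>\<omega>. F (\<lambda>k\<in>?I. XX k \<omega>) y \<partial>M) =
        c0 * (\<Sum>i\<in>pm ?I \<rightarrow>\<^sub>E UNIV. \<Sum>\<eta>\<in>pm ?I \<rightarrow>\<^sub>E {1, - 1}. m i \<eta> * mono_Y i \<eta> y)"
      by (rule has_bochner_integral_integral_eq)
    also have "\<dots> = c0 * (\<Sum>\<alpha>\<in>A. \<kappa> \<alpha> *
        ((- 1) ^ (num_cycles ?I \<phi>Re + num_cycles (sf ` FD ?I (a \<alpha>)) (\<beta> \<alpha>) +
          num_cycles (FD ?I (inv (Kreweras \<phi>Re (\<beta> \<alpha>)))) (Kreweras \<phi>Re (\<beta> \<alpha>)) + card ?I) *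
        S.trace_sum (FD ?I (inv (Kreweras \<phi>Re (\<beta> \<alpha>)))) (inv (Kreweras \<phi>Re (\<beta> \<alpha>)))
          (inv (Kreweras \<phi>tr (\<beta> \<alpha>))) y))"
      unfolding mono_Y_def \<beta>_eq sf_def
      by (rule arg_cong[where f="(*) c0"]) (rule S.averaged_trace_sum[OF \<phi> e finite_A a_PM moments(2)])
    also have "\<dots> = G y"
      unfolding G_def sum_distrib_left
    proof (rule sum.cong)
      fix \<alpha> assume \<alpha>: "\<alpha> \<in> A"
      have \<beta>: "\<beta> \<alpha> \<in> PM ?I" unfolding \<beta>_eq sf_def
        by (rule S.sign_flip_conj_PM[OF e a_PM[OF \<alpha>]])
      have half: "S.half (\<beta> \<alpha>) (sf ` FD ?I (a \<alpha>))" unfolding \<beta>_eq sf_def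
        by (rule S.half_sign_flip_conj[OF e a_PM[OF \<alpha>]])
      have cycles: "num_cycles (pm ?I) (\<beta> \<alpha>) = num_cycles (pm ?I) (a \<alpha>)" unfolding \<beta>_eq sf_def
        by (rule S.num_cycles_sign_flip_conj[OF e a_PM[OF \<alpha>]])
      define b where "b = num_cycles (sf ` FD ?I (a \<alpha>)) (\<beta> \<alpha>)"
      define r where "r = (\<lambda>\<psi>. num_cycles (FD ?I (inv (Kreweras \<psi> (\<beta> \<alpha>)))) (Kreweras \<psi> (\<beta> \<alpha>)))"
      have r_eq: "num_cycles (FD ?I (inv (Kreweras \<psi> (\<beta> \<alpha>)))) (Kreweras \<psi> (\<beta> \<alpha>)) = r \<psi>" for \<psi>
        by (simp only: r_def)
      have b: "int (num_cycles (pm ?I) (\<beta> \<alpha>)) div 2 = int b"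
        unfolding b_def by (rule S.num_cycles_pm_div_2[OF \<beta> half])
      have euler: "euler_char ?I \<psi> (\<beta> \<alpha>) = int (num_cycles ?I \<psi>) + int b + int (r \<psi>) - int (card ?I)"
        and r_inv: "num_cycles (FD ?I (inv (Kreweras \<psi> (\<beta> \<alpha>)))) (inv (Kreweras \<psi> (\<beta> \<alpha>))) = r \<psi>"
        if \<psi>: "\<psi> permutes ?I" for \<psi>
      proof -
        note K = S.Kreweras_PM[OF \<psi> \<beta>]
        have "int (num_cycles (pm ?I) (Kreweras \<psi> (\<beta> \<alpha>))) div 2 = int (r \<psi>)"
          unfolding r_def S.FD_inv[OF K] by (rule S.num_cycles_pm_div_2[OF K S.half_FD[OF K]])
        moreover have "int (num_cycles (pm ?I) (doubled \<psi>)) div 2 = int (num_cycles ?I \<psi>)"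
          using S.num_cycles_pm_div_2[OF S.doubled_PM[OF \<psi>] S.half_doubled[OF \<psi>]]
          by (simp add: S.num_cycles_doubled[OF \<psi>])
        ultimately show "euler_char ?I \<psi> (\<beta> \<alpha>) =
            int (num_cycles ?I \<psi>) + int b + int (r \<psi>) - int (card ?I)"
          unfolding euler_char_def S.doubled_eq[OF \<psi>, symmetric] b by simp
        show "num_cycles (FD ?I (inv (Kreweras \<psi> (\<beta> \<alpha>)))) (inv (Kreweras \<psi> (\<beta> \<alpha>))) = r \<psi>"
          unfolding r_def by (rule S.num_cycles_inv[OF K])
      qed
      have two_N: "of_nat (2 * CARD('N)) = 2 * ?N" by simp
      show "c0 * (\<kappa> \<alpha> * ((- 1) ^ (num_cycles ?I \<phi>Re + num_cycles (sf ` FD ?I (a \<alpha>)) (\<beta> \<alpha>) +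
          num_cycles (FD ?I (inv (Kreweras \<phi>Re (\<beta> \<alpha>)))) (Kreweras \<phi>Re (\<beta> \<alpha>)) + card ?I) *
        S.trace_sum (FD ?I (inv (Kreweras \<phi>Re (\<beta> \<alpha>)))) (inv (Kreweras \<phi>Re (\<beta> \<alpha>)))
          (inv (Kreweras \<phi>tr (\<beta> \<alpha>))) y)) =
        coeff \<alpha> * Re_tr n (inv (Kreweras \<phi>Re (\<beta> \<alpha>))) (inv (Kreweras \<phi>tr (\<beta> \<alpha>))) y"
        unfolding c0_def \<kappa>_def coeff_def Re_tr_eq euler[OF \<phi>(1)] euler[OF \<phi>(2)]
          r_inv[OF \<phi>(1)] r_inv[OF \<phi>(2)] cycles[symmetric] b two_N
          b_def[symmetric] r_eq
        by (rule coefficient_identity) simp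
    qed simp
    finally show ?thesis .
  qed

  \<comment> \<open>It remains to integrate \<open>G\<close> over the \<open>Y\<^sub>k\<close>.\<close>
  have component: "(\<lambda>z. fst z k) \<in> borel_measurable (PiM ?I (\<lambda>k. borel) \<Otimes>\<^sub>M PiM ?I (\<lambda>k. borel))"
    "(\<lambda>z. snd z k) \<in> borel_measurable (PiM ?I (\<lambda>k. borel) \<Otimes>\<^sub>M PiM ?I (\<lambda>k. borel))"
    if "k \<in> ?I" for k
    using measurable_compose[OF measurable_fst measurable_component_singleton[OF that]]
      measurable_compose[OF measurable_snd measurable_component_singleton[OF that]] by auto
  have F_measurable: "case_prod F \<in> borel_measurable (PiM ?I (\<lambda>k. borel) \<Otimes>\<^sub>M PiM ?I (\<lambda>k. borel))"
  proof -
    have "(\<lambda>z. qentry (X' k (fst z k) $ i $ j) r s)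
        \<in> borel_measurable (PiM ?I (\<lambda>k. borel) \<Otimes>\<^sub>M PiM ?I (\<lambda>k. borel))"
      if "k \<in> ?I" for k i j r s
      unfolding X'_def using borel_measurable_signed_entry[OF component(1)[OF that]]
      by (cases "\<epsilon> k = 1") simp_all
    then have "(\<lambda>z. mono i \<eta> (fst z)) \<in> borel_measurable (PiM ?I (\<lambda>k. borel) \<Otimes>\<^sub>M PiM ?I (\<lambda>k. borel))"
      for i \<eta> unfolding mono_def by (intro borel_measurable_prod)
    moreover have "(\<lambda>z. mono_Y i \<eta> (snd z)) \<in> borel_measurable (PiM ?I (\<lambda>k. borel) \<Otimes>\<^sub>M PiM ?I (\<lambda>k. borel))"
      for i \<eta> unfolding mono_Y_def
      by (intro borel_measurable_prod borel_measurable_signed_entry component)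
    ultimately show ?thesis unfolding case_prod_beta' F_eq
      by (intro borel_measurable_times borel_measurable_const borel_measurable_sum)
  qed
  have G_measurable: "G \<in> borel_measurable (PiM ?I (\<lambda>k. borel))"
    unfolding G_def
    by (intro borel_measurable_times borel_measurable_const borel_measurable_sum
        borel_measurable_Re_tr measurable_component_singleton)
  have F_XY: "F (\<lambda>k\<in>?I. XX k \<omega>) (\<lambda>k\<in>?I. Y k \<omega>) = Re_tr n (doubled \<phi>Re) (doubled \<phi>tr) (XY \<omega>)" for \<omega>
    unfolding F_def by (rule Re_tr_cong) (simp add: XY_def X'_def)
  have "(\<integral>\<omega>. Re_tr n (doubled \<phi>Re) (doubled \<phi>tr) (XY \<omega>) \<partial>M) = (\<integral>\<omega>. G (\<lambda>k\<in>?I. Y k \<omega>) \<partial>M)"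
    unfolding F_XY[symmetric]
    by (rule integral_indep_var[OF XY_indep F_measurable _ inner G_measurable])
       (use XY_integrable in \<open>simp only: F_XY\<close>)
  also have "\<dots> = (\<integral>\<omega>. (\<Sum>\<alpha>\<in>A. coeff \<alpha> * YRe_tr \<alpha> \<omega>) \<partial>M)"
  proof -
    have "Re_tr n \<pi> \<rho> (\<lambda>k\<in>?I. Y k \<omega>) = Re_tr n \<pi> \<rho> (\<lambda>k. Y k \<omega>)" for \<pi> \<rho> \<omega>
      by (rule Re_tr_cong) simp
    then show ?thesis by (simp only: G_def YRe_tr_def)
  qed
  also have "\<dots> = (\<Sum>\<alpha>\<in>A. coeff \<alpha> * (\<integral>\<omega>. YRe_tr \<alpha> \<omega> \<partial>M))"
    using Y_integrable by (subst Bochner_Integration.integral_sum) auto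
  finally show ?thesis unfolding coeff_def J_def .
qed

end
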